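(* A permutation $w$ is $2$-vexillary if and only if it avoids all of the following $35$ patterns: $21543$, $231564$, $315264$, $5271436$, $26487153$, $54726183$, $64821537$, $32154$, $241365$, $426153$, $5276143$, $26581437$, $54762183$, $64872153$, $214365$, $241635$, $2547163$, $5472163$, $26587143$, $61832547$, $65821437$, $214635$, $312645$, $4265173$, $25476183$, $51736284$, $61837254$, $65827143$, $215364$, $314265$, $5173264$, $26481537$, $51763284$, $61873254$, $65872143$.
   Context: Permutations are elements of $S_\infty=\bigcup_{n\ge 0} S_n$, in one-line notation. For a sequence $x=x(1)\cdots x(m)$ of distinct integers, $\mathrm{fl}(x)$ is the unique $v\in S_m$ with $v(i)<v(j)$ iff $x(i)<x(j)$. A permutation $w$ contains $v\in S_m$ as a pattern if there are $i_1<\cdots<i_m$ with $\mathrm{fl}(w(i_1)\cdots w(i_m))=v$; otherwise $w$ avoids $v$. Let $s_i=(i\ i{+}1)$. A reduced word of $w$ is a minimal-length sequence $(a_1,\dots,a_{\ell})$ with $s_{a_1}\cdots s_{a_{\ell}}=w$ (right multiplication by $s_i$ swaps the entries in positions $i$ and $i+1$). $\mathcal{EG}(w)$ is the set of semistandard Young tableaux (English notation) whose column word, obtained by reading each column from bottom to top, starting with the leftmost column and moving right, is a reduced word of $w$. Put $EG(w)=|\mathcal{EG}(w)|$. A permutation $w$ is $2$-vexillary if $EG(w)\le 2$. *)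

theory Defs
  imports "HOL-Combinatorics.Permutations"
begin

text \<open>Elements of \<open>S\<^sub>\<infinity>\<close> act on \<open>{1, 2, 3, \<dots>}\<close>; as functions on \<^typ>\<open>nat\<close> they fix \<open>0\<close>.\<close>

definition S_infty :: "(nat \<Rightarrow> nat) set" where
  "S_infty = (\<Union>n. {w. w permutes {1..n}})"

text \<open>A member of \<open>S\<^sub>m\<close> in one-line notation: the list \<open>[v(1), \<dots>, v(m)]\<close>.\<close>

definition one_line :: "nat \<Rightarrow> nat list set" where
  "one_line m = {v. length v = m \<and> set v = {1..m}}"

definition fl :: "'a::linorder list \<Rightarrow> nat list" where
  "fl x = (THE v. v \<in> one_line (length x) \<and>
     (\<forall>i<length x. \<forall>j<length x. v ! i < v ! j \<longleftrightarrow> x ! i < x ! j))"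

definition contains_pattern :: "(nat \<Rightarrow> nat) \<Rightarrow> nat list \<Rightarrow> bool" where
  "contains_pattern w v \<longleftrightarrow>
     (\<exists>is. length is = length v \<and> set is \<subseteq> {1..} \<and> sorted_wrt (<) is \<and> fl (map w is) = v)"

definition avoids_pattern :: "(nat \<Rightarrow> nat) \<Rightarrow> nat list \<Rightarrow> bool" where
  "avoids_pattern w v \<longleftrightarrow> \<not> contains_pattern w v"

definition simple_transposition :: "nat \<Rightarrow> nat \<Rightarrow> nat" where
  "simple_transposition i = Transposition.transpose i (i + 1)"

fun word_perm :: "nat list \<Rightarrow> nat \<Rightarrow> nat" where
  "word_perm [] = id"
| "word_perm (a # as) = simple_transposition a \<circ> word_perm as"

definition reduced_word :: "(nat \<Rightarrow> nat) \<Rightarrow> nat list \<Rightarrow> bool" where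
  "reduced_word w as \<longleftrightarrow> set as \<subseteq> {1..} \<and> word_perm as = w \<and>
     (\<forall>bs. set bs \<subseteq> {1..} \<and> word_perm bs = w \<longrightarrow> length as \<le> length bs)"

text \<open>
  A tableau is the list of its rows, from top to bottom.  \<^const>\<open>List.transpose\<close> gives its
  columns, from left to right, each one listed from top to bottom.  Rows are required to be
  nonempty so that every tableau has exactly one representation.
\<close>

definition semistandard :: "nat list list \<Rightarrow> bool" where
  "semistandard T \<longleftrightarrow>
     [] \<notin> set T \<and> sorted_wrt (\<ge>) (map length T) \<and>
     (\<forall>r\<in>set T. set r \<subseteq> {1..} \<and> sorted_wrt (\<le>) r) \<and>
     (\<forall>c\<in>set (List.transpose T). sorted_wrt (<) c)"

definition column_word :: "nat list list \<Rightarrow> nat list" where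
  "column_word T = concat (map rev (List.transpose T))"

definition EG_tableaux :: "(nat \<Rightarrow> nat) \<Rightarrow> nat list list set" where
  "EG_tableaux w = {T. semistandard T \<and> reduced_word w (column_word T)}"

text \<open>
  For \<open>w\<close> in \<open>S\<^sub>n\<close> the set \<^term>\<open>EG_tableaux w\<close> is finite (reduced words of \<open>w\<close> have a fixed
  length and only use letters below \<open>n\<close>), so \<^const>\<open>card\<close> is the true cardinality.
\<close>

definition EG :: "(nat \<Rightarrow> nat) \<Rightarrow> nat" where
  "EG w = card (EG_tableaux w)"

definition two_vexillary :: "(nat \<Rightarrow> nat) \<Rightarrow> bool" where
  "two_vexillary w \<longleftrightarrow> EG w \<le> 2"

definition two_vexillary_patterns :: "nat list list" where
  "two_vexillary_patterns = [
    [2, 1, 5, 4, 3],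
    [2, 3, 1, 5, 6, 4],
    [3, 1, 5, 2, 6, 4],
    [5, 2, 7, 1, 4, 3, 6],
    [2, 6, 4, 8, 7, 1, 5, 3],
    [5, 4, 7, 2, 6, 1, 8, 3],
    [6, 4, 8, 2, 1, 5, 3, 7],
    [3, 2, 1, 5, 4],
    [2, 4, 1, 3, 6, 5],
    [4, 2, 6, 1, 5, 3],
    [5, 2, 7, 6, 1, 4, 3],
    [2, 6, 5, 8, 1, 4, 3, 7],
    [5, 4, 7, 6, 2, 1, 8, 3],
    [6, 4, 8, 7, 2, 1, 5, 3],
    [2, 1, 4, 3, 6, 5],
    [2, 4, 1, 6, 3, 5],
    [2, 5, 4, 7, 1, 6, 3],
    [5, 4, 7, 2, 1, 6, 3],
    [2, 6, 5, 8, 7, 1, 4, 3],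
    [6, 1, 8, 3, 2, 5, 4, 7],
    [6, 5, 8, 2, 1, 4, 3, 7],
    [2, 1, 4, 6, 3, 5],
    [3, 1, 2, 6, 4, 5],
    [4, 2, 6, 5, 1, 7, 3],
    [2, 5, 4, 7, 6, 1, 8, 3],
    [5, 1, 7, 3, 6, 2, 8, 4],
    [6, 1, 8, 3, 7, 2, 5, 4],
    [6, 5, 8, 2, 7, 1, 4, 3],
    [2, 1, 5, 3, 6, 4],
    [3, 1, 4, 2, 6, 5],
    [5, 1, 7, 3, 2, 6, 4],
    [2, 6, 4, 8, 1, 5, 3, 7],
    [5, 1, 7, 6, 3, 2, 8, 4],
    [6, 1, 8, 7, 3, 2, 5, 4],
    [6, 5, 8, 7, 2, 1, 4, 3]]"

lemma two_vexillary_patterns_check: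
  "length two_vexillary_patterns = 35" "distinct two_vexillary_patterns"
  "\<forall>v\<in>set two_vexillary_patterns. v \<in> one_line (length v)"
proof -
  show "length two_vexillary_patterns = 35" "distinct two_vexillary_patterns"
    by (simp_all add: two_vexillary_patterns_def)
  have "list_all (\<lambda>v. sort v = [1..<Suc (length v)]) two_vexillary_patterns"
    by (simp add: two_vexillary_patterns_def upt_rec)
  moreover have "v \<in> one_line (length v)" if "sort v = [1..<Suc (length v)]" for v :: "nat list"
  proof -
    have "set v = set (sort v)" by simp
    also have "\<dots> = {1..length v}" using that by auto
    finally show ?thesis by (simp add: one_line_def)
  qed
  ultimately show "\<forall>v\<in>set two_vexillary_patterns. v \<in> one_line (length v)"
    by (simp add: list_all_iff)
qed

end

theory Submission
  imports Defs "HOL-Library.Sublist"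
begin

section \<open>Reduced words of a permutation as descent-by-descent sortings of its inverse\<close>

section \<open>Reduced words as sorting words\<close>

text \<open>A reduced word of \<open>w\<close> is the same as a way of sorting \<open>inv w\<close>
  by exchanging adjacent entries at descents (\<open>reduced_word_iff_sorts\<close>). So
  \<open>EG w\<close> counts the tableaux whose column word sorts y = \<open>inv w\<close>
  (\<open>card_EG_tableaux\<close>); call this number e(y). The proof decides when e(y) is at least
  2 or at least 3 along the transition tree of Lascoux and Schuetzenberger.

  The transition equation \<open>tableaux_transition\<close> says that for given u and r the values
  of e at the Bruhat covers u t_rj and at the covers u t_ir have the same sum. For words cut into
  decreasing columns, without any condition on rows, it comes from a derivation: skip one letter of
  the word and weight the result by the difference of a function at the two positions concerned.
  Read letter by letter, this is a sum over Bruhat covers (\<open>deriv_eq_sum_covers\<close>); read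
  column by column, it telescopes to zero (\<open>sum_deriv_tuples\<close>). The conditions on rows
  enter through a sign-reversing exchange in the manner of Fomin and Greene. It rests on the fact
  that the noncommutative elementary symmetric functions in the nilCoxeter algebra commute
  (\<open>El_commute\<close>), and it expresses the number of tableaux of a given shape as an
  alternating sum of counts of column tuples, a dual Jacobi-Trudi determinant
  (\<open>card_tabloids_eq\<close>). As this expression is linear, the transition equation passes to
  e.

  Let r be the last descent of y and s the last position after r with a value below y(r). The
  transition equation at u = y t_rs writes e(y) as the sum of e over the children
  \<open>cycle3 y i r s\<close>, one for each branch i (\<open>card_tableaux_branches\<close>). If
  there is no branch, the least value m of the interval \<open>{m..n}\<close> on which y acts sits
  at r+1. It forces the first column of every tableau, and removing that column leaves e unchanged
  (\<open>card_tableaux_cycle\<close>). The recursion ends at the identity, where e = 1.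

  The induction \<open>classified_permutation\<close> carries three facts together: e is at least 1;
  e is at least 2 iff 2143 occurs; e is at least 3 iff one of the 35 patterns occurs. With three
  branches y contains 32154 and e is at least 3. With two branches y contains 2143, and e(y) is at
  least 3 iff one of the children contains 2143, which has to match the occurrence of one of the 35
  patterns in y. With one branch, y and its child have to contain the same kinds of patterns. Each
  of these implications concerns an occurrence of at most 8 points together with three or four
  marked points, hence finitely many relative positions. They are settled by evaluation
  (\<open>checkA_35\<close> and its companions), and the locale \<open>config\<close> translates
  between permutations and the evaluated coordinates. Since the list of 35 patterns is closed under
  inversion, \<open>inv w\<close> may be replaced by \<open>w\<close> at the end.\<close>

abbreviation adj :: "nat \<Rightarrow> nat \<Rightarrow> nat" where
  "adj a \<equiv> Transposition.transpose a (Suc a)"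

lemma adj_adj [simp]: "y \<circ> adj a \<circ> adj a = y"
  by (simp add: comp_assoc)

text \<open>Each letter has to remove an inversion, so these are the reduced words that can be split
  off from \<open>y\<close>; \<open>word_perm\<close> acts on positions.\<close>

primrec descending :: "(nat \<Rightarrow> nat) \<Rightarrow> nat list \<Rightarrow> bool" where
  "descending y [] \<longleftrightarrow> True"
| "descending y (a # as) \<longleftrightarrow> y (Suc a) < y a \<and> descending (y \<circ> adj a) as"

definition sorts :: "(nat \<Rightarrow> nat) \<Rightarrow> nat list \<Rightarrow> bool" where
  "sorts y as \<longleftrightarrow> descending y as \<and> y \<circ> word_perm as = id"

lemma word_perm_Cons: "word_perm (a # as) = adj a \<circ> word_perm as"
  by (simp add: simple_transposition_def)

declare word_perm.simps(2) [simp del]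

lemma word_perm_append: "word_perm (as @ bs) = word_perm as \<circ> word_perm bs"
  by (induction as) (simp_all add: word_perm_Cons comp_assoc)

lemma descending_append:
  "descending y (as @ bs) \<longleftrightarrow> descending y as \<and> descending (y \<circ> word_perm as) bs"
  by (induction as arbitrary: y) (simp_all add: word_perm_Cons comp_assoc)

lemma sorts_Nil [simp]: "sorts y [] \<longleftrightarrow> y = id"
  by (simp add: sorts_def)

lemma sorts_Cons: "sorts y (a # as) \<longleftrightarrow> y (Suc a) < y a \<and> sorts (y \<circ> adj a) as"
  by (auto simp: sorts_def word_perm_Cons comp_assoc)

lemma sorts_append: "sorts y (as @ bs) \<longleftrightarrow> descending y as \<and> sorts (y \<circ> word_perm as) bs"
  by (auto simp: sorts_def word_perm_append descending_append comp_assoc)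

lemma permutes_comp_adj:
  fixes y :: "nat \<Rightarrow> nat"
  assumes "y permutes A" "a \<in> A" "Suc a \<in> A"
  shows "y \<circ> adj a permutes A"
  using assms by (intro permutes_compose permutes_swap_id)

definition invs :: "(nat \<Rightarrow> nat) \<Rightarrow> (nat \<times> nat) set" where
  "invs y = {(i, j). i < j \<and> y j < y i}"

lemma invs_id [simp]: "invs id = {}"
  by (auto simp: invs_def)

lemma invs_subset:
  assumes "y permutes {..n}"
  shows "invs y \<subseteq> {..n} \<times> {..n}"
proof -
  have y1: "y k = k" if "k > n" for k
    using assms that by (auto simp: permutes_def)
  have y2: "y k \<le> n" if "k \<le> n" for k
    using permutes_in_image[OF assms, of k] that by simp
  show ?thesis
  proof (clarsimp simp: invs_def)
    fix i j assume "i < j" "y j < y i"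
    then have "j \<le> n"
      using y1[of j] y1[of i] y2[of i] by (cases "j \<le> n"; cases "i \<le> n") auto
    with \<open>i < j\<close> show "i \<le> n \<and> j \<le> n" by simp
  qed
qed

lemma finite_invs: "y permutes {..n} \<Longrightarrow> finite (invs y)"
  by (rule finite_subset[OF invs_subset]) auto

text \<open>Relabelling both positions by \<open>adj a\<close> matches the inversions of the two
  permutations, except for \<open>(a, Suc a)\<close>, which is an inversion of \<open>y\<close>
  only.\<close>

lemma card_invs_comp_adj:
  assumes "finite (invs y)" "y (Suc a) < y a"
  shows "finite (invs (y \<circ> adj a))" "card (invs y) = Suc (card (invs (y \<circ> adj a)))"
proof -
  let ?f = "map_prod (adj a) (adj a)"
  have eq: "invs y - {(a, Suc a)} = ?f ` invs (y \<circ> adj a)" (is "?L = ?R")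
  proof
    show "?L \<subseteq> ?R"
    proof
      fix p assume "p \<in> ?L"
      then obtain i j where p: "p = (i, j)" "i < j" "y j < y i" "(i, j) \<noteq> (a, Suc a)"
        by (auto simp: invs_def)
      then have "adj a i < adj a j"
        by (auto simp: Transposition.transpose_def)
      then have "?f p \<in> invs (y \<circ> adj a)"
        using p by (auto simp: invs_def)
      then show "p \<in> ?R"
        by (rule rev_image_eqI) (simp add: p)
    qed
    show "?R \<subseteq> ?L"
    proof
      fix p assume "p \<in> ?R"
      then obtain i j where p: "p = (adj a i, adj a j)" "i < j" "y (adj a j) < y (adj a i)"
        by (auto simp: invs_def)
      moreover have "(i, j) \<noteq> (a, Suc a)"
        using p(3) assms(2) by auto
      ultimately show "p \<in> ?L"
        by (auto simp: invs_def Transposition.transpose_def split: if_splits)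
    qed
  qed
  have inj: "inj ?f"
    by (intro prod.inj_map) (auto intro: inj_on_inverseI[where g="adj a"])
  have "finite (?f ` invs (y \<circ> adj a))"
    using assms(1) by (subst eq[symmetric]) simp
  then show fin: "finite (invs (y \<circ> adj a))"
    using inj finite_imageD inj_on_subset by blast
  have "card (invs y - {(a, Suc a)}) = card (invs (y \<circ> adj a))"
    using eq card_image[OF inj_on_subset[OF inj]] by (metis subset_UNIV)
  moreover have "(a, Suc a) \<in> invs y"
    using assms(2) by (auto simp: invs_def)
  ultimately show "card (invs y) = Suc (card (invs (y \<circ> adj a)))"
    using assms(1) by (metis card.remove)
qed

lemma sorts_length:
  assumes "sorts y as" "finite (invs y)"
  shows "length as = card (invs y)"
  using assms
proof (induction as arbitrary: y)
  case Nil
  then show ?case by (simp add: invs_def)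
next
  case (Cons a as)
  then show ?case
    using card_invs_comp_adj[of y a] by (auto simp: sorts_Cons)
qed

text \<open>One letter changes the number of inversions by one, up or down. A word leading to the
  identity therefore has at least as many letters as there are inversions, and with equality every
  letter goes down.\<close>

lemma invs_le_length:
  fixes y :: "nat \<Rightarrow> nat"
  assumes "inj y" "y \<circ> word_perm as = id" "finite (invs y)"
  shows "card (invs y) \<le> length as \<and> (card (invs y) = length as \<longrightarrow> sorts y as)"
  using assms
proof (induction as arbitrary: y)
  case Nil
  have "y = id" using Nil(2) by (simp only: word_perm.simps(1) comp_id)
  then have "card (invs y) \<le> length [] \<and> (card (invs y) = length [] \<longrightarrow> sorts y [])"
    by simp
  then show ?case .
next
  case (Cons a as)
  have inj: "inj (y \<circ> adj a)" using Cons.prems(1) by (simp add: inj_compose)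
  have id: "(y \<circ> adj a) \<circ> word_perm as = id"
    using Cons.prems(2) by (simp only: word_perm_Cons comp_assoc)
  have IH: "card (invs (y \<circ> adj a)) \<le> length as \<and>
      (card (invs (y \<circ> adj a)) = length as \<longrightarrow> sorts (y \<circ> adj a) as)"
    if "finite (invs (y \<circ> adj a))"
    using Cons.IH[OF inj id that] .
  consider "y (Suc a) < y a" | "y a < y (Suc a)"
    using Cons.prems(1) by (metis inj_def n_not_Suc_n nat_neq_iff)
  then show ?case
  proof cases
    case 1
    then show ?thesis
      using IH card_invs_comp_adj[OF Cons.prems(3) 1] by (auto simp: sorts_Cons)
  next
    case 2
    \<comment> \<open>The letter creates an inversion here, so the bound for the rest of the word is
      larger by one than required and equality cannot occur.\<close>
    define z where "z = y \<circ> adj a"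
    have z: "z (Suc a) < z a" "y = z \<circ> adj a"
      using 2 by (simp_all add: z_def)
    have fin: "finite (invs z)"
    proof -
      have "invs z \<subseteq> insert (a, Suc a) (map_prod (adj a) (adj a) ` invs y)"
      proof
        fix p assume "p \<in> invs z"
        then obtain i j where p: "p = (i, j)" "i < j" "z j < z i"
          by (auto simp: invs_def)
        show "p \<in> insert (a, Suc a) (map_prod (adj a) (adj a) ` invs y)"
        proof (cases "(i, j) = (a, Suc a)")
          case False
          then have "adj a i < adj a j"
            using p by (auto simp: Transposition.transpose_def)
          then have "map_prod (adj a) (adj a) p \<in> invs y"
            using p by (auto simp: invs_def z_def)
          then show ?thesis
            by (intro insertI2 rev_image_eqI) (auto simp: p)
        qed (simp add: p)
      qed
      then show ?thesis using Cons.prems(3) finite_subset by blast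
    qed
    have "card (invs z) = Suc (card (invs y))"
      using card_invs_comp_adj(2)[OF fin z(1)] z(2) by simp
    then show ?thesis
      using IH fin by (auto simp: z_def)
  qed
qed

lemma permutes_no_descent:
  assumes "y permutes {..n}" "\<And>a. a < n \<Longrightarrow> y a < y (Suc a)"
  shows "y = id"
proof -
  have "y a < y (Suc a)" for a
    using assms permutes_in_image[OF assms(1), of a] permutes_not_in[OF assms(1)]
    by (cases "a < n"; cases "a = n") auto
  then have mono: "strict_mono y" by (simp add: strict_mono_Suc_iff)
  have "y k = k" for k
  proof (induction k rule: less_induct)
    case (less k)
    obtain l where l: "y l = k" using permutes_surj[OF assms(1)] by (metis surjD)
    have "k \<le> y k" using mono strict_mono_imp_increasing by blast
    moreover have "\<not> l < k" using less[of l] l by auto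
    ultimately show ?case
      using l mono by (metis linorder_not_less nless_le strict_mono_less)
  qed
  then show ?thesis by auto
qed

lemma sorts_exists:
  assumes "y permutes {..n}"
  shows "\<exists>as. sorts y as"
  using assms
proof (induction "card (invs y)" arbitrary: y rule: less_induct)
  case less
  show ?case
  proof (cases "\<exists>a<n. y (Suc a) < y a")
    case True
    then obtain a where a: "a < n" "y (Suc a) < y a" by blast
    have "y \<circ> adj a permutes {..n}"
      using less.prems a by (intro permutes_comp_adj) auto
    then obtain as where "sorts (y \<circ> adj a) as"
      using less.hyps card_invs_comp_adj(2)[OF finite_invs[OF less.prems] a(2)] by auto
    with a show ?thesis by (metis sorts_Cons)
  next
    case False
    then have "y = id"
      using less.prems permutes_inj[OF less.prems]
      by (intro permutes_no_descent) (auto simp: inj_def, metis n_not_Suc_n nat_neq_iff)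
    then show ?thesis by (metis sorts_Nil)
  qed
qed

lemma sorts_letters:
  fixes y :: "nat \<Rightarrow> nat"
  assumes "y permutes {m..n}" "sorts y as"
  shows "set as \<subseteq> {m..<n}"
  using assms
proof (induction as arbitrary: y)
  case (Cons a as)
  have d: "y (Suc a) < y a" using Cons.prems(2) by (simp add: sorts_Cons)
  have out: "y k = k" if "k \<notin> {m..n}" for k
    using permutes_not_in[OF Cons.prems(1) that] .
  have inn: "m \<le> y k \<and> y k \<le> n" if "m \<le> k" "k \<le> n" for k
    using permutes_in_image[OF Cons.prems(1), of k] that by simp
  have a: "m \<le> a \<and> a < n"
    using d out[of a] out[of "Suc a"] inn[of a] inn[of "Suc a"]
    by (cases "m \<le> a"; cases "a < n"; cases "Suc a = m"; cases "a = n") auto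
  then have "y \<circ> adj a permutes {m..n}"
    using Cons.prems by (intro permutes_comp_adj) auto
  then have "set as \<subseteq> {m..<n}"
    using Cons.IH Cons.prems(2) unfolding sorts_Cons by blast
  with a show ?case by simp
qed simp

text \<open>Some sorting word exists and has as many letters as \<open>inv w\<close> has inversions.
  A word of minimal length thus attains the bound of \<open>invs_le_length\<close>, whose equality
  case makes it descending.\<close>

lemma reduced_word_iff_sorts:
  assumes "w permutes {1..n}"
  shows "reduced_word w as \<longleftrightarrow> sorts (inv w) as"
proof -
  define y where "y = inv w"
  have y: "y permutes {1..n}" using permutes_inv[OF assms] by (simp add: y_def)
  have y0: "y permutes {..n}" by (rule permutes_subset[OF y]) auto
  have fin: "finite (invs y)" using finite_invs[OF y0] .
  have eq: "word_perm bs = w \<longleftrightarrow> y \<circ> word_perm bs = id" for bs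
    using permutes_inv_o[OF assms] unfolding y_def
    by (metis comp_assoc id_comp)
  obtain bs where bs: "sorts y bs" using sorts_exists[OF y0] by blast
  have bs': "word_perm bs = w" "set bs \<subseteq> {1..}" "length bs = card (invs y)"
    using bs sorts_letters[OF y bs] sorts_length[OF bs fin] by (auto simp: eq sorts_def)
  have "sorts y as" if "reduced_word w as"
  proof -
    have "y \<circ> word_perm as = id" "length as \<le> length bs"
      using that bs' by (auto simp: reduced_word_def eq)
    then show ?thesis
      using invs_le_length[of y as] permutes_inj[OF y] fin bs' by auto
  qed
  moreover have "reduced_word w as" if as: "sorts y as"
    using as sorts_letters[OF y as] sorts_length[OF as fin] invs_le_length[of y] permutes_inj[OF y] fin
    by (auto simp: reduced_word_def eq sorts_def)
  ultimately show ?thesis by (auto simp: y_def)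
qed

lemma descending_permutes:
  fixes y :: "nat \<Rightarrow> nat"
  assumes "y permutes {m..n}" "descending y as"
  shows "y \<circ> word_perm as permutes {m..n} \<and> set as \<subseteq> {m..<n}"
  using assms
proof (induction as arbitrary: y)
  case Nil
  then show ?case by simp
next
  case (Cons a as)
  have d: "y (Suc a) < y a" using Cons.prems(2) by simp
  have out: "y k = k" if "k \<notin> {m..n}" for k
    using permutes_not_in[OF Cons.prems(1) that] .
  have inn: "m \<le> y k \<and> y k \<le> n" if "m \<le> k" "k \<le> n" for k
    using permutes_in_image[OF Cons.prems(1), of k] that by simp
  have a: "m \<le> a \<and> a < n"
    using d out[of a] out[of "Suc a"] inn[of a] inn[of "Suc a"]
    by (cases "m \<le> a"; cases "a < n"; cases "Suc a = m"; cases "a = n") auto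
  then have "y \<circ> adj a permutes {m..n}"
    using Cons.prems by (intro permutes_comp_adj) auto
  then have "y \<circ> adj a \<circ> word_perm as permutes {m..n} \<and> set as \<subseteq> {m..<n}"
    using Cons.IH Cons.prems(2) unfolding descending.simps by blast
  with a show ?case by (simp only: word_perm_Cons comp_assoc) auto
qed

lemma adj_commute:
  assumes "Suc a < b \<or> Suc b < a"
  shows "adj a \<circ> adj b = adj b \<circ> adj a"
  using assms by (auto simp: fun_eq_iff Transposition.transpose_def)

lemma descending_far1:
  assumes "\<And>b. b \<in> set v \<Longrightarrow> Suc a < b \<or> Suc b < a"
  shows "word_perm (a # v) = word_perm (v @ [a]) \<and> (descending y (a # v) \<longleftrightarrow> descending y (v @ [a]))"
  using assms
proof (induction v arbitrary: y)
  case (Cons b v)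
  have ab: "Suc a < b \<or> Suc b < a" using Cons.prems by simp
  have c: "adj a \<circ> adj b = adj b \<circ> adj a" using adj_commute[OF ab] .
  have IH: "word_perm (a # v) = word_perm (v @ [a]) \<and> (descending y (a # v) \<longleftrightarrow> descending y (v @ [a]))" for y
    using Cons by simp
  have "word_perm (a # b # v) = adj b \<circ> word_perm (a # v)"
    by (simp add: word_perm_Cons c flip: comp_assoc)
  also have "\<dots> = word_perm ((b # v) @ [a])"
    using IH by (simp add: word_perm_Cons)
  finally have 1: "word_perm (a # b # v) = word_perm ((b # v) @ [a])" .
  have "descending y (a # b # v) \<longleftrightarrow> descending y (b # a # v)"
    using ab by (auto simp: comp_assoc c)
  also have "\<dots> \<longleftrightarrow> descending y ((b # v) @ [a])"
    using IH[of "y \<circ> adj b"] by simp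
  finally show ?case using 1 by simp
qed simp

text \<open>Letters at distance at least two concern disjoint pairs of positions, so neither the
  product nor the descent conditions depend on the order of two such blocks.\<close>

lemma descending_far:
  assumes "\<And>a b. a \<in> set u \<Longrightarrow> b \<in> set v \<Longrightarrow> Suc a < b \<or> Suc b < a"
  shows "word_perm (u @ v) = word_perm (v @ u) \<and> (descending y (u @ v) \<longleftrightarrow> descending y (v @ u))"
  using assms
proof (induction u arbitrary: y)
  case (Cons a u)
  have IH: "word_perm (u @ v) = word_perm (v @ u) \<and> (descending y (u @ v) \<longleftrightarrow> descending y (v @ u))" for y
    using Cons by simp
  have far1: "word_perm (a # v) = word_perm (v @ [a]) \<and> (descending y (a # v) \<longleftrightarrow> descending y (v @ [a]))"
    by (rule descending_far1) (use Cons.prems in auto)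
  have "word_perm ((a # u) @ v) = word_perm (a # v) \<circ> word_perm u"
    using IH by (simp add: word_perm_Cons word_perm_append comp_assoc)
  also have "\<dots> = word_perm (v @ a # u)"
    using far1 by (simp add: word_perm_Cons word_perm_append comp_assoc)
  finally have 1: "word_perm ((a # u) @ v) = word_perm (v @ a # u)" .
  have "descending y ((a # u) @ v) \<longleftrightarrow> descending y ((a # v) @ u)"
    using IH[of "y \<circ> adj a"] by simp
  also have "\<dots> \<longleftrightarrow> descending y ((v @ [a]) @ u)"
    using far1 unfolding descending_append[of y "a # v"] descending_append[of y "v @ [a]"] by simp
  finally show ?case using 1 by simp
qed simp

section \<open>Commuting noncommutative elementary symmetric functions in the nilCoxeter
  algebra\<close>

text \<open>The length is an integer, so that recursions may pass to \<open>k - 1\<close> freely and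
  the entries of a determinant may have negative index; such sets are empty.\<close>

definition Dec :: "nat \<Rightarrow> nat \<Rightarrow> int \<Rightarrow> nat list set" where
  "Dec n x k = {v. sorted_wrt (>) v \<and> int (length v) = k \<and> set v \<subseteq> {x..<n}}"

lemma finite_Dec [simp]: "finite (Dec n x k)"
proof (rule finite_subset)
  show "Dec n x k \<subseteq> {v. set v \<subseteq> {x..<n} \<and> length v = nat k}"
    by (auto simp: Dec_def)
qed (rule finite_lists_length_eq, simp)

lemma Dec_empty: "n \<le> x \<Longrightarrow> Dec n x k = (if k = 0 then {[]} else {})"
  by (auto simp: Dec_def)

lemma Dec_split:
  assumes "x < n"
  shows "Dec n x k = Dec n (Suc x) k \<union> (\<lambda>v. v @ [x]) ` Dec n (Suc x) (k - 1)"
proof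
  show "Dec n x k \<subseteq> Dec n (Suc x) k \<union> (\<lambda>v. v @ [x]) ` Dec n (Suc x) (k - 1)"
  proof
    fix v assume v: "v \<in> Dec n x k"
    show "v \<in> Dec n (Suc x) k \<union> (\<lambda>v. v @ [x]) ` Dec n (Suc x) (k - 1)"
    proof (cases "x \<in> set v")
      case False
      then show ?thesis using v by (auto simp: Dec_def subset_iff Suc_le_eq order.strict_iff_order)
    next
      case True
      then have "v \<noteq> []" by auto
      then obtain u l where vu: "v = u @ [l]" by (metis rev_exhaust)
      have u: "\<forall>a\<in>set u. l < a" "sorted_wrt (>) u" "x \<le> l"
        using v by (auto simp: Dec_def vu sorted_wrt_append)
      then have "l = x" using True by (auto simp: vu)
      then have "u \<in> Dec n (Suc x) (k - 1)"
        using v u by (fastforce simp: Dec_def vu)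
      then show ?thesis using vu \<open>l = x\<close> by blast
    qed
  qed
  show "Dec n (Suc x) k \<union> (\<lambda>v. v @ [x]) ` Dec n (Suc x) (k - 1) \<subseteq> Dec n x k"
    using assms by (fastforce simp: Dec_def sorted_wrt_append Suc_le_eq subset_iff)
qed

lemma sum_Dec_split:
  fixes g :: "nat list \<Rightarrow> 'b::comm_monoid_add"
  assumes "x < n"
  shows "(\<Sum>v\<in>Dec n x k. g v) = (\<Sum>v\<in>Dec n (Suc x) k. g v) + (\<Sum>v\<in>Dec n (Suc x) (k - 1). g (v @ [x]))"
proof -
  have disj: "Dec n (Suc x) k \<inter> (\<lambda>v. v @ [x]) ` Dec n (Suc x) (k - 1) = {}"
  proof -
    have "x \<notin> set v" if "v \<in> Dec n (Suc x) k" for v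
      using that by (auto simp: Dec_def)
    then show ?thesis by fastforce
  qed
  have "(\<Sum>v\<in>Dec n x k. g v)
      = (\<Sum>v\<in>Dec n (Suc x) k. g v) + (\<Sum>v\<in>(\<lambda>v. v @ [x]) ` Dec n (Suc x) (k - 1). g v)"
    by (simp only: Dec_split[OF assms] sum.union_disjoint[OF finite_Dec finite_imageI[OF finite_Dec] disj])
  also have "(\<Sum>v\<in>(\<lambda>v. v @ [x]) ` Dec n (Suc x) (k - 1). g v) = (\<Sum>v\<in>Dec n (Suc x) (k - 1). g (v @ [x]))"
    by (subst sum.reindex) (simp_all add: inj_on_def o_def)
  finally show ?thesis .
qed

text \<open>The nilCoxeter algebra acting on functions of permutations: a generator follows a
  descent and gives 0 at an ascent. \<open>act_far\<close>, \<open>act_same\<close> and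
  \<open>act_braid\<close> are the defining relations.\<close>

definition act :: "nat list \<Rightarrow> ((nat \<Rightarrow> nat) \<Rightarrow> int) \<Rightarrow> (nat \<Rightarrow> nat) \<Rightarrow> int" where
  "act v f y = (if descending y v then f (y \<circ> word_perm v) else 0)"

lemma act_Nil [simp]: "act [] f = f"
  by (auto simp: act_def)

lemma act_append: "act (u @ v) f = act u (act v f)"
  by (auto simp: act_def descending_append word_perm_append comp_assoc)

lemma act_far:
  assumes "\<And>a b. a \<in> set u \<Longrightarrow> b \<in> set v \<Longrightarrow> Suc a < b \<or> Suc b < a"
  shows "act u (act v f) = act v (act u f)"
proof -
  have "act (u @ v) f = act (v @ u) f"
    using descending_far[of u v] assms by (auto simp: act_def)
  then show ?thesis by (simp add: act_append)
qed

lemma act_add: "act v (\<lambda>y. f y + g y) = (\<lambda>y. act v f y + act v g y)"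
  and act_diff: "act v (\<lambda>y. f y - g y) = (\<lambda>y. act v f y - act v g y)"
  and act_0 [simp]: "act v (\<lambda>y. 0) = (\<lambda>y. 0)"
  and act_sum: "act v (\<lambda>y. \<Sum>i\<in>I. h i y) = (\<lambda>y. \<Sum>i\<in>I. act v (h i) y)"
  by (auto simp: act_def)

lemma act_same [simp]: "act [a] (act [a] f) = (\<lambda>y. 0)"
  by (auto simp: act_def fun_eq_iff word_perm_Cons)

lemma act_braid:
  "act [a] (act [Suc a] (act [a] f)) = act [Suc a] (act [a] (act [Suc a] f))"
proof -
  have p: "adj a \<circ> (adj (Suc a) \<circ> adj a) = adj (Suc a) \<circ> (adj a \<circ> adj (Suc a))"
    by (auto simp: fun_eq_iff Transposition.transpose_def)
  have "act [a, Suc a, a] f = act [Suc a, a, Suc a] f"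
    by (auto simp: act_def fun_eq_iff word_perm_Cons p)
  then show ?thesis
    by (simp only: act_append[symmetric] append.simps)
qed

text \<open>The noncommutative elementary symmetric function of degree \<open>k\<close> in the
  generators with index from \<open>x\<close> to \<open>n - 1\<close>, as an operator.\<close>

definition El :: "nat \<Rightarrow> nat \<Rightarrow> int \<Rightarrow> ((nat \<Rightarrow> nat) \<Rightarrow> int) \<Rightarrow> (nat \<Rightarrow> nat) \<Rightarrow> int" where
  "El n x k f y = (\<Sum>v\<in>Dec n x k. act v f y)"

lemma El_empty: "n \<le> x \<Longrightarrow> El n x k f = (if k = 0 then f else (\<lambda>y. 0))"
  by (auto simp: El_def Dec_empty)

lemma El_split:
  assumes "x < n"
  shows "El n x k f = (\<lambda>y. El n (Suc x) k f y + El n (Suc x) (k - 1) (act [x] f) y)"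
  by (rule ext) (simp add: El_def sum_Dec_split[OF assms] act_append)

lemma El_add: "El n x k (\<lambda>y. f y + g y) = (\<lambda>y. El n x k f y + El n x k g y)"
  and El_diff: "El n x k (\<lambda>y. f y - g y) = (\<lambda>y. El n x k f y - El n x k g y)"
  and El_0 [simp]: "El n x k (\<lambda>y. 0) = (\<lambda>y. 0)"
  by (simp_all add: El_def fun_eq_iff act_add act_diff sum.distrib sum_subtractf)

lemma act_El: "act u (El n x k f) = (\<lambda>y. \<Sum>v\<in>Dec n x k. act u (act v f) y)"
  by (rule trans[OF _ act_sum]) (simp add: El_def[abs_def])

lemma act_El_far: "Suc a < x \<Longrightarrow> act [a] (El n x k f) = El n x k (act [a] f)"
  unfolding act_El by (auto simp: El_def Dec_def fun_eq_iff intro!: sum.cong fun_cong[OF act_far])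

text \<open>The generator \<open>x\<close> commutes with all letters above \<open>Suc x\<close>.
  Since generators square to zero, \<open>El_split\<close> can be solved for the operator without
  the letter \<open>Suc x\<close>, and \<open>x\<close> is moved past that one.\<close>

lemma act_El_adjacent:
  assumes "Suc x < n"
  shows "act [x] (El n (Suc x) q g) = (\<lambda>y. El n (Suc x) q (act [x] g) y
      - El n (Suc x) (q - 1) (act [Suc x] (act [x] g)) y
      + El n (Suc x) (q - 1) (act [x] (act [Suc x] g)) y
      - El n (Suc x) (q - 2) (act [Suc x] (act [x] (act [Suc x] g))) y)"
proof -
  have G: "El n (Suc (Suc x)) q h = (\<lambda>y. El n (Suc x) q h y - El n (Suc x) (q - 1) (act [Suc x] h) y)" for q h
    unfolding El_split[OF assms] by simp
  show ?thesis
    unfolding El_split[OF assms, of q g] act_add act_El_far[OF lessI]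
    unfolding G by (simp add: fun_eq_iff)
qed

text \<open>Induction on the number of letters. Split off the letter \<open>x\<close> from both
  factors and move it inwards by \<open>act_El_adjacent\<close>; the braid relation and the
  vanishing squares leave an expression that is symmetric in \<open>p\<close> and \<open>q\<close>
  once the smaller operators commute.\<close>

lemma El_commute: "El n x p (El n x q f) = El n x q (El n x p f)"
proof (induction "n - x" arbitrary: x p q f)
  case 0
  then show ?case by (simp add: El_empty)
next
  case (Suc m)
  then have x: "x < n" by simp
  have IH: "El n (Suc x) p (El n (Suc x) q f) = El n (Suc x) q (El n (Suc x) p f)" for p q f
    using Suc.hyps by simp
  let ?F = "El n (Suc x)"
  have "El n x p (El n x q f) = (\<lambda>y. ?F p (?F q f) y + ?F p (?F (q - 1) (act [x] f)) y
      + ?F (p - 1) (?F q (act [x] f)) y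
      + (?F (p - 1) (?F (q - 1) (act [x] (act [Suc x] f))) y
         - ?F (p - 1) (?F (q - 1) (act [Suc x] (act [x] f))) y) * (if Suc x < n then 1 else 0))" for p q
  proof (cases "Suc x < n")
    case True
    show ?thesis
      unfolding El_split[OF x] El_add act_add
      unfolding act_El_adjacent[OF True] El_add El_diff act_braid act_same El_0
      using True by (simp add: fun_eq_iff)
  next
    case False
    have a: "act [x] (?F k g) = ?F k (act [x] g)" for k g
      using False by (simp add: El_empty fun_eq_iff)
    show ?thesis
      unfolding El_split[OF x] El_add act_add a act_same
      using False by (simp add: fun_eq_iff)
  qed
  then show ?case
    by (simp add: IH fun_eq_iff)
qed

definition Dec_pairs :: "nat \<Rightarrow> nat \<Rightarrow> (nat \<Rightarrow> nat) \<Rightarrow> (nat \<Rightarrow> nat) \<Rightarrow> int \<Rightarrow> int \<Rightarrow> (nat list \<times> nat list) set" where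
  "Dec_pairs n x y z p q =
     {(c, d) \<in> Dec n x p \<times> Dec n x q. descending y (c @ d) \<and> y \<circ> word_perm (c @ d) = z}"

lemma finite_Dec_pairs [simp]: "finite (Dec_pairs n x y z p q)"
  unfolding Dec_pairs_def by (rule finite_subset[of _ "Dec n x p \<times> Dec n x q"]) auto

lemma card_Dec_pairs: "int (card (Dec_pairs n x y z p q)) = El n x p (El n x q (\<lambda>y. of_bool (y = z))) y"
proof -
  have "int (card (Dec_pairs n x y z p q)) = (\<Sum>cd\<in>Dec_pairs n x y z p q. 1)"
    by simp
  also have "\<dots> = (\<Sum>(c, d)\<in>Dec n x p \<times> Dec n x q. act (c @ d) (\<lambda>y. of_bool (y = z)) y)"
    by (rule sum.mono_neutral_cong_left) (auto simp: Dec_pairs_def act_def split: if_splits)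
  also have "\<dots> = El n x p (El n x q (\<lambda>y. of_bool (y = z))) y"
    by (simp add: El_def[of n x p] act_El act_append sum.cartesian_product)
  finally show ?thesis .
qed

text \<open>\<open>El_commute\<close> evaluated at the indicator function of \<open>z\<close>. It
  yields equal cardinalities without an explicit bijection.\<close>

lemma card_Dec_pairs_commute: "card (Dec_pairs n x y z p q) = card (Dec_pairs n x y z q p)"
  using card_Dec_pairs[of n x y z p q] card_Dec_pairs[of n x y z q p]
  unfolding El_commute[of n x p q] by linarith

section \<open>The transition equation for words cut into decreasing columns\<close>

section \<open>Transitions\<close>

text \<open>For injective \<open>u\<close> these are the Bruhat covers: the exchange of
  \<open>i\<close> and \<open>j\<close> adds exactly one inversion.\<close>

definition covers :: "nat \<Rightarrow> (nat \<Rightarrow> nat) \<Rightarrow> (nat \<times> nat) set" where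
  "covers n u = {(i, j). i < j \<and> j \<le> n \<and> u i < u j \<and> (\<forall>k. i < k \<and> k < j \<longrightarrow> \<not> (u i < u k \<and> u k < u j))}"

lemma finite_covers [simp]: "finite (covers n u)"
  by (rule finite_subset[of _ "{..n} \<times> {..n}"]) (auto simp: covers_def)

text \<open>The ascent at \<open>a\<close> is in danger only if \<open>a = i\<close> or
  \<open>Suc a = j\<close>. The other position of the pair then lies strictly between
  \<open>i\<close> and \<open>j\<close>, and its value is kept out of the interval from
  \<open>u i\<close> to \<open>u j\<close>.\<close>

lemma covers_ascent:
  assumes "inj u" "u a < u (Suc a)" "(i, j) \<in> covers n u" "(i, j) \<noteq> (a, Suc a)"
  shows "u (Transposition.transpose i j a) < u (Transposition.transpose i j (Suc a))"
proof -
  have ne: "u p = u q \<longleftrightarrow> p = q" for p q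
    using assms(1) by (auto simp: inj_def)
  have ij: "i < j" "u i < u j" and b: "\<And>k. i < k \<Longrightarrow> k < j \<Longrightarrow> u k < u i \<or> u j < u k"
    using assms(3) ne by (auto simp: covers_def) (metis nat_neq_iff)
  show ?thesis
    using assms(2,4) ij b[of a] b[of "Suc a"] by (auto simp: Transposition.transpose_def)
qed

text \<open>Together with \<open>covers_adj2\<close> a bijection by relabelling positions, between
  the covers of \<open>u \<circ> adj a\<close> other than \<open>(a, Suc a)\<close> and the covers
  of \<open>u\<close> that keep the descent at \<open>a\<close>.\<close>

lemma covers_adj1:
  assumes "inj u" "u (Suc a) < u a" "a < n" "(i, j) \<in> covers n (u \<circ> adj a)" "(i, j) \<noteq> (a, Suc a)"
  shows "(adj a i, adj a j) \<in> covers n u"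
    and "u (Transposition.transpose (adj a i) (adj a j) (Suc a)) < u (Transposition.transpose (adj a i) (adj a j) a)"
proof -
  have ij: "i < j" "j \<le> n" "u (adj a i) < u (adj a j)"
    and b: "\<And>k. i < k \<Longrightarrow> k < j \<Longrightarrow> \<not> (u (adj a i) < u (adj a k) \<and> u (adj a k) < u (adj a j))"
    using assms(4) by (auto simp: covers_def)
  have lt: "adj a i < adj a j" "adj a j \<le> n"
    using ij assms(3,5) by (auto simp: Transposition.transpose_def)
  have "\<not> (u (adj a i) < u k \<and> u k < u (adj a j))" if k: "adj a i < k" "k < adj a j" for k
  proof (cases "i < adj a k \<and> adj a k < j")
    case True
    then show ?thesis using b[of "adj a k"] by simp
  next
    case False
    then show ?thesis
      using k ij assms(2,5) by (auto simp: Transposition.transpose_def split: if_splits)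
  qed
  then show 1: "(adj a i, adj a j) \<in> covers n u"
    using lt ij by (auto simp: covers_def)
  have inj: "inj (u \<circ> adj a)" using assms(1) by (simp add: inj_compose)
  have "(u \<circ> adj a) (Transposition.transpose i j a) < (u \<circ> adj a) (Transposition.transpose i j (Suc a))"
    by (rule covers_ascent[OF inj _ assms(4,5)]) (use assms(2) in simp)
  then show "u (Transposition.transpose (adj a i) (adj a j) (Suc a)) < u (Transposition.transpose (adj a i) (adj a j) a)"
    by (auto simp: Transposition.transpose_def split: if_splits)
qed

lemma covers_adj2:
  assumes "inj u" "u (Suc a) < u a" "a < n" "(i, j) \<in> covers n u"
    and "u (Transposition.transpose i j (Suc a)) < u (Transposition.transpose i j a)"
  shows "(adj a i, adj a j) \<in> covers n (u \<circ> adj a)" "(adj a i, adj a j) \<noteq> (a, Suc a)"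
proof -
  have ij: "i < j" "j \<le> n" "u i < u j"
    and b: "\<And>k. i < k \<Longrightarrow> k < j \<Longrightarrow> \<not> (u i < u k \<and> u k < u j)"
    using assms(4) by (auto simp: covers_def)
  have ne: "(i, j) \<noteq> (a, Suc a)" using ij assms(2) by auto
  have lt: "adj a i < adj a j" "adj a j \<le> n"
    using ij ne assms(3) by (auto simp: Transposition.transpose_def)
  have "\<not> (u i < u (adj a k) \<and> u (adj a k) < u j)" if k: "adj a i < k" "k < adj a j" for k
  proof (cases "i < adj a k \<and> adj a k < j")
    case True
    then show ?thesis using b[of "adj a k"] by simp
  next
    case False
    then show ?thesis
      using k ij assms(2,5) ne by (auto simp: Transposition.transpose_def split: if_splits)
  qed
  then show "(adj a i, adj a j) \<in> covers n (u \<circ> adj a)"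
    using lt ij by (auto simp: covers_def)
  show "(adj a i, adj a j) \<noteq> (a, Suc a)"
    using ij ne by (auto simp: Transposition.transpose_def split: if_splits)
qed

text \<open>\<open>deriv c f as y\<close> sums, over all letters of \<open>as\<close>, the value of \<open>f\<close> at the permutation reached
  from \<open>y\<close> when that letter is skipped, weighted by the difference of \<open>c\<close> at the two original
  positions which the skipped letter would have exchanged.\<close>

primrec deriv :: "(nat \<Rightarrow> int) \<Rightarrow> ((nat \<Rightarrow> nat) \<Rightarrow> int) \<Rightarrow> nat list \<Rightarrow> (nat \<Rightarrow> nat) \<Rightarrow> int" where
  "deriv c f [] y = 0"
| "deriv c f (a # as) y = (c a - c (Suc a)) * act as f y +
     (if y (Suc a) < y a then deriv (c \<circ> adj a) f as (y \<circ> adj a) else 0)"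

lemma deriv_append:
  "deriv c f (u @ v) y = deriv c (act v f) u y +
     (if descending y u then deriv (c \<circ> word_perm u) f v (y \<circ> word_perm u) else 0)"
  by (induction u arbitrary: c y) (simp_all add: act_append word_perm_Cons comp_assoc algebra_simps)

lemma act_sorts: "act as (\<lambda>y. of_bool (y = id)) y = of_bool (sorts y as)"
  by (auto simp: act_def sorts_def)

text \<open>A form of the exchange property, by induction on the word. At a descent the covers are
  relabelled by \<open>adj a\<close>, and the extra cover \<open>(a, Suc a)\<close> of
  \<open>u \<circ> adj a\<close> accounts for the term in which the letter \<open>a\<close> is
  skipped. At an ascent, \<open>(a, Suc a)\<close> is the only cover after which \<open>a\<close>
  may be the next letter.\<close>

lemma deriv_eq_sum_covers:
  assumes "inj u" "set as \<subseteq> {..<n}"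
  shows "deriv c (\<lambda>y. of_bool (y = id)) as u
    = (\<Sum>(i, j)\<in>covers n u. (c i - c j) * of_bool (sorts (u \<circ> Transposition.transpose i j) as))"
  using assms
proof (induction as arbitrary: c u)
  case Nil
  have "u \<circ> Transposition.transpose i j \<noteq> id" if "(i, j) \<in> covers n u" for i j
  proof
    assume *: "u \<circ> Transposition.transpose i j = id"
    have "u i = j" "u j = i"
      using fun_cong[OF *, of i] fun_cong[OF *, of j] by auto
    then show False using that by (auto simp: covers_def)
  qed
  then have "(\<Sum>(i, j)\<in>covers n u. (c i - c j) * of_bool (sorts (u \<circ> Transposition.transpose i j) [])) = 0"
    by (intro sum.neutral) auto
  then show ?case unfolding deriv.simps by (rule sym)
next
  case (Cons a as)
  have IH: "deriv c (\<lambda>y. of_bool (y = id)) as u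
    = (\<Sum>(i, j)\<in>covers n u. (c i - c j) * of_bool (sorts (u \<circ> Transposition.transpose i j) as))"
    if "inj u" for c u
    by (rule Cons.IH[OF that]) (use Cons.prems(2) in simp)
  have a: "a < n" using Cons.prems by simp
  have inj: "inj u" by fact
  have inj': "inj (u \<circ> adj a)" using inj by (simp add: inj_compose)
  let ?t = "Transposition.transpose"
  show ?case
  proof (cases "u (Suc a) < u a")
    case True
    let ?C = "covers n (u \<circ> adj a)"
    have mem: "(a, Suc a) \<in> ?C"
      using True a by (auto simp: covers_def)
    have "(\<Sum>(i, j)\<in>covers n u. (c i - c j) * of_bool (sorts (u \<circ> ?t i j) (a # as)))
        = (\<Sum>(i, j)\<in>{(i, j) \<in> covers n u. u (?t i j (Suc a)) < u (?t i j a)}.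
            (c i - c j) * of_bool (sorts (u \<circ> ?t i j \<circ> adj a) as))"
      by (rule sum.mono_neutral_cong_right) (auto simp: sorts_Cons)
    also have "\<dots> = (\<Sum>(i, j)\<in>?C - {(a, Suc a)}.
            ((c \<circ> adj a) i - (c \<circ> adj a) j) * of_bool (sorts (u \<circ> adj a \<circ> ?t i j) as))"
    proof (rule sum.reindex_bij_witness[of _ "map_prod (adj a) (adj a)" "map_prod (adj a) (adj a)"])
      fix p assume "p \<in> {(i, j) \<in> covers n u. u (?t i j (Suc a)) < u (?t i j a)}"
      then obtain i j where p: "p = (i, j)" "(i, j) \<in> covers n u" "u (?t i j (Suc a)) < u (?t i j a)"
        by auto
      show "map_prod (adj a) (adj a) (map_prod (adj a) (adj a) p) = p" using p by simp
      show "map_prod (adj a) (adj a) p \<in> ?C - {(a, Suc a)}"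
        using covers_adj2[OF inj True a p(2,3)] p(1) by auto
      have "?t i j \<circ> adj a = adj a \<circ> ?t (adj a i) (adj a j)"
        by (auto simp: fun_eq_iff Transposition.transpose_def)
      then show "(case map_prod (adj a) (adj a) p of (i, j) \<Rightarrow>
          ((c \<circ> adj a) i - (c \<circ> adj a) j) * of_bool (sorts (u \<circ> adj a \<circ> ?t i j) as))
        = (case p of (i, j) \<Rightarrow> (c i - c j) * of_bool (sorts (u \<circ> ?t i j \<circ> adj a) as))"
        using p(1) by (simp add: comp_assoc)
    next
      fix p assume "p \<in> ?C - {(a, Suc a)}"
      then obtain i j where p: "p = (i, j)" "(i, j) \<in> ?C" "(i, j) \<noteq> (a, Suc a)"
        by (cases p) auto
      show "map_prod (adj a) (adj a) (map_prod (adj a) (adj a) p) = p" using p by simp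
      show "map_prod (adj a) (adj a) p \<in> {(i, j) \<in> covers n u. u (?t i j (Suc a)) < u (?t i j a)}"
        using covers_adj1[OF inj True a p(2,3)] p(1) by simp
    qed
    also have "\<dots> = (\<Sum>(i, j)\<in>?C. ((c \<circ> adj a) i - (c \<circ> adj a) j) *
          of_bool (sorts (u \<circ> adj a \<circ> ?t i j) as)) - (c (Suc a) - c a) * of_bool (sorts u as)"
      using mem by (subst sum_diff1) auto
    also have "\<dots> = deriv c (\<lambda>y. of_bool (y = id)) (a # as) u"
      using IH[OF inj', of "c \<circ> adj a"] True by (simp add: act_sorts algebra_simps)
    finally show ?thesis by (rule sym)
  next
    case False
    then have asc: "u a < u (Suc a)"
      using inj by (metis inj_eq linorder_neqE_nat n_not_Suc_n)
    have mem: "(a, Suc a) \<in> covers n u"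
      using asc a by (auto simp: covers_def)
    have "(\<Sum>(i, j)\<in>covers n u. (c i - c j) * of_bool (sorts (u \<circ> ?t i j) (a # as)))
        = (\<Sum>(i, j)\<in>{(a, Suc a)}. (c i - c j) * of_bool (sorts (u \<circ> ?t i j) (a # as)))"
    proof (rule sum.mono_neutral_right)
      show "\<forall>p\<in>covers n u - {(a, Suc a)}.
          (case p of (i, j) \<Rightarrow> (c i - c j) * of_bool (sorts (u \<circ> ?t i j) (a # as))) = 0"
        using covers_ascent[OF inj asc] by (fastforce simp: sorts_Cons)
    qed (use mem in auto)
    also have "\<dots> = (c a - c (Suc a)) * of_bool (sorts u as)"
      using asc by (simp add: sorts_Cons)
    also have "\<dots> = deriv c (\<lambda>y. of_bool (y = id)) (a # as) u"
      using False by (simp add: act_sorts)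
    finally show ?thesis by (rule sym)
  qed
qed

text \<open>Inserting a letter into a fixed decreasing list gives a telescoping sum.\<close>

lemma sum_deriv_Dec:
  assumes "x \<le> n" "c n = 0"
  shows "(\<Sum>v\<in>Dec n x k. deriv c f v y)
    = (\<Sum>v\<in>Dec n x (k - 1). if descending y v then c (word_perm v x) * f (y \<circ> word_perm v) else 0)"
  using assms(1)
proof (induction "n - x" arbitrary: x k f)
  case 0
  then show ?case using assms(2) by (auto simp: Dec_empty)
next
  case (Suc m)
  then have x: "x < n" by simp
  let ?S = "\<lambda>k. Dec n (Suc x) k"
  let ?w = "\<lambda>z v. if descending y v then c (word_perm v z) * f (y \<circ> word_perm v) else 0"
  have IH: "(\<Sum>v\<in>?S k. deriv c f v y)
    = (\<Sum>v\<in>?S (k - 1). if descending y v then c (word_perm v (Suc x)) * f (y \<circ> word_perm v) else 0)" for k f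
    using Suc x by simp
  have "(\<Sum>v\<in>Dec n x k. deriv c f v y) = (\<Sum>v\<in>?S k. deriv c f v y) + (\<Sum>v\<in>?S (k - 1). deriv c (act [x] f) v y)
      + (\<Sum>v\<in>?S (k - 1). ?w x v - ?w (Suc x) v)"
    unfolding sum_Dec_split[OF x] deriv_append sum.distrib
    by (simp add: algebra_simps if_distrib cong: if_cong)
  \<comment> \<open>By the induction hypothesis the first sum equals the subtracted part of the
    third one; this cancellation is the telescoping.\<close>
  also have "\<dots> = (\<Sum>v\<in>?S (k - 1). ?w x v) + (\<Sum>v\<in>?S (k - 1 - 1). ?w x (v @ [x]))"
  proof -
    have "(\<Sum>v\<in>?S (k - 1). deriv c (act [x] f) v y) = (\<Sum>v\<in>?S (k - 1 - 1). ?w x (v @ [x]))"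
      unfolding IH by (intro sum.cong refl)
        (auto simp: act_def descending_append word_perm_append word_perm_Cons comp_assoc)
    then show ?thesis
      unfolding IH[where k=k and f=f] by (simp add: sum_subtractf)
  qed
  also have "\<dots> = (\<Sum>v\<in>Dec n x (k - 1). ?w x v)"
    unfolding sum_Dec_split[OF x] ..
  finally show ?case .
qed

primrec tuples :: "nat \<Rightarrow> int list \<Rightarrow> nat list list set" where
  "tuples n [] = {[]}"
| "tuples n (k # ks) = (\<lambda>(v, D). v # D) ` (Dec n 0 k \<times> tuples n ks)"

lemma finite_tuples [simp]: "finite (tuples n ks)"
  by (induction ks) auto

lemma sum_tuples_Cons:
  "(\<Sum>D\<in>tuples n (k # ks). g D) = (\<Sum>D\<in>tuples n ks. \<Sum>v\<in>Dec n 0 k. g (v # D))"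
proof -
  have "(\<Sum>D\<in>tuples n (k # ks). g D) = (\<Sum>(v, D)\<in>Dec n 0 k \<times> tuples n ks. g (v # D))"
    unfolding tuples.simps by (subst sum.reindex) (auto simp: inj_on_def case_prod_unfold)
  also have "\<dots> = (\<Sum>v\<in>Dec n 0 k. \<Sum>D\<in>tuples n ks. g (v # D))"
    by (simp add: sum.cartesian_product)
  also have "\<dots> = (\<Sum>D\<in>tuples n ks. \<Sum>v\<in>Dec n 0 k. g (v # D))"
    by (rule sum.swap)
  finally show ?thesis .
qed

lemma set_concat_tuples: "D \<in> tuples n ks \<Longrightarrow> set (concat D) \<subseteq> {..<n}"
proof (induction ks arbitrary: D)
  case (Cons k ks)
  then obtain v E where "D = v # E" "v \<in> Dec n 0 k" "set (concat E) \<subseteq> {..<n}" by auto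
  then show ?case by (auto simp: Dec_def)
qed simp

lemma word_perm_notin:
  assumes "\<And>a. a \<in> set as \<Longrightarrow> x \<noteq> a \<and> x \<noteq> Suc a"
  shows "word_perm as x = x"
  using assms by (induction as) (auto simp: word_perm_Cons Transposition.transpose_def)

text \<open>The skipped letter lies in one column, and the sum over that column telescopes to the
  weights at the two ends 0 and \<open>Suc n\<close>. The columns before it permute
  \<open>{1..n}\<close> and fix both ends, so these weights are zero. The letters 0 and
  \<open>n\<close>, which no sorting word contains, take part as skipped letters.\<close>

lemma sum_deriv_tuples:
  assumes "y permutes {1..n}" "c 0 = 0" "c (Suc n) = 0"
  shows "(\<Sum>D\<in>tuples (Suc n) ks. deriv c f (concat D) y) = 0"
  using assms
proof (induction ks arbitrary: c y)
  case Nil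
  then show ?case by simp
next
  case (Cons k ks)
  have letters: "y \<circ> word_perm v permutes {1..n} \<and> set v \<subseteq> {1..<n}" if "descending y v" for v
    using descending_permutes[OF Cons.prems(1) that] .
  have endpts: "word_perm v 0 = 0 \<and> word_perm v (Suc n) = Suc n" if "descending y v" for v
    using letters[OF that] by (auto intro!: word_perm_notin)
  have first: "(\<Sum>v\<in>Dec (Suc n) 0 k. deriv c g v y) = 0" for g
  proof -
    have "c (Suc n) = 0" by (rule Cons.prems(3))
    then have "(\<Sum>v\<in>Dec (Suc n) 0 k. deriv c g v y) = (\<Sum>v\<in>Dec (Suc n) 0 (k - 1).
        if descending y v then c (word_perm v 0) * g (y \<circ> word_perm v) else 0)"
      by (intro sum_deriv_Dec) simp_all
    also have "\<dots> = 0"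
      using endpts Cons.prems(2) by (intro sum.neutral) auto
    finally show ?thesis .
  qed
  have second: "(\<Sum>D\<in>tuples (Suc n) ks. deriv (c \<circ> word_perm v) f (concat D) (y \<circ> word_perm v)) = 0"
    if "descending y v" for v
  proof (rule Cons.IH)
    show "y \<circ> word_perm v permutes {1..n}" using letters[OF that] by blast
  qed (use endpts[OF that] Cons.prems(2,3) in simp_all)
  have "(\<Sum>D\<in>tuples (Suc n) (k # ks). deriv c f (concat D) y)
    = (\<Sum>D\<in>tuples (Suc n) ks. \<Sum>v\<in>Dec (Suc n) 0 k. deriv c (act (concat D) f) v y)
      + (\<Sum>D\<in>tuples (Suc n) ks. \<Sum>v\<in>Dec (Suc n) 0 k. if descending y v
           then deriv (c \<circ> word_perm v) f (concat D) (y \<circ> word_perm v) else 0)"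
    by (simp add: sum_tuples_Cons deriv_append sum.distrib del: tuples.simps)
  also have "(\<Sum>D\<in>tuples (Suc n) ks. \<Sum>v\<in>Dec (Suc n) 0 k. deriv c (act (concat D) f) v y) = 0"
    by (simp add: first)
  also have "(\<Sum>D\<in>tuples (Suc n) ks. \<Sum>v\<in>Dec (Suc n) 0 k. if descending y v
           then deriv (c \<circ> word_perm v) f (concat D) (y \<circ> word_perm v) else 0)
       = (\<Sum>v\<in>Dec (Suc n) 0 k. if descending y v then
            \<Sum>D\<in>tuples (Suc n) ks. deriv (c \<circ> word_perm v) f (concat D) (y \<circ> word_perm v) else 0)"
    by (rule trans[OF sum.swap]) (intro sum.cong refl, simp)
  also have "\<dots> = 0"
    using second by (intro sum.neutral) auto
  finally show ?case by simp
qed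

text \<open>Up to convention, the coefficient of the monomial with exponents \<open>ks\<close> in
  the Stanley symmetric function of \<open>y\<close>.\<close>

definition tuple_count :: "nat \<Rightarrow> int list \<Rightarrow> (nat \<Rightarrow> nat) \<Rightarrow> int" where
  "tuple_count n ks y = int (card {D \<in> tuples n ks. sorts y (concat D)})"

text \<open>With the indicator function of \<open>r\<close> as weight, the covers starting at
  \<open>r\<close> count positively, those ending at \<open>r\<close> negatively, and all others not
  at all.\<close>

lemma tuple_count_transition:
  assumes "u permutes {1..n}" "1 \<le> r" "r \<le> n"
  shows "(\<Sum>j | (r, j) \<in> covers (Suc n) u. tuple_count (Suc n) ks (u \<circ> Transposition.transpose r j))
    = (\<Sum>i | (i, r) \<in> covers (Suc n) u. tuple_count (Suc n) ks (u \<circ> Transposition.transpose i r))"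
proof -
  let ?C = "covers (Suc n) u" and ?t = "Transposition.transpose"
  let ?N = "\<lambda>i j. tuple_count (Suc n) ks (u \<circ> ?t i j)"
  define c :: "nat \<Rightarrow> int" where "c x = of_bool (x = r)" for x
  have "0 = (\<Sum>D\<in>tuples (Suc n) ks. deriv c (\<lambda>y. of_bool (y = id)) (concat D) u)"
    using sum_deriv_tuples[OF assms(1)] assms(2,3) by (simp add: c_def)
  also have "\<dots> = (\<Sum>D\<in>tuples (Suc n) ks. \<Sum>(i, j)\<in>?C.
      (c i - c j) * of_bool (sorts (u \<circ> ?t i j) (concat D)))"
    using set_concat_tuples
    by (intro sum.cong refl deriv_eq_sum_covers permutes_inj[OF assms(1)]) blast
  also have "\<dots> = (\<Sum>(i, j)\<in>?C. (c i - c j) * ?N i j)"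
    by (rule trans[OF sum.swap])
      (simp add: tuple_count_def case_prod_unfold sum_distrib_left[symmetric] Int_def)
  also have "\<dots> = (\<Sum>(i, j)\<in>?C. c i * ?N i j) - (\<Sum>(i, j)\<in>?C. c j * ?N i j)"
    by (simp add: sum_subtractf[symmetric] case_prod_unfold algebra_simps)
  also have "(\<Sum>(i, j)\<in>?C. c i * ?N i j) = (\<Sum>j | (r, j) \<in> ?C. ?N r j)"
  proof -
    have "(\<Sum>(i, j)\<in>?C. c i * ?N i j) = (\<Sum>p\<in>Pair r ` {j. (r, j) \<in> ?C}. ?N (fst p) (snd p))"
      by (rule sum.mono_neutral_cong_right) (auto simp: c_def)
    then show ?thesis by (simp add: sum.reindex inj_on_def)
  qed
  also have "(\<Sum>(i, j)\<in>?C. c j * ?N i j) = (\<Sum>i | (i, r) \<in> ?C. ?N i r)"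
  proof -
    have "(\<Sum>(i, j)\<in>?C. c j * ?N i j) = (\<Sum>p\<in>(\<lambda>i. (i, r)) ` {i. (i, r) \<in> ?C}. ?N (fst p) (snd p))"
      by (rule sum.mono_neutral_cong_right) (auto simp: c_def)
    then show ?thesis by (simp add: sum.reindex inj_on_def)
  qed
  finally show ?thesis by (simp add: comp_def)
qed

section \<open>The sign-reversing exchange of columns\<close>

section \<open>Fomin--Greene signs\<close>

text \<open>A column is listed from bottom to top, so row \<open>i\<close> of column \<open>v\<close> is \<open>rev v ! i\<close>.\<close>

definition viol :: "nat list \<Rightarrow> nat list \<Rightarrow> nat \<Rightarrow> bool" where
  "viol v w i \<longleftrightarrow> i < length w \<and> (length v \<le> i \<or> rev w ! i < rev v ! i)"

text \<open>For decreasing columns this is semistandardness: column lengths weakly decrease and rows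
  weakly increase. Empty columns may follow at the right.\<close>

definition tabloid :: "nat list list \<Rightarrow> bool" where
  "tabloid D \<longleftrightarrow> (\<forall>j i. Suc j < length D \<longrightarrow> \<not> viol (D ! j) (D ! Suc j) i)"

text \<open>The topmost row with a violation, and the rightmost violation in it. The exchange
  changes only entries below row \<open>i\<close> in column \<open>Suc j\<close> and from row
  \<open>i\<close> on in column \<open>j\<close>, so it does not affect this choice
  (\<open>bad_at_replace\<close>).\<close>

definition bad_at :: "nat \<Rightarrow> nat \<Rightarrow> nat list list \<Rightarrow> bool" where
  "bad_at i j D \<longleftrightarrow> Suc j < length D \<and> viol (D ! j) (D ! Suc j) i \<and>
     (\<forall>i' j'. i' < i \<and> Suc j' < length D \<longrightarrow> \<not> viol (D ! j') (D ! Suc j') i') \<and>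
     (\<forall>j'. j < j' \<and> Suc j' < length D \<longrightarrow> \<not> viol (D ! j') (D ! Suc j') i)"

lemma not_tabloid_bad_at:
  assumes "\<not> tabloid D"
  shows "\<exists>i j. bad_at i j D"
proof -
  define P where "P i \<longleftrightarrow> (\<exists>j. Suc j < length D \<and> viol (D ! j) (D ! Suc j) i)" for i
  have "\<exists>i. P i" using assms by (auto simp: P_def tabloid_def)
  then have L: "P (LEAST i. P i)" by (metis LeastI_ex)
  define i where "i = (LEAST i. P i)"
  define J where "J = {j. Suc j < length D \<and> viol (D ! j) (D ! Suc j) i}"
  have J: "finite J" "J \<noteq> {}"
    using L by (auto simp: J_def P_def i_def intro: finite_subset[of _ "{..<length D}"])
  have "bad_at i (Max J) D"
    unfolding bad_at_def
  proof (intro conjI allI impI)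
    show "Suc (Max J) < length D" "viol (D ! Max J) (D ! Suc (Max J)) i"
      using Max_in[OF J] by (auto simp: J_def)
  next
    fix i' j' assume "i' < i \<and> Suc j' < length D"
    then show "\<not> viol (D ! j') (D ! Suc j') i'"
      using not_less_Least[of i' P] by (auto simp: i_def P_def)
  next
    fix j' assume "Max J < j' \<and> Suc j' < length D"
    then show "\<not> viol (D ! j') (D ! Suc j') i"
      using Max_ge[OF J(1), of j'] by (auto simp: J_def)
  qed
  then show ?thesis by blast
qed

lemma bad_at_unique:
  assumes "bad_at i j D" "bad_at i' j' D"
  shows "i = i' \<and> j = j'"
  using assms unfolding bad_at_def by (metis nat_neq_iff)

lemma bad_at_not_tabloid: "bad_at i j D \<Longrightarrow> \<not> tabloid D"
  by (auto simp: bad_at_def tabloid_def)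

lemma viol_cong:
  assumes "take k (rev v) = take k (rev v')" "take k (rev w) = take k (rev w')" "i < k"
  shows "viol v w i \<longleftrightarrow> viol v' w' i"
proof -
  have l: "i < length u \<longleftrightarrow> i < length u'" if "take k (rev u) = take k (rev u')" for u u' :: "nat list"
    using arg_cong[OF that, of length] assms(3) by auto
  have "rev u ! i = rev u' ! i" if "take k (rev u) = take k (rev u')" for u u' :: "nat list"
    using arg_cong[OF that, of "\<lambda>u. u ! i"] assms(3) by simp
  then show ?thesis
    using l assms(1,2) unfolding viol_def by (metis linorder_not_le)
qed

lemma tuples_iff: "D \<in> tuples n ks \<longleftrightarrow> length D = length ks \<and> (\<forall>j<length ks. D ! j \<in> Dec n 0 (ks ! j))"
proof (induction ks arbitrary: D)
  case (Cons k ks)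
  show ?case
  proof (cases D)
    case (Cons v E)
    have "D \<in> tuples n (k # ks) \<longleftrightarrow> v \<in> Dec n 0 k \<and> E \<in> tuples n ks"
      by (auto simp: Cons)
    then show ?thesis
      using Cons.IH[of E] by (auto simp: Cons nth_Cons split: nat.splits)
  qed auto
qed auto

text \<open>The violating entry \<open>x\<close> cuts both columns. Below the cut all entries exceed
  \<open>x\<close>; the part \<open>cs\<close> of the left column is smaller than \<open>x\<close>,
  because the row just above has no violation and the right column increases downwards.\<close>

lemma bad_at_split:
  assumes "bad_at i j D" "D \<in> tuples n ks"
  obtains L cb cs db x ds R where
    "D = L @ (cb @ cs) # (db @ x # ds) # R" "length L = j" "length cs = i" "length ds = i"
    "\<forall>a\<in>set cs. a < x" "\<forall>a\<in>set cb. x < a" "\<forall>a\<in>set db. x < a"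
    "sorted_wrt (>) cb" "sorted_wrt (>) cs" "sorted_wrt (>) db" "sorted_wrt (>) (x # ds)"
    "set (cb @ cs @ db @ x # ds) \<subseteq> {..<n}"
proof -
  define c where "c = D ! j"
  define d where "d = D ! Suc j"
  have lenD: "Suc j < length D" "length D = length ks" and v: "viol c d i"
    using assms by (auto simp: bad_at_def tuples_iff c_def d_def)
  have nv: "\<not> viol c d i'" if "i' < i" for i'
    using assms(1) that lenD by (auto simp: bad_at_def c_def d_def)
  have "c \<in> Dec n 0 (ks ! j)" "d \<in> Dec n 0 (ks ! Suc j)"
    using assms(2) lenD by (simp_all add: tuples_iff c_def d_def)
  then have c: "sorted_wrt (>) c" "set c \<subseteq> {..<n}" and d: "sorted_wrt (>) d" "set d \<subseteq> {..<n}"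
    by (auto simp: Dec_def)
  have id: "i < length d" using v by (auto simp: viol_def)
  have ic: "i \<le> length c"
  proof (cases i)
    case (Suc m)
    then show ?thesis using nv[of m] id by (auto simp: viol_def)
  qed simp
  define cb where "cb = take (length c - i) c"
  define cs where "cs = drop (length c - i) c"
  define db where "db = take (length d - Suc i) d"
  define x where "x = d ! (length d - Suc i)"
  define ds where "ds = drop (length d - i) d"
  have csplit: "c = cb @ cs" and lcs: "length cs = i"
    using ic by (auto simp: cb_def cs_def)
  have dsplit: "d = db @ x # ds" and lds: "length ds = i"
    using id id_take_nth_drop[of "length d - Suc i" d] by (auto simp: db_def x_def ds_def Suc_diff_Suc)
  have xrev: "x = rev d ! i" using id by (simp add: x_def rev_nth)
  have cs: "\<forall>a\<in>set cs. a < x"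
  proof (cases cs)
    case (Cons h t)
    obtain m where m: "i = Suc m" using lcs Cons by (cases i) auto
    have "ds \<noteq> []" using lds m by auto
    then have "rev c ! m = h" "rev d ! m = hd ds"
      using csplit dsplit lcs lds m Cons by (auto simp: rev_nth nth_append hd_conv_nth)
    then have "h \<le> hd ds" using nv[of m] id ic m by (auto simp: viol_def)
    moreover have "hd ds < x"
      using d(1) \<open>ds \<noteq> []\<close> by (auto simp: dsplit sorted_wrt_append)
    moreover have "\<forall>a\<in>set t. a < h"
      using c(1) by (auto simp: csplit Cons sorted_wrt_append)
    ultimately show ?thesis by (auto simp: Cons)
  qed simp
  have cb: "\<forall>a\<in>set cb. x < a"
  proof (cases cb rule: rev_cases)
    case (snoc t l)
    then have "rev c ! i = l" using csplit lcs by (auto simp: rev_nth nth_append)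
    then have "x < l" using v xrev csplit lcs snoc by (auto simp: viol_def)
    moreover have "\<forall>a\<in>set t. l < a"
      using c(1) by (auto simp: csplit snoc sorted_wrt_append)
    ultimately show ?thesis by (auto simp: snoc)
  qed simp
  have "D = take j D @ c # d # drop (Suc (Suc j)) D"
    using id_take_nth_drop[of j D] Cons_nth_drop_Suc[of "Suc j" D] lenD by (simp add: c_def d_def)
  moreover have "length (take j D) = j" using lenD by simp
  ultimately show ?thesis
    using that[of "take j D" cb cs db x ds "drop (Suc (Suc j)) D"] c d lcs lds cs cb
    by (auto simp: csplit dsplit sorted_wrt_append)
qed

text \<open>The letters of \<open>cs\<close> are below \<open>x\<close> and those of
  \<open>db\<close> above it, so the two blocks commute. This makes \<open>cb\<close> and
  \<open>db\<close> adjacent, ready for an exchange of their lengths.\<close>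

lemma sorts_exchange:
  assumes "\<And>a b. a \<in> set cs \<Longrightarrow> b \<in> set db \<Longrightarrow> Suc a < b"
  shows "sorts z (cb @ cs @ db @ rest) \<longleftrightarrow>
    descending z (cb @ db) \<and> sorts (z \<circ> word_perm (cb @ db)) (cs @ rest)"
proof -
  have "word_perm (cs @ db) = word_perm (db @ cs) \<and> (descending y (cs @ db) \<longleftrightarrow> descending y (db @ cs))" for y
    using assms by (intro descending_far) blast
  then have "sorts y ((cs @ db) @ rest) \<longleftrightarrow> sorts y ((db @ cs) @ rest)" for y
    unfolding sorts_append[of y "cs @ db"] sorts_append[of y "db @ cs"] by simp
  from this[of "z \<circ> word_perm cb"] show ?thesis
    by (auto simp: sorts_append descending_append word_perm_append comp_assoc)
qed

definition bad_tuples :: "nat \<Rightarrow> int list \<Rightarrow> nat \<Rightarrow> nat \<Rightarrow> (nat \<Rightarrow> nat) \<Rightarrow> nat list list set" where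
  "bad_tuples n ks i j y = {D \<in> tuples n ks. sorts y (concat D) \<and> bad_at i j D}"

text \<open>Any bijection will do. It is chosen as a function of data that can be recovered after
  the exchange, which makes \<open>exch_tuple\<close> injective.\<close>

definition exch :: "nat \<Rightarrow> nat \<Rightarrow> (nat \<Rightarrow> nat) \<Rightarrow> (nat \<Rightarrow> nat) \<Rightarrow> int \<Rightarrow> int \<Rightarrow> nat list \<times> nat list \<Rightarrow> nat list \<times> nat list" where
  "exch n x y z p q = (SOME f. bij_betw f (Dec_pairs n x y z p q) (Dec_pairs n x y z q p))"

lemma exch_bij: "bij_betw (exch n x y z p q) (Dec_pairs n x y z p q) (Dec_pairs n x y z q p)"
proof -
  have "\<exists>f. bij_betw f (Dec_pairs n x y z p q) (Dec_pairs n x y z q p)"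
    by (rule finite_same_card_bij) (simp_all add: card_Dec_pairs_commute)
  then show ?thesis unfolding exch_def by (rule someI_ex)
qed

text \<open>In this definition \<open>ds\<close> begins with the violating entry, which is
  \<open>x\<close> in \<open>bad_at_split\<close>. As \<open>x\<close> stays in the right column,
  the column lengths p and q become q - 1 and p + 1, as when two adjacent rows of a Jacobi-Trudi
  determinant are exchanged.\<close>

definition exch_tuple :: "nat \<Rightarrow> nat \<Rightarrow> nat \<Rightarrow> (nat \<Rightarrow> nat) \<Rightarrow> nat list list \<Rightarrow> nat list list" where
  "exch_tuple n i j y D =
     (let c = D ! j; d = D ! Suc j;
          cb = take (length c - i) c; cs = drop (length c - i) c;
          db = take (length d - Suc i) d; ds = drop (length d - Suc i) d;
          z = y \<circ> word_perm (concat (take j D));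
          (cb', db') = exch n (Suc (hd ds)) z (z \<circ> word_perm (cb @ db)) (int (length cb)) (int (length db)) (cb, db)
      in D[j := cb' @ cs, Suc j := db' @ ds])"

lemma exch_tuple_eq:
  assumes "length L = j" "length cs = i" "length ds = i"
    and "z = y \<circ> word_perm (concat L)"
    and "exch n (Suc x) z (z \<circ> word_perm (cb @ db)) (int (length cb)) (int (length db)) (cb, db) = (cb', db')"
  shows "exch_tuple n i j y (L @ (cb @ cs) # (db @ x # ds) # R) = L @ (cb' @ cs) # (db' @ x # ds) # R"
  using assms by (simp add: exch_tuple_def Let_def nth_append list_update_append)

lemma bad_at_replace:
  assumes "bad_at i j (L @ (cb @ cs) # (db @ x # ds) # R)"
    and "length L = j" "length cs = i" "length ds = i"
    and "\<forall>a\<in>set cb'. x < a"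
  shows "bad_at i j (L @ (cb' @ cs) # (db' @ x # ds) # R)" (is "bad_at i j ?E")
proof -
  let ?D = "L @ (cb @ cs) # (db @ x # ds) # R"
  have D: "Suc j < length ?E" "length ?E = length ?D" using assms(2) by auto
  have top: "take i (rev (?D ! k)) = take i (rev (?E ! k))" for k
    using assms(2-4) by (auto simp: nth_append nth_Cons split: nat.splits)
  have top': "take (Suc i) (rev (?D ! k)) = take (Suc i) (rev (?E ! k))" if "j < k" for k
    using assms(2-4) that by (auto simp: nth_append nth_Cons split: nat.splits)
  have "viol (?E ! j) (?E ! Suc j) i"
  proof (cases cb' rule: rev_cases)
    case Nil
    then show ?thesis using assms(2-4) by (simp add: viol_def nth_append)
  next
    case (snoc t l)
    then show ?thesis using assms(2-5) by (simp add: viol_def nth_append rev_nth)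
  qed
  moreover have "\<not> viol (?E ! j') (?E ! Suc j') i'" if "i' < i" "Suc j' < length ?E" for i' j'
    using assms(1) that D viol_cong[OF top[of j'] top[of "Suc j'"] that(1)] unfolding bad_at_def by metis
  moreover have "\<not> viol (?E ! j') (?E ! Suc j') i" if "j < j'" "Suc j' < length ?E" for j'
    using assms(1) that D viol_cong[OF top'[of j'] top'[of "Suc j'"] lessI] unfolding bad_at_def by (metis less_Suc_eq)
  ultimately show ?thesis using D unfolding bad_at_def by blast
qed

lemma exch_tuple_spec:
  assumes "D \<in> bad_tuples n ks i j y"
  obtains L cb cs db x ds R cb' db' z z' where
    "D = L @ (cb @ cs) # (db @ x # ds) # R" "length L = j" "length cs = i" "length ds = i"
    "z = y \<circ> word_perm (concat L)" "(cb, db) \<in> Dec_pairs n (Suc x) z z' (int (length cb)) (int (length db))"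
    "exch n (Suc x) z z' (int (length cb)) (int (length db)) (cb, db) = (cb', db')"
    "(cb', db') \<in> Dec_pairs n (Suc x) z z' (int (length db)) (int (length cb))"
    "exch_tuple n i j y D = L @ (cb' @ cs) # (db' @ x # ds) # R"
    "exch_tuple n i j y D \<in> bad_tuples n (ks[j := ks ! Suc j - 1, Suc j := ks ! j + 1]) i j y"
proof -
  have D: "D \<in> tuples n ks" "sorts y (concat D)" "bad_at i j D"
    using assms by (auto simp: bad_tuples_def)
  obtain L cb cs db x ds R where s: "D = L @ (cb @ cs) # (db @ x # ds) # R" "length L = j" "length cs = i" "length ds = i"
    "\<forall>a\<in>set cs. a < x" "\<forall>a\<in>set cb. x < a" "\<forall>a\<in>set db. x < a"
    "sorted_wrt (>) cb" "sorted_wrt (>) cs" "sorted_wrt (>) db" "sorted_wrt (>) (x # ds)"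
    "set (cb @ cs @ db @ x # ds) \<subseteq> {..<n}"
    using bad_at_split[OF D(3,1)] .
  define z where "z = y \<circ> word_perm (concat L)"
  define z' where "z' = z \<circ> word_perm (cb @ db)"
  let ?p = "int (length cb)" and ?q = "int (length db)"
  have far: "Suc a < b" if "a \<in> set cs" "b \<in> set e" "\<forall>a\<in>set e. x < a" for a b e
    using s(5) that by fastforce
  have sorts: "sorts y (concat (L @ (b @ cs) # (e @ x # ds) # R)) \<longleftrightarrow>
      descending y (concat L) \<and> descending z (b @ e) \<and> sorts (z \<circ> word_perm (b @ e)) (cs @ x # ds @ concat R)"
    if "\<forall>a\<in>set e. x < a" for b e
    using sorts_exchange[of cs e z b "x # ds @ concat R"] far[OF _ _ that]
    by (auto simp: sorts_append z_def)
  have desc: "descending y (concat L)" "descending z (cb @ db)" "sorts z' (cs @ x # ds @ concat R)"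
    using D(2) sorts[OF s(7), of cb] by (auto simp: s(1) z'_def)
  have pair: "(cb, db) \<in> Dec_pairs n (Suc x) z z' ?p ?q"
    using s(6-12) desc(2) by (auto simp: Dec_pairs_def Dec_def z'_def Suc_le_eq)
  obtain cb' db' where e: "exch n (Suc x) z z' ?p ?q (cb, db) = (cb', db')"
    by (cases "exch n (Suc x) z z' ?p ?q (cb, db)")
  have pair': "(cb', db') \<in> Dec_pairs n (Suc x) z z' ?q ?p"
    using bij_betwE[OF exch_bij[of n "Suc x" z z' ?p ?q]] pair e by force
  have E: "exch_tuple n i j y D = L @ (cb' @ cs) # (db' @ x # ds) # R"
    unfolding s(1) by (rule exch_tuple_eq[OF s(2-4) z_def]) (use e in \<open>simp add: z'_def\<close>)
  have p': "\<forall>a\<in>set cb'. x < a" "\<forall>a\<in>set db'. x < a" "sorted_wrt (>) cb'" "sorted_wrt (>) db'"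
    "set cb' \<subseteq> {..<n}" "set db' \<subseteq> {..<n}" "length cb' = length db" "length db' = length cb"
    "descending z (cb' @ db')" "z \<circ> word_perm (cb' @ db') = z'"
    using pair' by (fastforce simp: Dec_pairs_def Dec_def Suc_le_eq)+
  have "bad_at i j (exch_tuple n i j y D)"
    unfolding E by (rule bad_at_replace[OF _ s(2-4) p'(1)]) (use D(3) s(1) in simp)
  moreover have "sorts y (concat (exch_tuple n i j y D))"
    unfolding E sorts[OF p'(2)] using p'(9,10) desc by simp
  moreover have "exch_tuple n i j y D \<in> tuples n (ks[j := ks ! Suc j - 1, Suc j := ks ! j + 1])"
  proof -
    have len: "length D = length ks" "Suc j < length ks"
      using D(1) s(1,2) by (auto simp: tuples_iff)
    have kj: "ks ! j = int (length cb + i)" "ks ! Suc j = int (length db + Suc i)"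
    proof -
      have "D ! j \<in> Dec n 0 (ks ! j)" "D ! Suc j \<in> Dec n 0 (ks ! Suc j)"
        using D(1) len by (simp_all add: tuples_iff)
      moreover have "D ! j = cb @ cs" "D ! Suc j = db @ x # ds"
        using s(1,2) by (simp_all add: nth_append)
      ultimately show "ks ! j = int (length cb + i)" "ks ! Suc j = int (length db + Suc i)"
        using s(3,4) by (simp_all add: Dec_def)
    qed
    have "sorted_wrt (>) (cb' @ cs)" "sorted_wrt (>) (db' @ x # ds)"
      using p'(1-4) s(5,9,11) by (auto simp: sorted_wrt_append; meson order.strict_trans)+
    then have cd: "cb' @ cs \<in> Dec n 0 (ks ! Suc j - 1)" "db' @ x # ds \<in> Dec n 0 (ks ! j + 1)"
      using kj p'(5-8) s(3,4,12) by (simp_all add: Dec_def atLeast0LessThan)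
    have "(L @ (cb' @ cs) # (db' @ x # ds) # R) ! k \<in> Dec n 0 (ks[j := ks ! Suc j - 1, Suc j := ks ! j + 1] ! k)"
      if "k < length ks" for k
    proof -
      consider "k = j" | "k = Suc j" | "k < j" | "k > Suc j" by linarith
      then show ?thesis
      proof cases
        case 3
        then have "(L @ (cb' @ cs) # (db' @ x # ds) # R) ! k = D ! k" using s by (simp add: nth_append)
        then show ?thesis using 3 D(1) that by (simp add: tuples_iff)
      next
        case 4
        then have "(L @ (cb' @ cs) # (db' @ x # ds) # R) ! k = D ! k"
          using s by (auto simp: nth_append nth_Cons split: nat.splits)
        then show ?thesis using 4 D(1) that by (simp add: tuples_iff)
      qed (use cd s(2) len in \<open>simp_all add: nth_append\<close>)
    qed
    then show ?thesis
      using len s(1) unfolding E tuples_iff by simp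
  qed
  ultimately show ?thesis
    using that[OF s(1-4) z_def pair e pair' E] by (simp add: bad_tuples_def)
qed

lemma finite_bad_tuples [simp]: "finite (bad_tuples n ks i j y)"
  unfolding bad_tuples_def by simp

text \<open>The image shows \<open>L\<close>, \<open>cs\<close>, \<open>x\<close>, \<open>ds\<close>
  and \<open>R\<close>, hence also the start and the end of the exchanged part and both lengths.
  These determine the bijection \<open>exch\<close> that was used, so it can be undone.\<close>

lemma card_bad_tuples_le:
  "card (bad_tuples n ks i j y) \<le> card (bad_tuples n (ks[j := ks ! Suc j - 1, Suc j := ks ! j + 1]) i j y)"
proof (rule card_inj_on_le[where f="exch_tuple n i j y"])
  show "inj_on (exch_tuple n i j y) (bad_tuples n ks i j y)"
  proof (rule inj_onI)
    fix D E assume D: "D \<in> bad_tuples n ks i j y" and E: "E \<in> bad_tuples n ks i j y"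
      and eq: "exch_tuple n i j y D = exch_tuple n i j y E"
    obtain L cb cs db x ds R cb' db' z z' where D':
      "D = L @ (cb @ cs) # (db @ x # ds) # R" "length L = j" "length cs = i" "length ds = i"
      "z = y \<circ> word_perm (concat L)" "(cb, db) \<in> Dec_pairs n (Suc x) z z' (int (length cb)) (int (length db))"
      "exch n (Suc x) z z' (int (length cb)) (int (length db)) (cb, db) = (cb', db')"
      "(cb', db') \<in> Dec_pairs n (Suc x) z z' (int (length db)) (int (length cb))"
      "exch_tuple n i j y D = L @ (cb' @ cs) # (db' @ x # ds) # R"
      using exch_tuple_spec[OF D] .
    obtain L2 cb2 cs2 db2 x2 ds2 R2 cb2' db2' z2 z2' where E':
      "E = L2 @ (cb2 @ cs2) # (db2 @ x2 # ds2) # R2" "length L2 = j" "length cs2 = i" "length ds2 = i"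
      "z2 = y \<circ> word_perm (concat L2)" "(cb2, db2) \<in> Dec_pairs n (Suc x2) z2 z2' (int (length cb2)) (int (length db2))"
      "exch n (Suc x2) z2 z2' (int (length cb2)) (int (length db2)) (cb2, db2) = (cb2', db2')"
      "(cb2', db2') \<in> Dec_pairs n (Suc x2) z2 z2' (int (length db2)) (int (length cb2))"
      "exch_tuple n i j y E = L2 @ (cb2' @ cs2) # (db2' @ x2 # ds2) # R2"
      using exch_tuple_spec[OF E] .
    have "L = L2" "cb' @ cs = cb2' @ cs2" "db' @ x # ds = db2' @ x2 # ds2" "R = R2"
      using eq D'(2,9) E'(2,9) by auto
    then have s: "L = L2" "cb' = cb2'" "cs = cs2" "db' = db2'" "x = x2" "ds = ds2" "R = R2"
      using D'(3,4) E'(3,4) by auto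
    have z: "z = z2" using D'(5) E'(5) s by simp
    have z': "z' = z2'" using D'(8) E'(8) s z by (auto simp: Dec_pairs_def)
    have l: "length cb = length cb2" "length db = length db2"
      using D'(8) E'(8) s by (auto simp: Dec_pairs_def Dec_def)
    have "inj_on (exch n (Suc x) z z' (int (length cb)) (int (length db)))
        (Dec_pairs n (Suc x) z z' (int (length cb)) (int (length db)))"
      by (rule bij_betw_imp_inj_on[OF exch_bij])
    moreover have "exch n (Suc x) z z' (int (length cb)) (int (length db)) (cb, db)
        = exch n (Suc x) z z' (int (length cb)) (int (length db)) (cb2, db2)"
      using D'(7) E'(7) s z z' l by simp
    moreover have "(cb2, db2) \<in> Dec_pairs n (Suc x) z z' (int (length cb)) (int (length db))"
      using E'(6) s z z' l by simp
    ultimately have "(cb, db) = (cb2, db2)"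
      using D'(6) by (metis inj_onD)
    then show "D = E" using D'(1) E'(1) s by simp
  qed
  show "exch_tuple n i j y ` bad_tuples n ks i j y \<subseteq>
      bad_tuples n (ks[j := ks ! Suc j - 1, Suc j := ks ! j + 1]) i j y"
    using exch_tuple_spec by blast
qed simp

lemma bad_tuples_empty: "length ks \<le> Suc j \<Longrightarrow> bad_tuples n ks i j y = {}"
  by (auto simp: bad_tuples_def bad_at_def tuples_iff)

lemma card_bad_tuples:
  "card (bad_tuples n (ks[j := ks ! Suc j - 1, Suc j := ks ! j + 1]) i j y) = card (bad_tuples n ks i j y)"
proof (cases "Suc j < length ks")
  case True
  define ks' where "ks' = ks[j := ks ! Suc j - 1, Suc j := ks ! j + 1]"
  \<comment> \<open>The change of lengths is an involution, which gives the reverse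
    inequality.\<close>
  have "ks'[j := ks' ! Suc j - 1, Suc j := ks' ! j + 1] = ks"
    using True by (auto simp: ks'_def list_eq_iff_nth_eq nth_list_update)
  then show ?thesis
    using card_bad_tuples_le[of n ks i j y] card_bad_tuples_le[of n ks' i j y]
    by (simp add: ks'_def)
qed (simp add: bad_tuples_empty)

lemma distinct_decreasing: "sorted_wrt (>) (v :: nat list) \<Longrightarrow> distinct v"
  by (induction v) auto

lemma length_Dec_le: "v \<in> Dec n 0 k \<Longrightarrow> length v \<le> n"
  using card_mono[of "{0..<n}" "set v"] distinct_decreasing[of v]
  by (simp add: Dec_def distinct_card)

lemma tuple_count_split:
  "tuple_count n ks y = int (card {D \<in> tuples n ks. tabloid D \<and> sorts y (concat D)})
     + (\<Sum>(i, j)\<in>{..<n} \<times> {..<length ks}. int (card (bad_tuples n ks i j y)))"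
proof -
  have "{D \<in> tuples n ks. sorts y (concat D)} = {D \<in> tuples n ks. tabloid D \<and> sorts y (concat D)}
      \<union> (\<Union>(i, j)\<in>{..<n} \<times> {..<length ks}. bad_tuples n ks i j y)" (is "?A = ?G \<union> ?B")
  proof
    show "?A \<subseteq> ?G \<union> ?B"
    proof
      fix D assume D: "D \<in> ?A"
      show "D \<in> ?G \<union> ?B"
      proof (cases "tabloid D")
        case False
        then obtain i j where b: "bad_at i j D" using not_tabloid_bad_at by blast
        have len: "Suc j < length D" "length D = length ks" "i < length (D ! Suc j)"
          using b D by (auto simp: bad_at_def viol_def tuples_iff)
        then have "D ! Suc j \<in> Dec n 0 (ks ! Suc j)" using D by (auto simp: tuples_iff)
        then have "length (D ! Suc j) \<le> n" by (rule length_Dec_le)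
        then have "i < n" "j < length ks" using len by auto
        then show ?thesis using D b by (auto simp: bad_tuples_def)
      qed (use D in simp)
    qed
    show "?G \<union> ?B \<subseteq> ?A" by (auto simp: bad_tuples_def)
  qed
  moreover have "card (?G \<union> ?B) = card ?G + card ?B"
    by (rule card_Un_disjoint) (auto simp: bad_tuples_def dest: bad_at_not_tabloid)
  moreover have "card ?B = (\<Sum>(i, j)\<in>{..<n} \<times> {..<length ks}. card (bad_tuples n ks i j y))"
    unfolding case_prod_unfold
    by (rule card_UN_disjoint) (auto simp: bad_tuples_def dest: bad_at_unique)
  ultimately show ?thesis
    by (simp add: tuple_count_def case_prod_unfold)
qed

section \<open>The dual Jacobi-Trudi expansion of the number of tableaux\<close>

text \<open>The column lengths in the summand of \<open>p\<close> in the dual Jacobi-Trudi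
  determinant.\<close>

definition shifted :: "int list \<Rightarrow> (nat \<Rightarrow> nat) \<Rightarrow> int list" where
  "shifted ks p = map (\<lambda>j. ks ! p j + int j - int (p j)) [0..<length ks]"

lemma length_shifted [simp]: "length (shifted ks p) = length ks"
  by (simp add: shifted_def)

lemma shifted_id: "shifted ks id = ks"
  by (simp add: shifted_def map_nth)

lemma shifted_swap:
  assumes "Suc j < length ks"
  shows "shifted ks (p \<circ> adj j) = (shifted ks p)[j := shifted ks p ! Suc j - 1, Suc j := shifted ks p ! j + 1]"
proof (rule nth_equalityI)
  fix k assume "k < length (shifted ks (p \<circ> adj j))"
  then have k: "k < length ks" by simp
  consider "k = j" | "k = Suc j" | "k \<noteq> j" "k \<noteq> Suc j" by blast
  then show "shifted ks (p \<circ> adj j) ! k =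
      (shifted ks p)[j := shifted ks p ! Suc j - 1, Suc j := shifted ks p ! j + 1] ! k"
  proof cases
    case 1
    then show ?thesis using assms by (simp add: shifted_def)
  next
    case 2
    then show ?thesis using assms by (simp add: shifted_def)
  next
    case 3
    then show ?thesis using k by (simp add: shifted_def)
  qed
qed simp

text \<open>Composing \<open>p\<close> with \<open>adj j\<close> changes the sign. By
  \<open>shifted_swap\<close> it changes the lengths as the exchange does, so the number of bad
  tuples stays the same.\<close>

lemma signed_bad_sum:
  assumes "Suc j < length ks"
  shows "(\<Sum>p | p permutes {..<length ks}. sign p * int (card (bad_tuples n (shifted ks p) i j y))) = 0"
    (is "sum ?f ?P = 0")
proof -
  have t: "adj j permutes {..<length ks}"
    using assms by (intro permutes_swap_id) auto
  have "sum ?f ?P = (\<Sum>p\<in>?P. ?f (p \<circ> adj j))"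
    by (rule sum_permutations_compose_right[OF t])
  also have "\<dots> = (\<Sum>p\<in>?P. - ?f p)"
  proof (rule sum.cong)
    fix p assume "p \<in> ?P"
    then have "permutation p" by (auto simp: permutation_permutes)
    then have "sign (p \<circ> adj j) = - sign p"
      by (simp add: sign_compose permutation_swap_id sign_swap_id)
    then show "?f (p \<circ> adj j) = - ?f p"
      using assms by (simp add: shifted_swap card_bad_tuples)
  qed simp
  finally show ?thesis by (simp add: sum_negf)
qed

lemma tabloid_lengths:
  assumes "tabloid D" "Suc j < length D"
  shows "length (D ! Suc j) \<le> length (D ! j)"
  using assms(1)[unfolded tabloid_def viol_def, rule_format, OF assms(2), of "length (D ! j)"]
  by simp

text \<open>Column lengths of a tableau weakly decrease. A descent of \<open>p\<close> at
  \<open>j\<close> would make column \<open>j\<close> strictly shorter than column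
  \<open>Suc j\<close>.\<close>

lemma tabloid_shifted:
  assumes "D \<in> tuples n (shifted ks p)" "tabloid D" "p permutes {..<length ks}" "sorted_wrt (\<ge>) ks"
  shows "p = id"
proof -
  let ?K = "length ks"
  have len: "length D = ?K" and ent: "int (length (D ! j)) = ks ! p j + int j - int (p j)" if "j < ?K" for j
    using assms(1) that by (auto simp: tuples_iff Dec_def shifted_def)
  have inn: "p j < ?K \<longleftrightarrow> j < ?K" for j
    using permutes_in_image[OF assms(3), of j] by simp
  have step: "p j < p (Suc j)" if "Suc j < ?K" for j
  proof (rule ccontr)
    assume "\<not> p j < p (Suc j)"
    moreover have "p j \<noteq> p (Suc j)"
      using permutes_inj[OF assms(3)] by (metis inj_eq n_not_Suc_n)
    ultimately have lt: "p (Suc j) < p j" by simp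
    then have "ks ! p j \<le> ks ! p (Suc j)"
      using assms(4) inn that by (simp add: sorted_wrt_iff_nth_less)
    moreover have "length (D ! Suc j) \<le> length (D ! j)"
      using tabloid_lengths[OF assms(2)] len that by simp
    ultimately show False
      using ent[of j] ent[of "Suc j"] that lt by simp
  qed
  show ?thesis
  proof (cases "?K = 0")
    case True
    then show ?thesis using assms(3) by simp
  next
    case False
    have "p permutes {..?K - 1}" using assms(3) False by (simp add: lessThan_Suc_atMost[symmetric])
    then show ?thesis by (rule permutes_no_descent) (use step in simp)
  qed
qed

text \<open>The bad tuples cancel by \<open>signed_bad_sum\<close>, and tableaux arise for the
  identity only. The right-hand side is linear in \<open>tuple_count\<close>, so that linear
  equations between tuple counts pass to tableaux.\<close>

theorem card_tabloids_eq:
  assumes "sorted_wrt (\<ge>) ks"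
  shows "int (card {D \<in> tuples n ks. tabloid D \<and> sorts y (concat D)})
    = (\<Sum>p | p permutes {..<length ks}. sign p * tuple_count n (shifted ks p) y)"
proof -
  let ?P = "{p. p permutes {..<length ks}}"
  let ?G = "\<lambda>ks. {D \<in> tuples n ks. tabloid D \<and> sorts y (concat D)}"
  have "(\<Sum>p\<in>?P. sign p * tuple_count n (shifted ks p) y)
    = (\<Sum>p\<in>?P. sign p * int (card (?G (shifted ks p))))
      + (\<Sum>p\<in>?P. \<Sum>(i, j)\<in>{..<n} \<times> {..<length ks}. sign p * int (card (bad_tuples n (shifted ks p) i j y)))"
    by (simp add: tuple_count_split algebra_simps sum.distrib sum_distrib_left case_prod_unfold)
  also have "(\<Sum>p\<in>?P. \<Sum>(i, j)\<in>{..<n} \<times> {..<length ks}. sign p * int (card (bad_tuples n (shifted ks p) i j y)))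
    = (\<Sum>(i, j)\<in>{..<n} \<times> {..<length ks}. \<Sum>p\<in>?P. sign p * int (card (bad_tuples n (shifted ks p) i j y)))"
    unfolding case_prod_unfold by (rule sum.swap)
  also have "\<dots> = 0"
  proof (intro sum.neutral ballI, clarify)
    fix i j
    show "(\<Sum>p\<in>?P. sign p * int (card (bad_tuples n (shifted ks p) i j y))) = 0"
      by (cases "Suc j < length ks") (simp_all add: signed_bad_sum bad_tuples_empty)
  qed
  also have "(\<Sum>p\<in>?P. sign p * int (card (?G (shifted ks p)))) = (\<Sum>p\<in>{id}. sign p * int (card (?G (shifted ks p))))"
  proof (rule sum.mono_neutral_right)
    show "\<forall>p\<in>?P - {id}. sign p * int (card (?G (shifted ks p))) = 0"
    proof
      fix p assume "p \<in> ?P - {id}"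
      then have "?G (shifted ks p) = {}"
        using tabloid_shifted[OF _ _ _ assms] by blast
      then show "sign p * int (card (?G (shifted ks p))) = 0" by (simp only: card.empty)
    qed
  qed (auto simp: finite_permutations permutes_id)
  finally show ?thesis by (simp add: shifted_id)
qed

section \<open>Edelman-Greene tableaux as lists of columns, and their transition equation\<close>

section \<open>Tableaux\<close>

text \<open>Columns are listed from bottom to top, so that \<open>concat\<close> gives the column
  word; nonempty columns make the representation unique.\<close>

definition tableaux :: "(nat \<Rightarrow> nat) \<Rightarrow> nat list list set" where
  "tableaux y = {D. [] \<notin> set D \<and> (\<forall>v\<in>set D. sorted_wrt (>) v) \<and> tabloid D \<and> sorts y (concat D)}"

lemma length_filter_antitone:
  assumes "sorted_wrt (\<lambda>x y. f y \<le> (f x :: nat)) xs"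
  shows "j < length (filter (\<lambda>x. i < f x) xs) \<longleftrightarrow> j < length xs \<and> i < f (xs ! j)"
  using assms
proof (induction xs arbitrary: j)
  case (Cons x xs)
  show ?case
  proof (cases "i < f x")
    case True
    then show ?thesis using Cons by (cases j) auto
  next
    case False
    then have "filter (\<lambda>x. i < f x) xs = []"
      using Cons.prems by (auto simp: filter_empty_conv not_less intro: order.trans)
    moreover have "\<not> i < f ((x # xs) ! j)" if "j < length (x # xs)"
      using False Cons.prems that by (cases j) (auto simp: all_set_conv_all_nth dest: order.trans)
    ultimately show ?thesis using False by auto
  qed
qed simp

lemma sorted_lengths: "sorted_wrt (\<ge>) (map length xs) \<longleftrightarrow> sorted (rev (map length xs))"
  by (simp add: sorted_wrt_rev)

lemma nth_transpose_iff:
  assumes "sorted_wrt (\<ge>) (map length T)" "j < length (List.transpose T)"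
  shows "i < length (List.transpose T ! j) \<longleftrightarrow> i < length T \<and> j < length (T ! i)"
    and "i < length (List.transpose T ! j) \<Longrightarrow> List.transpose T ! j ! i = T ! i ! j"
proof -
  show "i < length (List.transpose T ! j) \<longleftrightarrow> i < length T \<and> j < length (T ! i)"
    using length_filter_antitone[of length T i j] assms by (simp add: nth_transpose sorted_wrt_map)
  then show "i < length (List.transpose T ! j) \<Longrightarrow> List.transpose T ! j ! i = T ! i ! j"
    using nth_nth_transpose_sorted[of T j i] length_filter_antitone[of length T i j] assms
    by (simp add: sorted_lengths[symmetric] sorted_wrt_map)
qed

lemma transpose_nonempty:
  assumes "sorted_wrt (\<ge>) (map length T)"
  shows "[] \<notin> set (List.transpose T)"
proof
  assume "[] \<in> set (List.transpose T)"
  then obtain j where j: "j < length (List.transpose T)" "List.transpose T ! j = []"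
    by (metis in_set_conv_nth)
  have "length (List.transpose T) = (if T = [] then 0 else length (T ! 0))"
    using assms by (simp add: length_transpose_sorted sorted_lengths)
  then have "0 < length T \<and> j < length (T ! 0)" using j(1) by (auto split: if_splits)
  then show False using nth_transpose_iff(1)[OF assms j(1), of 0] j(2) by simp
qed

lemma transpose_involution:
  assumes "sorted_wrt (\<ge>) (map length T)" "[] \<notin> set T"
  shows "List.transpose (List.transpose T) = T"
  using assms by (simp add: transpose_transpose sorted_lengths takeWhile_eq_all_conv) metis

lemma tabloid_sorted_lengths: "tabloid D \<Longrightarrow> sorted_wrt (\<ge>) (map length D)"
  by (rule sorted_wrt_iff_nth_Suc_transp[THEN iffD2])
    (auto simp: tabloid_lengths intro: transpI)

lemma viol_rev: "viol v w i \<longleftrightarrow> i < length (rev w) \<and> (length (rev v) \<le> i \<or> rev w ! i < rev v ! i)"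
  by (simp add: viol_def)

text \<open>Transposing and reversing each column passes from lists of rows to lists of columns in
  reading order, and \<open>reduced_word_iff_sorts\<close> replaces reduced words of
  \<open>w\<close> by sorting words of \<open>inv w\<close>.\<close>

lemma card_EG_tableaux:
  assumes "w permutes {1..n}"
  shows "card (EG_tableaux w) = card (tableaux (inv w))"
proof -
  let ?f = "\<lambda>T. map rev (List.transpose T)" and ?g = "\<lambda>D. List.transpose (map rev D)"
  have "bij_betw ?f (EG_tableaux w) (tableaux (inv w))"
  proof (rule bij_betw_byWitness[where f'="?g"])
    show "\<forall>T\<in>EG_tableaux w. ?g (?f T) = T"
      by (auto simp: EG_tableaux_def semistandard_def comp_def transpose_involution)
    have sD: "sorted_wrt (\<ge>) (map length (map rev D))" if "tabloid D" for D
      using tabloid_sorted_lengths[OF that] by (simp add: comp_def)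
    show "\<forall>D\<in>tableaux (inv w). ?f (?g D) = D"
    proof
      fix D assume D: "D \<in> tableaux (inv w)"
      then have "List.transpose (List.transpose (map rev D)) = map rev D"
        by (intro transpose_involution sD) (auto simp: tableaux_def)
      then show "?f (?g D) = D" by (simp add: comp_def)
    qed
    show "?f ` EG_tableaux w \<subseteq> tableaux (inv w)"
    proof (rule image_subsetI)
      fix T assume T: "T \<in> EG_tableaux w"
      then have s: "sorted_wrt (\<ge>) (map length T)" "\<forall>r\<in>set T. sorted_wrt (\<le>) r"
        "\<forall>c\<in>set (List.transpose T). sorted_wrt (<) c" "sorts (inv w) (column_word T)"
        by (auto simp: EG_tableaux_def semistandard_def reduced_word_iff_sorts[OF assms])
      have "tabloid (?f T)"
        unfolding tabloid_def
      proof (intro allI impI)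
        fix j i assume j: "Suc j < length (?f T)"
        show "\<not> viol (?f T ! j) (?f T ! Suc j) i"
        proof (cases "i < length (List.transpose T ! Suc j)")
          case True
          then have i: "i < length T" "Suc j < length (T ! i)"
            using nth_transpose_iff(1)[OF s(1), of "Suc j" i] j by auto
          then have "T ! i ! j \<le> T ! i ! Suc j"
            using s(2) by (auto simp: sorted_wrt_iff_nth_less)
          then show ?thesis
            using j True i nth_transpose_iff[OF s(1), of j i] nth_transpose_iff(2)[OF s(1), of "Suc j" i]
            by (auto simp: viol_rev)
        qed (use j in \<open>simp add: viol_rev\<close>)
      qed
      then show "?f T \<in> tableaux (inv w)"
        using s transpose_nonempty[OF s(1)]
        by (auto simp: tableaux_def column_word_def sorted_wrt_rev)
    qed
    show "?g ` tableaux (inv w) \<subseteq> EG_tableaux w"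
    proof (rule image_subsetI)
      fix D assume D: "D \<in> tableaux (inv w)"
      define C where "C = map rev D"
      have tab: "tabloid D" and so: "sorts (inv w) (concat D)" using D by (auto simp: tableaux_def)
      have sC: "sorted_wrt (\<ge>) (map length C)" "[] \<notin> set C"
        using sD[OF tab] D by (auto simp: C_def tableaux_def)
      have tt: "List.transpose (List.transpose C) = C" using transpose_involution[OF sC] .
      have lt: "sorted_wrt (\<ge>) (map length (List.transpose C))" by (simp add: sorted_lengths)
      have "set (concat D) \<subseteq> {1..<n}"
        using sorts_letters[OF permutes_inv[OF assms] so] .
      then have letters: "set c \<subseteq> {1..}" if "c \<in> set C" for c
        using that by (fastforce simp: C_def)
      have entry: "List.transpose C ! i ! j = C ! j ! i" "j < length C" "i < length (C ! j)"
        if "i < length (List.transpose C)" "j < length (List.transpose C ! i)" for i j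
        using nth_transpose_iff[OF sC(1) that(1), of j] that(2) by auto
      have "set r \<subseteq> {1..} \<and> sorted_wrt (\<le>) r" if r: "r \<in> set (List.transpose C)" for r
      proof -
        obtain i where i: "i < length (List.transpose C)" "r = List.transpose C ! i"
          using r by (metis in_set_conv_nth)
        have "r ! j \<ge> 1" if "j < length r" for j
          using entry[of i j] i that letters[of "C ! j"] by (auto simp: in_set_conv_nth) (metis atLeast_iff nth_mem subsetD)
        moreover have "r ! j \<le> r ! Suc j" if "Suc j < length r" for j
          using entry[of i j] entry[of i "Suc j"] i that tab
          by (auto simp: tabloid_def viol_rev C_def) (metis nat_le_linear linorder_not_less)
        ultimately show ?thesis
          by (auto simp: in_set_conv_nth sorted_iff_nth_Suc)
      qed
      moreover have "sorted_wrt (<) c" if "c \<in> set C" for c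
        using that D by (auto simp: C_def tableaux_def sorted_wrt_rev)
      ultimately have "semistandard (List.transpose C)"
        unfolding semistandard_def tt using lt transpose_nonempty[OF sC(1)] by blast
      moreover have "column_word (List.transpose C) = concat D"
        unfolding column_word_def tt by (simp add: C_def comp_def)
      ultimately show "?g D \<in> EG_tableaux w"
        using so by (simp add: EG_tableaux_def reduced_word_iff_sorts[OF assms] C_def)
    qed
  qed
  then show ?thesis by (rule bij_betw_same_card)
qed

lemma tabloid_Cons:
  "tabloid (v # D) \<longleftrightarrow> (D = [] \<or> (\<forall>i. \<not> viol v (hd D) i)) \<and> tabloid D"
proof (cases D)
  case (Cons w E)
  have "tabloid (v # D) \<longleftrightarrow> (\<forall>j<Suc (length E). \<forall>i. \<not> viol ((v # D) ! j) (D ! j) i)"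
    by (auto simp: tabloid_def Cons)
  also have "\<dots> \<longleftrightarrow> (\<forall>i. \<not> viol v w i) \<and> tabloid D"
    unfolding All_less_Suc2 by (auto simp: tabloid_def Cons)
  finally show ?thesis by (simp add: Cons)
qed (simp add: tabloid_def)

lemma tabloid_append_Nil: "tabloid (D @ replicate k []) \<longleftrightarrow> tabloid D"
proof (induction D)
  case Nil
  then show ?case by (auto simp: tabloid_def viol_def)
next
  case (Cons v D)
  then show ?case by (cases D; cases k) (auto simp: tabloid_Cons viol_def)
qed

lemma tabloid_filter_Nil:
  "tabloid D \<Longrightarrow> D = filter (\<lambda>v. v \<noteq> []) D @ replicate (length D - length (filter (\<lambda>v. v \<noteq> []) D)) []"
proof (induction D)
  case (Cons v D)
  have IH: "D = filter (\<lambda>v. v \<noteq> []) D @ replicate (length D - length (filter (\<lambda>v. v \<noteq> []) D)) []"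
    using Cons by (simp add: tabloid_Cons)
  show ?case
  proof (cases "v = []")
    case True
    have "\<forall>w\<in>set D. w = []"
      using tabloid_sorted_lengths[OF Cons.prems] True by auto
    then have "filter (\<lambda>v. v \<noteq> []) D = []" by (simp add: filter_empty_conv)
    then show ?thesis using IH True by simp
  next
    case False
    then show ?thesis using IH by simp
  qed
qed simp

text \<open>Column lengths are padded by zeros to a common number \<open>K\<close> of columns, so
  that one size of determinant serves all permutations in a transition equation.\<close>

definition shapes :: "nat \<Rightarrow> nat \<Rightarrow> int list set" where
  "shapes m K = {ks. length ks = K \<and> sorted_wrt (\<ge>) ks \<and> set ks \<subseteq> {0..int m}}"

lemma finite_shapes [simp]: "finite (shapes m K)"
  unfolding shapes_def
  by (rule finite_subset[OF _ finite_lists_length_eq[of "{0..int m}" K]]) auto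

lemma length_le_length_concat: "[] \<notin> set D \<Longrightarrow> length D \<le> length (concat D)"
proof (induction D)
  case (Cons v D)
  then show ?case by (cases v) auto
qed simp

text \<open>A tableau without empty columns has at most as many columns as letters, hence at most
  \<open>K\<close>; empty columns at the right fill it up.\<close>

lemma card_tableaux_eq_sum:
  assumes "y permutes {0..m}" "card (invs y) \<le> K"
  shows "int (card (tableaux y)) = (\<Sum>ks\<in>shapes m K. int (card {D \<in> tuples m ks. tabloid D \<and> sorts y (concat D)}))"
proof -
  let ?G = "\<lambda>ks. {D \<in> tuples m ks. tabloid D \<and> sorts y (concat D)}"
  let ?U = "\<Union>ks\<in>shapes m K. ?G ks"
  let ?f = "filter (\<lambda>v. v \<noteq> [])" and ?g = "\<lambda>D. D @ replicate (K - length D) []"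
  have c: "concat (?f D) = concat D" for D :: "nat list list" by (induction D) auto
  have "bij_betw ?f ?U (tableaux y)"
  proof (rule bij_betw_byWitness[where f'="?g"])
    show "\<forall>D\<in>?U. ?g (?f D) = D"
      using tabloid_filter_Nil by (auto simp: shapes_def tuples_iff) metis
    show "\<forall>D\<in>tableaux y. ?f (?g D) = D"
      by (auto simp: tableaux_def filter_id_conv)
    show "?f ` ?U \<subseteq> tableaux y"
    proof (rule image_subsetI)
      fix D assume "D \<in> ?U"
      then obtain ks where D: "D \<in> tuples m ks" "tabloid D" "sorts y (concat D)" by auto
      then have "tabloid (?f D)"
        using tabloid_filter_Nil[OF D(2)] tabloid_append_Nil by metis
      moreover have "\<forall>v\<in>set D. sorted_wrt (>) v"
        using D(1) by (auto simp: tuples_iff Dec_def in_set_conv_nth)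
      ultimately show "?f D \<in> tableaux y"
        using D(3) by (simp add: tableaux_def c)
    qed
    show "?g ` tableaux y \<subseteq> ?U"
    proof (rule image_subsetI)
      fix D assume D: "D \<in> tableaux y"
      define E where "E = ?g D"
      define ks where "ks = map (\<lambda>v. int (length v)) E"
      have so: "sorts y (concat D)" using D by (simp add: tableaux_def)
      have "y permutes {..m}" using assms(1) by (simp add: atLeast0AtMost)
      then have "length (concat D) \<le> K"
        using sorts_length[OF so finite_invs] assms(2) by simp
      then have len: "length D \<le> K"
        using length_le_length_concat[of D] D by (simp add: tableaux_def)
      have letters: "set (concat D) \<subseteq> {0..<m}" using sorts_letters[OF assms(1) so] .
      have dec: "v \<in> Dec m 0 (int (length v))" if "v \<in> set E" for v
        using that D letters by (auto simp: E_def Dec_def tableaux_def split: if_splits)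
      have tab: "tabloid E" using D by (simp add: E_def tabloid_append_Nil tableaux_def)
      have "E \<in> tuples m ks" using dec by (auto simp: tuples_iff ks_def)
      moreover have "sorted_wrt (\<ge>) (replicate k (0 :: int))" for k
        by (induction k) auto
      then have "ks \<in> shapes m K"
        using len tabloid_sorted_lengths[OF tab] length_Dec_le[OF dec]
        by (auto simp: shapes_def ks_def E_def sorted_wrt_map sorted_wrt_append)
      moreover have "sorts y (concat E)" using so by (simp add: E_def)
      ultimately show "?g D \<in> ?U" using tab unfolding E_def by blast
    qed
  qed
  then have "card (tableaux y) = card ?U" by (simp add: bij_betw_same_card)
  also have "\<dots> = (\<Sum>ks\<in>shapes m K. card (?G ks))"
  proof (rule card_UN_disjoint)
    show "\<forall>ks\<in>shapes m K. \<forall>ks'\<in>shapes m K. ks \<noteq> ks' \<longrightarrow> ?G ks \<inter> ?G ks' = {}"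
      by (auto simp: tuples_iff Dec_def list_eq_iff_nth_eq)
  qed auto
  finally show ?thesis by simp
qed

text \<open>The number of tableaux is one fixed integer combination of tuple counts for all
  permutations involved, so \<open>tuple_count_transition\<close> applies term by term.\<close>

theorem tableaux_transition:
  assumes "u permutes {1..n}" "1 \<le> r" "r \<le> n"
  shows "(\<Sum>j | (r, j) \<in> covers (Suc n) u. card (tableaux (u \<circ> Transposition.transpose r j)))
    = (\<Sum>i | (i, r) \<in> covers (Suc n) u. card (tableaux (u \<circ> Transposition.transpose i r)))"
proof -
  let ?t = "Transposition.transpose" and ?C = "covers (Suc n) u"
  \<comment> \<open>The sum of all lengths bounds each of them, which gives one \<open>K\<close> for
    both sides.\<close>
  define K where "K = (\<Sum>(i, j)\<in>?C. card (invs (u \<circ> ?t i j)))"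
  define N where "N y = (\<Sum>ks\<in>shapes (Suc n) K. \<Sum>p | p permutes {..<K}. sign p * tuple_count (Suc n) (shifted ks p) y)" for y
  have N: "int (card (tableaux (u \<circ> ?t i j))) = N (u \<circ> ?t i j)" if ij: "(i, j) \<in> ?C" for i j
  proof -
    have "u permutes {0..Suc n}" by (rule permutes_subset[OF assms(1)]) auto
    then have p: "u \<circ> ?t i j permutes {0..Suc n}"
      using ij by (intro permutes_compose permutes_swap_id) (auto simp: covers_def)
    have "card (invs (u \<circ> ?t i j)) \<le> K"
      using member_le_sum[OF ij, of "\<lambda>(i, j). card (invs (u \<circ> ?t i j))"] by (simp add: K_def)
    then show ?thesis
      by (simp add: card_tableaux_eq_sum[OF p] N_def card_tabloids_eq shapes_def)
  qed
  have N': "(\<Sum>x\<in>A. N (h x)) = (\<Sum>ks\<in>shapes (Suc n) K. \<Sum>p | p permutes {..<K}.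
      sign p * (\<Sum>x\<in>A. tuple_count (Suc n) (shifted ks p) (h x)))" for A :: "nat set" and h
    unfolding N_def sum_distrib_left
    by (rule trans[OF sum.swap], rule sum.cong[OF refl], rule sum.swap)
  have "int (\<Sum>j | (r, j) \<in> ?C. card (tableaux (u \<circ> ?t r j))) = (\<Sum>j | (r, j) \<in> ?C. N (u \<circ> ?t r j))"
    by (simp add: N)
  also have "\<dots> = (\<Sum>i | (i, r) \<in> ?C. N (u \<circ> ?t i r))"
    unfolding N' tuple_count_transition[OF assms] ..
  also have "\<dots> = int (\<Sum>i | (i, r) \<in> ?C. card (tableaux (u \<circ> ?t i r)))"
    by (simp add: N)
  finally show ?thesis by (simp only: of_nat_eq_iff)
qed

lemma tableaux_id: "tableaux id = {[]}"
proof -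
  have "D = []" if "D \<in> tableaux id" for D
  proof (cases D)
    case (Cons v E)
    then show ?thesis using that by (cases v) (auto simp: tableaux_def sorts_Cons)
  qed
  then show ?thesis by (auto simp: tableaux_def tabloid_def)
qed

text \<open>The entry \<open>m\<close> in position \<open>p\<close> can only reach position \<open>m\<close> by means of the
  letters \<open>p - 1, \<dots>, m\<close>, in this order.\<close>

lemma sorts_subseq:
  assumes "sorts y as" "y permutes {m..n}" "y p = m" "m \<le> p"
  shows "subseq (rev [m..<p]) as"
  using assms
proof (induction as arbitrary: y p)
  case Nil
  then have "y = id" by (simp only: sorts_Nil)
  then show ?case using Nil.prems(3) by simp
next
  case (Cons a as)
  have d: "y (Suc a) < y a" and so: "sorts (y \<circ> adj a) as"
    using Cons.prems(1) unfolding sorts_Cons by blast+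
  have "set (a # as) \<subseteq> {m..<n}" by (rule sorts_letters[OF Cons.prems(2,1)])
  then have a: "m \<le> a" "a < n" by auto
  then have p': "y \<circ> adj a permutes {m..n}"
    using Cons.prems(2) by (intro permutes_comp_adj) auto
  have "y (Suc a) \<ge> m" using permutes_in_image[OF Cons.prems(2), of "Suc a"] a by simp
  then have "p \<noteq> a" using d Cons.prems(3) by auto
  show ?case
  proof (cases "p = Suc a")
    case True
    have "subseq (rev [m..<a]) as"
      by (rule Cons.IH[OF so p']) (use Cons.prems(3) a True in auto)
    then show ?thesis using True a by simp
  next
    case False
    have "subseq (rev [m..<p]) as"
      by (rule Cons.IH[OF so p']) (use Cons.prems(3,4) False \<open>p \<noteq> a\<close> in auto)
    then show ?thesis by (rule list_emb_Cons)
  qed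
qed

lemma card_le_rows:
  assumes "sorted_wrt (>) (v :: nat list)"
  shows "card {e \<in> set v. e \<le> h} = card {i. i < length v \<and> rev v ! i \<le> h}"
proof -
  have d: "distinct (rev v)" using distinct_decreasing[OF assms] by simp
  have "{e \<in> set v. e \<le> h} = (!) (rev v) ` {i. i < length v \<and> rev v ! i \<le> h}"
    by (subst set_rev[symmetric], subst set_conv_nth) auto
  moreover have "inj_on ((!) (rev v)) {i. i < length v \<and> rev v ! i \<le> h}"
    by (rule inj_on_nth[OF d]) auto
  ultimately show ?thesis by (simp add: card_image)
qed

text \<open>A bound of Schensted type. The part of the subsequence in later columns is bounded by
  the entries of the second column up to its head, and comparing rows moves this bound to the first
  column. The part in the first column consists of larger entries and is counted in
  addition.\<close>

lemma decreasing_subseq_length: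
  assumes "tabloid (c # D)" "\<forall>v\<in>set (c # D). sorted_wrt (>) v"
    and "subseq xs (concat (c # D))" "sorted_wrt (>) xs" "xs \<noteq> []"
  shows "length xs \<le> card {e \<in> set c. e \<le> hd xs}"
  using assms
proof (induction D arbitrary: c xs)
  case Nil
  have "set xs \<subseteq> set c" using Nil.prems(3) by (auto dest: list_emb_set)
  moreover have "\<forall>e\<in>set xs. e \<le> hd xs" using Nil.prems(4) by (cases xs) auto
  ultimately have "card (set xs) \<le> card {e \<in> set c. e \<le> hd xs}" by (intro card_mono) auto
  then show ?case using distinct_card[OF distinct_decreasing[OF Nil.prems(4)]] by simp
next
  case (Cons d D)
  have "subseq xs (c @ concat (d # D))" using Cons.prems(3) by simp
  then obtain us vs where xs: "xs = us @ vs" and us: "subseq us c" and vs: "subseq vs (concat (d # D))"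
    unfolding subseq_append_iff by blast
  have us': "set us \<subseteq> set c" using us by (auto dest: list_emb_set)
  have le: "\<forall>e\<in>set xs. e \<le> hd xs" using Cons.prems(4) by (cases xs) auto
  have dist: "distinct us" using distinct_decreasing[OF Cons.prems(4)] xs by simp
  show ?case
  proof (cases "vs = []")
    case True
    have "card (set us) \<le> card {e \<in> set c. e \<le> hd xs}" using us' le xs by (intro card_mono) auto
    then show ?thesis using True xs dist by (simp add: distinct_card)
  next
    case False
    define h where "h = hd vs"
    have gt: "\<forall>e\<in>set us. h < e" using Cons.prems(4) False unfolding xs h_def
      by (auto simp: sorted_wrt_append)
    have hx: "h \<le> hd xs" using le False unfolding xs h_def by auto
    have "length vs \<le> card {e \<in> set d. e \<le> h}"
      unfolding h_def
      by (rule Cons.IH[OF _ _ vs])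
        (use Cons.prems(1,2,4) False in \<open>simp_all add: tabloid_Cons xs sorted_wrt_append\<close>)
    also have "\<dots> \<le> card {e \<in> set c. e \<le> h}"
    proof -
      have "i < length c \<and> rev c ! i \<le> rev d ! i" if "i < length d" for i
      proof -
        have "\<not> viol c d i" using Cons.prems(1) by (simp add: tabloid_Cons)
        then show ?thesis using that by (simp add: viol_def not_le not_less)
      qed
      then have "{i. i < length d \<and> rev d ! i \<le> h} \<subseteq> {i. i < length c \<and> rev c ! i \<le> h}"
        by (auto intro: order.trans)
      then show ?thesis
        using Cons.prems(2) by (simp add: card_le_rows card_mono)
    qed
    finally have "length vs \<le> card {e \<in> set c. e \<le> h}" .
    moreover have "card (set us \<union> {e \<in> set c. e \<le> h}) = card (set us) + card {e \<in> set c. e \<le> h}"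
      using gt by (intro card_Un_disjoint) auto
    moreover have "card (set us \<union> {e \<in> set c. e \<le> h}) \<le> card {e \<in> set c. e \<le> hd xs}"
      using us' le hx xs by (intro card_mono) auto
    ultimately show ?thesis using dist by (simp add: xs distinct_card)
  qed
qed

lemma descending_cycle:
  assumes "y permutes {m..n}" "y (Suc r) = m" "m \<le> r"
  shows "descending y (rev [m..<Suc r]) \<and> y (word_perm (rev [m..<Suc r]) m) = m"
  using assms
proof (induction "r - m" arbitrary: y r)
  case 0
  then have "r = m" by simp
  have "y m \<noteq> m" using 0 \<open>r = m\<close> permutes_inj[OF 0(2)] by (metis inj_eq n_not_Suc_n)
  moreover have "y m \<ge> m"
    using permutes_in_image[OF 0(2), of m] permutes_not_in[OF 0(2), of m] by (cases "m \<le> n") auto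
  ultimately show ?case using 0 \<open>r = m\<close> by (simp add: word_perm_Cons)
next
  case (Suc k)
  then obtain r' where r: "r = Suc r'" "m \<le> r'" by (cases r) auto
  have rn: "Suc r \<le> n"
    using permutes_not_in[OF Suc.prems(1), of "Suc r"] Suc.prems(2,3) by (cases "Suc r \<le> n") auto
  have "y r \<noteq> m" using Suc.prems(2) permutes_inj[OF Suc.prems(1)] by (metis inj_eq n_not_Suc_n)
  moreover have "y r \<ge> m" using permutes_in_image[OF Suc.prems(1), of r] rn Suc.prems(3) by simp
  ultimately have d: "y (Suc r) < y r" using Suc.prems(2) by simp
  have "y \<circ> adj r permutes {m..n}"
    using rn Suc.prems by (intro permutes_comp_adj) auto
  then have "descending (y \<circ> adj r) (rev [m..<Suc r']) \<and> (y \<circ> adj r) (word_perm (rev [m..<Suc r']) m) = m"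
    by (intro Suc.hyps(1)) (use Suc.hyps(2) Suc.prems(2) r in auto)
  moreover have "rev [m..<Suc r] = r # rev [m..<Suc r']" using r by simp
  ultimately show ?case using d by (simp add: word_perm_Cons)
qed

lemma sorted_subset_eq:
  assumes "sorted_wrt (>) (v :: nat list)" "set v \<subseteq> {m..<p}" "p - m \<le> length v"
  shows "v = rev [m..<p]"
proof -
  have "card (set v) = length v" using distinct_decreasing[OF assms(1)] by (rule distinct_card)
  moreover have "card (set v) \<le> card {m..<p}" using assms(2) by (intro card_mono) auto
  ultimately have "set v = {m..<p}" using assms(2,3) by (intro card_subset_eq) auto
  moreover have "sorted_wrt (<) (rev v)" using assms(1) by (simp add: sorted_wrt_rev)
  ultimately have "rev v = [m..<p]"
    by (intro strict_sorted_equal) auto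
  then show ?thesis by (metis rev_rev_ident)
qed

text \<open>The first column is forced. By \<open>sorts_subseq\<close> the column word contains r,
  ..., m as a subsequence, so the first column has at least that many letters by
  \<open>decreasing_subseq_length\<close>. All of them are at most \<open>r\<close>, since
  \<open>y\<close> has no descent beyond. Conversely, this column fits in front of every tableau of
  the remaining permutation, whose first column uses letters from m+1 to r+1 only.\<close>

lemma card_tableaux_cycle:
  assumes "y permutes {m..n}" "y (Suc r) = m" "m \<le> r" "\<And>k. r < k \<Longrightarrow> y k < y (Suc k)"
  shows "y \<circ> word_perm (rev [m..<Suc r]) permutes {Suc m..n}"
    and "card (tableaux y) = card (tableaux (y \<circ> word_perm (rev [m..<Suc r])))"
proof -
  define c where "c = rev [m..<Suc r]"
  define z where "z = y \<circ> word_perm c"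
  have dc: "descending y c" and zm: "z m = m"
    using descending_cycle[OF assms(1-3)] by (auto simp: c_def z_def)
  have zp: "z permutes {m..n}"
    using descending_permutes[OF assms(1) dc] by (simp add: z_def)
  show zp': "y \<circ> word_perm (rev [m..<Suc r]) permutes {Suc m..n}"
    unfolding c_def[symmetric] z_def[symmetric]
    by (rule permutes_superset[OF zp]) (use zm in \<open>auto simp: not_less_eq_eq le_antisym\<close>)
  then have zp': "z permutes {Suc m..n}" by (simp add: z_def c_def)
  have zy: "z k = y k" if "Suc r < k" for k
    unfolding z_def comp_apply by (rule arg_cong[OF word_perm_notin]) (use that in \<open>auto simp: c_def\<close>)
  have "(#) c ` tableaux z = tableaux y"
  proof
    show "(#) c ` tableaux z \<subseteq> tableaux y"
    proof (rule image_subsetI)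
      fix D assume D: "D \<in> tableaux z"
      have so: "sorts z (concat D)" using D by (simp add: tableaux_def)
      have "tabloid (c # D)"
      proof (cases D)
        case (Cons d E)
        have d: "sorted_wrt (>) d" "d \<noteq> []" using D Cons by (auto simp: tableaux_def)
        have "set (concat D) \<subseteq> {Suc m..<n}" by (rule sorts_letters[OF zp' so])
        then have dm: "\<forall>e\<in>set d. Suc m \<le> e" using Cons by auto
        have "z (Suc (hd d)) < z (hd d)"
          using so d(2) Cons by (cases d) (auto simp: sorts_Cons)
        then have "\<not> Suc r < hd d" using zy[of "hd d"] zy[of "Suc (hd d)"] assms(4)[of "hd d"] by auto
        moreover have "\<forall>e\<in>set d. e \<le> hd d" using d by (cases d) auto
        ultimately have ds: "set d \<subseteq> {Suc m..<Suc (Suc r)}" using dm by fastforce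
        have row: "Suc m + i \<le> rev d ! i" if "i < length d" for i
          using that
        proof (induction i)
          case 0
          then show ?case using dm by (simp add: rev_nth)
        next
          case (Suc i)
          have "sorted_wrt (<) (rev d)" using d(1) by (simp add: sorted_wrt_rev)
          then have "rev d ! i < rev d ! Suc i"
            using Suc.prems by (simp add: sorted_wrt_iff_nth_less)
          then show ?case using Suc by simp
        qed
        have "card (set d) \<le> card {Suc m..<Suc (Suc r)}" using ds by (intro card_mono) auto
        then have "length d \<le> length c"
          using distinct_card[OF distinct_decreasing[OF d(1)]] assms(3) by (simp add: c_def Suc_diff_le)
        then have "\<not> viol c d i" for i
          using row[of i] by (auto simp: viol_def c_def simp del: upt_Suc)
        then show ?thesis using D Cons by (simp add: tabloid_Cons tableaux_def)
      qed (simp add: tabloid_def)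
      moreover have "sorted_wrt (>) c" by (simp add: c_def sorted_wrt_rev del: upt_Suc)
      moreover have "c \<noteq> []" using assms(3) by (simp add: c_def)
      moreover have "sorts y (c @ concat D)" using dc so by (simp add: sorts_append z_def)
      ultimately show "c # D \<in> tableaux y" using D by (simp add: tableaux_def)
    qed
    show "tableaux y \<subseteq> (#) c ` tableaux z"
    proof
      fix D assume D: "D \<in> tableaux y"
      have so: "sorts y (concat D)" using D by (simp add: tableaux_def)
      have sub: "subseq c (concat D)"
        unfolding c_def by (rule sorts_subseq[OF so assms(1,2)]) (use assms(3) in simp)
      have cne: "c \<noteq> []" using assms(3) by (simp add: c_def)
      show "D \<in> (#) c ` tableaux z"
      proof (cases D)
        case Nil
        then show ?thesis using sub cne by simp
      next
        case (Cons v E)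
        have v: "sorted_wrt (>) v" "v \<noteq> []" using D Cons by (auto simp: tableaux_def)
        have "set (concat D) \<subseteq> {m..<n}" by (rule sorts_letters[OF assms(1) so])
        then have vm: "\<forall>e\<in>set v. m \<le> e" using Cons by auto
        have "y (Suc (hd v)) < y (hd v)"
          using so v(2) Cons by (cases v) (auto simp: sorts_Cons)
        then have "\<not> r < hd v" using assms(4)[of "hd v"] by auto
        moreover have "\<forall>e\<in>set v. e \<le> hd v" using v by (cases v) auto
        ultimately have vs: "set v \<subseteq> {m..<Suc r}" using vm by fastforce
        have "length c \<le> card {e \<in> set v. e \<le> hd c}"
          by (rule decreasing_subseq_length[of v E])
            (use D Cons sub cne in \<open>auto simp: tableaux_def c_def sorted_wrt_rev simp del: upt_Suc\<close>)
        also have "\<dots> \<le> card (set v)" by (intro card_mono) auto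
        also have "\<dots> \<le> length v" by (rule card_length)
        finally have "v = c"
          unfolding c_def by (intro sorted_subset_eq[OF v(1) vs]) (simp add: c_def del: upt_Suc)
        moreover have "E \<in> tableaux z"
          using D Cons \<open>v = c\<close> dc by (simp add: tableaux_def tabloid_Cons sorts_append z_def)
        ultimately show ?thesis using Cons by simp
      qed
    qed
  qed
  then have "card (tableaux y) = card ((#) c ` tableaux z)" by simp
  also have "\<dots> = card (tableaux z)" by (rule card_image) (simp add: inj_on_def)
  finally show "card (tableaux y) = card (tableaux (y \<circ> word_perm (rev [m..<Suc r])))"
    by (simp add: z_def c_def)
qed

section \<open>Procedures for evaluating the finite case analysis\<close>

section \<open>Finite checks\<close>

text \<open>Points (position, value) listed by increasing position. Points of a pattern have
  multiples of 6 as coordinates, which leaves room in each gap for the marked points at offsets 2 to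
  5; 0 and 100 act as bounds on either side.\<close>

type_synonym points = "(nat \<times> nat) list"

text \<open>A finite set of patterns, stored by their Lehmer codes; the child with index k belongs
  to the digit k.\<close>

datatype trie = Node bool "trie list"

primrec accepts :: "trie \<Rightarrow> bool" where "accepts (Node b ts) = b"
primrec subtries :: "trie \<Rightarrow> trie list" where "subtries (Node b ts) = ts"

text \<open>Computes a Lehmer digit in unary, by dropping one child for each later smaller value;
  the head of the result is the child to enter.\<close>

primrec drop_smaller :: "nat \<Rightarrow> points \<Rightarrow> trie list \<Rightarrow> trie list" where
  "drop_smaller v [] ts = ts"
| "drop_smaller v (p # U) ts = (if snd p < v then (case ts of [] \<Rightarrow> [] | t # ts' \<Rightarrow> drop_smaller v U ts') else drop_smaller v U ts)"

primrec matches :: "points \<Rightarrow> trie \<Rightarrow> bool" where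
  "matches [] t \<longleftrightarrow> accepts t"
| "matches (p # T) t \<longleftrightarrow> (case drop_smaller (snd p) T (subtries t) of [] \<Rightarrow> False | t' # _ \<Rightarrow> matches T t')"

text \<open>\<open>X\<close> and \<open>Y\<close> stand for the position and the value of the
  candidate under test, in rectangles that have to be free of points of the occurrence.\<close>

datatype bound = K nat | X | Y
datatype rect = Rect bound bound bound bound

primrec bval :: "nat \<Rightarrow> nat \<Rightarrow> bound \<Rightarrow> nat" where
  "bval A B (K n) = n" | "bval A B X = A" | "bval A B Y = B"

primrec empty_rect :: "nat \<Rightarrow> nat \<Rightarrow> nat \<Rightarrow> nat \<Rightarrow> points \<Rightarrow> bool" where
  "empty_rect a b c d [] \<longleftrightarrow> True"
| "empty_rect a b c d (p # Q) \<longleftrightarrow>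
     \<not> (a < fst p \<and> fst p < b \<and> c < snd p \<and> snd p < d) \<and> empty_rect a b c d Q"

primrec clear :: "rect list \<Rightarrow> nat \<Rightarrow> nat \<Rightarrow> points \<Rightarrow> bool" where
  "clear [] A B Q \<longleftrightarrow> True"
| "clear (r # rs) A B Q \<longleftrightarrow> (case r of Rect a b c d \<Rightarrow>
     empty_rect (bval A B a) (bval A B b) (bval A B c) (bval A B d) Q) \<and> clear rs A B Q"

primrec gaps :: "nat \<Rightarrow> points \<Rightarrow> nat list" where
  "gaps k [] = [k]"
| "gaps k (_ # Q) = k # gaps (k + 6) Q"

primrec cands_elem :: "nat \<Rightarrow> nat \<Rightarrow> nat \<Rightarrow> nat \<Rightarrow> rect list \<Rightarrow> rect list \<Rightarrow> points \<Rightarrow> points \<Rightarrow> points" where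
  "cands_elem l h l' h' rs rs' Q [] = []"
| "cands_elem l h l' h' rs rs' Q (p # E) =
     (if l < fst p \<and> fst p < h \<and> l' < snd p \<and> snd p < h'
      then (if clear rs (fst p) (snd p) Q then (if clear rs' (fst p) (snd p) Q
         then p # cands_elem l h l' h' rs rs' Q E else cands_elem l h l' h' rs rs' Q E)
         else cands_elem l h l' h' rs rs' Q E)
      else cands_elem l h l' h' rs rs' Q E)"

primrec cands_val :: "nat \<Rightarrow> nat \<Rightarrow> rect list \<Rightarrow> points \<Rightarrow> nat \<Rightarrow> nat list \<Rightarrow> points \<Rightarrow> points" where
  "cands_val l h rs Q A [] C = C"
| "cands_val l h rs Q A (B # Bs) C = (if l < B \<and> B < h then (if clear rs A B Q
     then (A, B) # cands_val l h rs Q A Bs C else cands_val l h rs Q A Bs C) else cands_val l h rs Q A Bs C)"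

primrec cands_pos :: "nat \<Rightarrow> nat \<Rightarrow> nat \<Rightarrow> nat \<Rightarrow> rect list \<Rightarrow> rect list \<Rightarrow> points \<Rightarrow> nat list \<Rightarrow> nat list \<Rightarrow> points" where
  "cands_pos l h l' h' rs rs' Q Bs [] = []"
| "cands_pos l h l' h' rs rs' Q Bs (A # As) = (if l < A \<and> A < h then (if clear rs A 0 Q
      then cands_val l' h' rs' Q A Bs (cands_pos l h l' h' rs rs' Q Bs As)
      else cands_pos l h l' h' rs rs' Q Bs As) else cands_pos l h l' h' rs rs' Q Bs As)"

primrec app :: "points \<Rightarrow> points \<Rightarrow> points" where
  "app [] D = D" | "app (p # C) D = p # app C D"

text \<open>By injectivity a marked point is either a point of the occurrence or new in both
  coordinates. The rectangles \<open>rs\<close> used below never mention \<open>Y\<close> and are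
  tested before a value is chosen, with 0 in its place; \<open>rs'\<close> is tested with both
  coordinates.\<close>

definition cands :: "nat \<Rightarrow> nat \<Rightarrow> nat \<Rightarrow> nat \<Rightarrow> nat \<Rightarrow> nat \<Rightarrow> rect list \<Rightarrow> rect list \<Rightarrow> points \<Rightarrow> points" where
  "cands o1 o2 l h l' h' rs rs' Q =
     app (cands_elem l h l' h' rs rs' Q Q) (cands_pos l h l' h' rs rs' Q (gaps o2 Q) (gaps o1 Q))"

primrec incr_above :: "nat \<Rightarrow> nat \<Rightarrow> points \<Rightarrow> bool" where
  "incr_above A b [] \<longleftrightarrow> True"
| "incr_above A b (p # Q) \<longleftrightarrow> (if A < fst p then (if b < snd p then incr_above A (snd p) Q else False) else incr_above A b Q)"

primrec put :: "nat \<Rightarrow> nat \<Rightarrow> points \<Rightarrow> points" where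
  "put a b [] = [(a, b)]"
| "put a b (p # Q) = (if a < fst p then (a, b) # p # Q else if a = fst p then (a, b) # Q else p # put a b Q)"

primrec del :: "nat \<Rightarrow> points \<Rightarrow> points" where
  "del a [] = []"
| "del a (p # Q) = (if a = fst p then Q else p # del a Q)"

primrec mem_pos :: "nat \<Rightarrow> points \<Rightarrow> bool" where
  "mem_pos a [] \<longleftrightarrow> False"
| "mem_pos a (p # Q) \<longleftrightarrow> (if a = fst p then True else mem_pos a Q)"

primrec matches_any :: "points list \<Rightarrow> trie \<Rightarrow> bool" where
  "matches_any [] t \<longleftrightarrow> False"
| "matches_any (T # Ts) t \<longleftrightarrow> (if matches T t then True else matches_any Ts t)"

primrec search :: "points \<Rightarrow> points \<Rightarrow> trie \<Rightarrow> bool" where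
  "search [] P t \<longleftrightarrow> matches P t"
| "search (p # Q) P t \<longleftrightarrow> (if search Q (app P [p]) t then True else search Q P t)"

text \<open>\<open>Ts\<close> holds likely sublists, which are tried ahead of the search through all
  sublists of \<open>T\<close>.\<close>

definition found :: "points list \<Rightarrow> points \<Rightarrow> trie \<Rightarrow> bool" where
  "found Ts T t \<longleftrightarrow> matches_any Ts t \<or> search T [] t"

text \<open>Occurrences of 2143, by completing first 1, then 21, then 214.\<close>

definition low3 :: "nat \<Rightarrow> nat \<Rightarrow> points \<Rightarrow> bool" where
  "low3 v w Q \<longleftrightarrow> (\<exists>p\<in>set Q. v < snd p \<and> snd p < w)"

primrec low2 :: "nat \<Rightarrow> points \<Rightarrow> bool" where
  "low2 v [] \<longleftrightarrow> False"
| "low2 v (p # Q) \<longleftrightarrow> (if v < snd p \<and> low3 v (snd p) Q then True else low2 v Q)"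

primrec low1 :: "nat \<Rightarrow> points \<Rightarrow> bool" where
  "low1 v [] \<longleftrightarrow> False"
| "low1 v (p # Q) \<longleftrightarrow> (if snd p < v then low2 v Q else low1 v Q)"

primrec has2143 :: "points \<Rightarrow> bool" where
  "has2143 [] \<longleftrightarrow> False"
| "has2143 (p # Q) \<longleftrightarrow> (if low1 (snd p) Q then True else has2143 Q)"

definition found3 :: "nat \<Rightarrow> nat \<Rightarrow> nat \<Rightarrow> points \<Rightarrow> trie \<Rightarrow> bool" where
  "found3 ai ar as T t \<longleftrightarrow> found [del ai (del ar T), del ai (del as T), del ar (del as T)] T t"

text \<open>An occurrence that avoids the three marked positions persists unchanged, so only the
  others are examined. The values given are those of the permutation in which a pattern is to be
  found.\<close>

definition leaf3 :: "points \<Rightarrow> trie \<Rightarrow> nat \<Rightarrow> nat \<Rightarrow> nat \<Rightarrow> nat \<Rightarrow> nat \<Rightarrow> nat \<Rightarrow> bool" where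
  "leaf3 Q t ai bi ar br as bs \<longleftrightarrow> (mem_pos ai Q \<or> mem_pos ar Q \<or> mem_pos as Q \<longrightarrow>
     found3 ai ar as (put ai bi (put ar br (put as bs Q))) t)"

text \<open>Check A: one branch, from the parent to the child. The points at r, s and i are placed
  in this order; al, be and ga are the values of the parent at i, s and r, in increasing
  order.\<close>

definition stepA_i where
  "stepA_i Q t ar ga as be C \<longleftrightarrow> (\<forall>(ai, al)\<in>set C. leaf3 Q t ai be ar al as ga)"
definition stepA_s where
  "stepA_s Q t ar ga C \<longleftrightarrow> (\<forall>(as, be)\<in>set C. stepA_i Q t ar ga as be
     (cands 2 2 0 ar 0 be [Rect X (K ar) (K 0) (K be)] [Rect (K 0) (K ar) Y (K be)] Q))"
definition stepA_r where
  "stepA_r Q t C \<longleftrightarrow> (\<forall>(ar, ga)\<in>set C. incr_above ar 0 Q \<longrightarrow> stepA_s Q t ar ga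
     (cands 4 3 ar 100 0 ga [Rect (K ar) X (K ga) (K 100), Rect X (K 100) (K 0) (K ga)]
        [Rect (K ar) X Y (K 100)] Q))"
definition checkA where
  "checkA Q t \<longleftrightarrow> stepA_r Q t (cands 3 4 0 100 0 100 [] [] Q)"

text \<open>Check B: one branch, from the child back to the parent. The placed points carry the
  values of the child, al at r, be at i and ga at s.\<close>

definition stepB_i where
  "stepB_i Q t ar al as ga C \<longleftrightarrow> (\<forall>(ai, be)\<in>set C. leaf3 Q t ai al ar ga as be)"
definition stepB_s where
  "stepB_s Q t ar al C \<longleftrightarrow> (\<forall>(as, ga)\<in>set C. stepB_i Q t ar al as ga
     (cands 2 3 0 ar al ga []
        [Rect (K 0) (K ar) (K al) Y, Rect X (K ar) (K 0) Y, Rect (K ar) (K as) Y (K 100)] Q))"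
definition stepB_r where
  "stepB_r Q t C \<longleftrightarrow> (\<forall>(ar, al)\<in>set C. incr_above ar 0 Q \<longrightarrow> stepB_s Q t ar al
     (cands 4 4 ar 100 al 100 [] [Rect (K ar) X Y (K 100), Rect X (K 100) (K 0) Y] Q))"
definition checkB where
  "checkB Q t \<longleftrightarrow> stepB_r Q t (cands 3 2 0 100 0 100 [] [] Q)"

primrec del_rect :: "nat \<Rightarrow> nat \<Rightarrow> points \<Rightarrow> points" where
  "del_rect b d [] = []"
| "del_rect b d (p # Q) = (if fst p < b \<and> snd p < d then del_rect b d Q else p # del_rect b d Q)"

text \<open>Check C: two branches, from the parent to the pattern 2143 in one of the children. The
  branch at a1 is left of the one at a2 and has the larger value.\<close>

definition stepC_i2 where
  "stepC_i2 Q ar ga as be a1 b1 C \<longleftrightarrow> (\<forall>(a2, b2)\<in>set C.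
     has2143 (put a2 b2 (put a1 be (put ar b1 (put as ga Q)))) \<or>
     has2143 (put a1 b1 (put a2 be (put ar b2 (put as ga Q)))))"
definition stepC_i1 where
  "stepC_i1 Q ar ga as be C \<longleftrightarrow> (\<forall>(a1, b1)\<in>set C.
     has2143 (put a1 be (put ar b1 (put as ga Q))) \<or>
     stepC_i2 Q ar ga as be a1 b1
       (cands 3 2 a1 ar 0 b1 [Rect X (K ar) (K 0) (K be)] [Rect (K a1) (K ar) Y (K be)] Q))"
text \<open>As long as no branch is chosen, the child is unknown at r and at those points left of r
  with value below be where a branch may lie. These points are left out of the early test.\<close>

definition stepC_s where
  "stepC_s Q ar ga C \<longleftrightarrow> (\<forall>(as, be)\<in>set C.
     has2143 (del_rect ar be (del ar (put as ga Q))) \<or>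
     stepC_i1 Q ar ga as be (cands 2 3 0 ar 0 be [] [Rect (K 0) (K ar) Y (K be)] Q))"
definition stepC_r where
  "stepC_r Q C \<longleftrightarrow> (\<forall>(ar, ga)\<in>set C. incr_above ar 0 Q \<longrightarrow> stepC_s Q ar ga
     (cands 5 4 ar 100 0 ga [Rect (K ar) X (K ga) (K 100), Rect X (K 100) (K 0) (K ga)]
        [Rect (K ar) X Y (K 100)] Q))"
definition checkC where
  "checkC Q \<longleftrightarrow> stepC_r Q (cands 4 5 0 100 0 100 [] [] Q)"

definition found1 :: "points \<Rightarrow> trie \<Rightarrow> bool" where
  "found1 T t \<longleftrightarrow> found [T] T t"

definition leaf4 :: "points \<Rightarrow> trie \<Rightarrow> nat \<Rightarrow> nat \<Rightarrow> nat \<Rightarrow> nat \<Rightarrow> nat \<Rightarrow> nat \<Rightarrow> nat \<Rightarrow> nat \<Rightarrow> bool" where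
  "leaf4 Q t a1 b1 a2 b2 ar br as bs \<longleftrightarrow>
     found1 (put a1 b1 (put a2 b2 (put ar br (put as bs Q)))) t"

text \<open>Check D1: two branches, from 2143 in the child of the left branch back to the
  parent.\<close>

definition stepD1_i2 where
  "stepD1_i2 Q t ar al as ga a1 be C \<longleftrightarrow> (\<forall>(a2, al2)\<in>set C. leaf4 Q t a1 al a2 al2 ar ga as be)"
definition stepD1_i1 where
  "stepD1_i1 Q t ar al as ga C \<longleftrightarrow> (\<forall>(a1, be)\<in>set C. stepD1_i2 Q t ar al as ga a1 be
     (cands 3 2 a1 ar 0 al [Rect X (K ar) (K 0) (K be)] [Rect (K a1) (K ar) Y (K be)] Q))"
definition stepD1_s where
  "stepD1_s Q t ar al C \<longleftrightarrow> (\<forall>(as, ga)\<in>set C. stepD1_i1 Q t ar al as ga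
     (cands 2 4 0 ar al ga [] [Rect (K 0) (K ar) (K al) Y, Rect (K ar) (K as) Y (K 100)] Q))"
definition stepD1_r where
  "stepD1_r Q t C \<longleftrightarrow> (\<forall>(ar, al)\<in>set C. incr_above ar 0 Q \<longrightarrow> stepD1_s Q t ar al
     (cands 5 5 ar 100 al 100 [] [Rect (K ar) X Y (K 100), Rect X (K 100) (K 0) Y] Q))"
definition checkD1 where
  "checkD1 Q t \<longleftrightarrow> stepD1_r Q t (cands 4 3 0 100 0 100 [] [] Q)"

text \<open>Check D2: the counterpart of D1 for the child of the right branch.\<close>

definition stepD2_i1 where
  "stepD2_i1 Q t ar al2 as ga a2 be C \<longleftrightarrow> (\<forall>(a1, al1)\<in>set C. leaf4 Q t a1 al1 a2 al2 ar ga as be)"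
definition stepD2_i2 where
  "stepD2_i2 Q t ar al2 as ga C \<longleftrightarrow> (\<forall>(a2, be)\<in>set C. stepD2_i1 Q t ar al2 as ga a2 be
     (cands 2 3 0 a2 al2 be [Rect X (K ar) (K al2) (K be)] [Rect (K 0) (K ar) Y (K be)] Q))"
definition stepD2_s where
  "stepD2_s Q t ar al2 C \<longleftrightarrow> (\<forall>(as, ga)\<in>set C. stepD2_i2 Q t ar al2 as ga
     (cands 3 4 0 ar al2 ga [] [Rect X (K ar) (K 0) Y, Rect (K ar) (K as) Y (K 100)] Q))"
definition stepD2_r where
  "stepD2_r Q t C \<longleftrightarrow> (\<forall>(ar, al2)\<in>set C. incr_above ar 0 Q \<longrightarrow> stepD2_s Q t ar al2
     (cands 5 5 ar 100 al2 100 [] [Rect (K ar) X Y (K 100), Rect X (K 100) (K 0) Y] Q))"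
definition checkD2 where
  "checkD2 Q t \<longleftrightarrow> stepD2_r Q t (cands 4 2 0 100 0 100 [] [] Q)"

text \<open>Dispatch on evaluated Boolean arguments keeps the simplifier from traversing the branch
  that is not taken.\<close>

definition "emptyX \<beta> a b c d Q = (if \<beta> then False else empty_rect a b c d Q)"
definition "clearX \<beta> rs A B Q = (if \<beta> then clear rs A B Q else False)"
definition "dropX \<beta> v U ts = (if \<beta> then (case ts of [] \<Rightarrow> [] | t # ts' \<Rightarrow> drop_smaller v U ts') else drop_smaller v U ts)"
definition "consX \<beta> p C = (if \<beta> then p # C else C)"
definition "elemY \<beta> p l h l' h' rs rs' Q E = (if \<beta> then consX (clear rs' (fst p) (snd p) Q) p (cands_elem l h l' h' rs rs' Q E) else cands_elem l h l' h' rs rs' Q E)"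
definition "elemX \<beta> p l h l' h' rs rs' Q E = (if \<beta> then elemY (clear rs (fst p) (snd p) Q) p l h l' h' rs rs' Q E else cands_elem l h l' h' rs rs' Q E)"
definition "valX \<beta> l h rs Q A B Bs C = (if \<beta> then consX (clear rs A B Q) (A, B) (cands_val l h rs Q A Bs C) else cands_val l h rs Q A Bs C)"
definition "posY \<beta> l h l' h' rs rs' Q Bs A As = (if \<beta> then cands_val l' h' rs' Q A Bs (cands_pos l h l' h' rs rs' Q Bs As) else cands_pos l h l' h' rs rs' Q Bs As)"
definition "posX \<beta> l h l' h' rs rs' Q Bs A As = (if \<beta> then posY (clear rs A 0 Q) l h l' h' rs rs' Q Bs A As else cands_pos l h l' h' rs rs' Q Bs As)"
definition "incrY \<beta> A b Q = (if \<beta> then incr_above A b Q else False)"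
definition "incrX \<beta> A b v Q = (if \<beta> then incrY (b < v) A v Q else incr_above A b Q)"
definition "putY \<beta> a b p Q = (if \<beta> then (a, b) # Q else p # put a b Q)"
definition "putX \<beta> a b p Q = (if \<beta> then (a, b) # p # Q else putY (a = fst p) a b p Q)"
definition "delX \<beta> a p Q = (if \<beta> then Q else p # del a Q)"
definition "memX \<beta> a Q = (if \<beta> then True else mem_pos a Q)"
definition "anyX \<beta> Ts t = (if \<beta> then True else matches_any Ts t)"
definition "searchX \<beta> Q P t = (if \<beta> then True else search Q P t)"
definition "foundX \<beta> T t = (if \<beta> then True else search T [] t)"
definition "low3X \<beta> v w Q = (if \<beta> then True else low3 v w Q)"
definition "low2X \<beta> v Q = (if \<beta> then True else low2 v Q)"
definition "low1X \<beta> v Q = (if \<beta> then low2 v Q else low1 v Q)"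
definition "hasX \<beta> Q = (if \<beta> then True else has2143 Q)"
definition "drX \<beta> b d p Q = (if \<beta> then del_rect b d Q else p # del_rect b d Q)"
definition "leafX \<beta> Q t ai bi ar br as bs = (if \<beta> then found3 ai ar as (put ai bi (put ar br (put as bs Q))) t else True)"

definition "guardA \<beta> Q t ar ga = (\<beta> \<longrightarrow> stepA_s Q t ar ga
     (cands 4 3 ar 100 0 ga [Rect (K ar) X (K ga) (K 100), Rect X (K 100) (K 0) (K ga)]
        [Rect (K ar) X Y (K 100)] Q))"
definition "guardB \<beta> Q t ar al = (\<beta> \<longrightarrow> stepB_s Q t ar al
     (cands 4 4 ar 100 al 100 [] [Rect (K ar) X Y (K 100), Rect X (K 100) (K 0) Y] Q))"
definition "guardC \<beta> Q ar ga = (\<beta> \<longrightarrow> stepC_s Q ar ga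
     (cands 5 4 ar 100 0 ga [Rect (K ar) X (K ga) (K 100), Rect X (K 100) (K 0) (K ga)]
        [Rect (K ar) X Y (K 100)] Q))"
definition "guardD1 \<beta> Q t ar al = (\<beta> \<longrightarrow> stepD1_s Q t ar al
     (cands 5 5 ar 100 al 100 [] [Rect (K ar) X Y (K 100), Rect X (K 100) (K 0) Y] Q))"
definition "guardD2 \<beta> Q t ar al = (\<beta> \<longrightarrow> stepD2_s Q t ar al
     (cands 5 5 ar 100 al 100 [] [Rect (K ar) X Y (K 100), Rect X (K 100) (K 0) Y] Q))"
definition "elseC1 \<beta> Q ar ga as be = (\<beta> \<or> stepC_i1 Q ar ga as be (cands 2 3 0 ar 0 be [] [Rect (K 0) (K ar) Y (K be)] Q))"
definition "elseC2 \<beta> Q ar ga as be a1 b1 = (\<beta> \<or> stepC_i2 Q ar ga as be a1 b1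
       (cands 3 2 a1 ar 0 b1 [Rect X (K ar) (K 0) (K be)] [Rect (K a1) (K ar) Y (K be)] Q))"
definition "elseC3 \<beta> T = (\<beta> \<or> has2143 T)"

lemmas dispatch_defs =
  emptyX_def clearX_def dropX_def consX_def elemY_def elemX_def valX_def posY_def posX_def incrY_def incrX_def putY_def putX_def delX_def memX_def anyX_def searchX_def foundX_def low3X_def low2X_def low1X_def hasX_def drX_def leafX_def
  guardA_def guardB_def guardC_def guardD1_def guardD2_def elseC1_def elseC2_def elseC3_def

lemma dispatch:
  "emptyX True a b c d Q = False"
  "emptyX False a b c d Q = empty_rect a b c d Q"
  "clearX True rs A B Q = clear rs A B Q"
  "clearX False rs A B Q = False"
  "dropX True v U [] = []"
  "dropX True v U (t # ts) = drop_smaller v U ts"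
  "dropX False v U ts = drop_smaller v U ts"
  "consX True p C = p # C"
  "consX False p C = C"
  "elemY True (x, y) l h l' h' rs rs' Q E = consX (clear rs' (x) (y) Q) (x, y) (cands_elem l h l' h' rs rs' Q E)"
  "elemY False (x, y) l h l' h' rs rs' Q E = cands_elem l h l' h' rs rs' Q E"
  "elemX True (x, y) l h l' h' rs rs' Q E = elemY (clear rs (x) (y) Q) (x, y) l h l' h' rs rs' Q E"
  "elemX False (x, y) l h l' h' rs rs' Q E = cands_elem l h l' h' rs rs' Q E"
  "valX True l h rs Q A B Bs C = consX (clear rs A B Q) (A, B) (cands_val l h rs Q A Bs C)"
  "valX False l h rs Q A B Bs C = cands_val l h rs Q A Bs C"
  "posY True l h l' h' rs rs' Q Bs A As = cands_val l' h' rs' Q A Bs (cands_pos l h l' h' rs rs' Q Bs As)"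
  "posY False l h l' h' rs rs' Q Bs A As = cands_pos l h l' h' rs rs' Q Bs As"
  "posX True l h l' h' rs rs' Q Bs A As = posY (clear rs A 0 Q) l h l' h' rs rs' Q Bs A As"
  "posX False l h l' h' rs rs' Q Bs A As = cands_pos l h l' h' rs rs' Q Bs As"
  "incrY True A b Q = incr_above A b Q"
  "incrY False A b Q = False"
  "incrX True A b v Q = incrY (b < v) A v Q"
  "incrX False A b v Q = incr_above A b Q"
  "putY True a b p Q = (a, b) # Q"
  "putY False a b p Q = p # put a b Q"
  "putX True a b (x, y) Q = (a, b) # (x, y) # Q"
  "putX False a b (x, y) Q = putY (a = x) a b (x, y) Q"
  "delX True a p Q = Q"
  "delX False a p Q = p # del a Q"
  "memX True a Q = True"
  "memX False a Q = mem_pos a Q"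
  "anyX True Ts t = True"
  "anyX False Ts t = matches_any Ts t"
  "searchX True Q P t = True"
  "searchX False Q P t = search Q P t"
  "foundX True T t = True"
  "foundX False T t = search T [] t"
  "low3X True v w Q = True"
  "low3X False v w Q = low3 v w Q"
  "low2X True v Q = True"
  "low2X False v Q = low2 v Q"
  "low1X True v Q = low2 v Q"
  "low1X False v Q = low1 v Q"
  "hasX True Q = True"
  "hasX False Q = has2143 Q"
  "drX True b d p Q = del_rect b d Q"
  "drX False b d p Q = p # del_rect b d Q"
  "leafX True Q t ai bi ar br as bs = found3 ai ar as (put ai bi (put ar br (put as bs Q))) t"
  "leafX False Q t ai bi ar br as bs = True"
  "guardA True Q t ar ga = stepA_s Q t ar ga
     (cands 4 3 ar 100 0 ga [Rect (K ar) X (K ga) (K 100), Rect X (K 100) (K 0) (K ga)]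
        [Rect (K ar) X Y (K 100)] Q)"
  "guardA False Q t ar ga = True"
  "guardB True Q t ar al = stepB_s Q t ar al
     (cands 4 4 ar 100 al 100 [] [Rect (K ar) X Y (K 100), Rect X (K 100) (K 0) Y] Q)"
  "guardB False Q t ar al = True"
  "guardD1 True Q t ar al = stepD1_s Q t ar al
     (cands 5 5 ar 100 al 100 [] [Rect (K ar) X Y (K 100), Rect X (K 100) (K 0) Y] Q)"
  "guardD1 False Q t ar al = True"
  "guardD2 True Q t ar al = stepD2_s Q t ar al
     (cands 5 5 ar 100 al 100 [] [Rect (K ar) X Y (K 100), Rect X (K 100) (K 0) Y] Q)"
  "guardD2 False Q t ar al = True"
  "guardC True Q ar ga = stepC_s Q ar ga
     (cands 5 4 ar 100 0 ga [Rect (K ar) X (K ga) (K 100), Rect X (K 100) (K 0) (K ga)]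
        [Rect (K ar) X Y (K 100)] Q)"
  "guardC False Q ar ga = True"
  "elseC1 True Q ar ga as be = True"
  "elseC1 False Q ar ga as be = stepC_i1 Q ar ga as be (cands 2 3 0 ar 0 be [] [Rect (K 0) (K ar) Y (K be)] Q)"
  "elseC2 True Q ar ga as be a1 b1 = True"
  "elseC2 False Q ar ga as be a1 b1 = stepC_i2 Q ar ga as be a1 b1
       (cands 3 2 a1 ar 0 b1 [Rect X (K ar) (K 0) (K be)] [Rect (K a1) (K ar) Y (K be)] Q)"
  "elseC3 True T = True"
  "elseC3 False T = has2143 T"
  by (simp_all add: dispatch_defs)

definition "matches_sub T ts = (case ts of [] \<Rightarrow> False | t # _ \<Rightarrow> matches T t)"

text \<open>The rewriting system for the checks: points are taken apart as explicit pairs, and each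
  conditional is handed to a dispatch function whose first argument is evaluated to a truth
  value.\<close>

lemma eval_rules:
  "empty_rect a b c d [] = True"
  "empty_rect a b c d ((x, y) # Q) = emptyX (a < x \<and> x < b \<and> c < y \<and> y < d) a b c d Q"
  "clear [] A B Q = True"
  "clear (Rect ba bb bc bd # rs) A B Q = clearX (empty_rect (bval A B ba) (bval A B bb) (bval A B bc) (bval A B bd) Q) rs A B Q"
  "drop_smaller v [] ts = ts"
  "drop_smaller v ((x, y) # U) ts = dropX (y < v) v U ts"
  "matches [] t = accepts t"
  "matches ((x, y) # T) t = matches_sub T (drop_smaller y T (subtries t))"
  "matches_sub T [] = False"
  "matches_sub T (t # ts) = matches T t"
  "cands_elem l h l' h' rs rs' Q [] = []"
  "cands_elem l h l' h' rs rs' Q ((x, y) # E) = elemX (l < x \<and> x < h \<and> l' < y \<and> y < h') (x, y) l h l' h' rs rs' Q E"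
  "cands_val l h rs Q A [] C = C"
  "cands_val l h rs Q A (B # Bs) C = valX (l < B \<and> B < h) l h rs Q A B Bs C"
  "cands_pos l h l' h' rs rs' Q Bs [] = []"
  "cands_pos l h l' h' rs rs' Q Bs (A # As) = posX (l < A \<and> A < h) l h l' h' rs rs' Q Bs A As"
  "incr_above A b [] = True"
  "incr_above A b ((x, y) # Q) = incrX (A < x) A b y Q"
  "put a b [] = [(a, b)]"
  "put a b ((x, y) # Q) = putX (a < x) a b (x, y) Q"
  "del a [] = []"
  "del a ((x, y) # Q) = delX (a = x) a (x, y) Q"
  "mem_pos a [] = False"
  "mem_pos a ((x, y) # Q) = memX (a = x) a Q"
  "matches_any [] t = False"
  "matches_any (T # Ts) t = anyX (matches T t) Ts t"
  "found Ts T t = foundX (matches_any Ts t) T t"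
  "search [] P t = matches P t"
  "search ((x, y) # Q) P t = searchX (search Q (app P [(x, y)]) t) Q P t"
  "low3 v w [] = False"
  "low3 v w ((x, y) # Q) = low3X (v < y \<and> y < w) v w Q"
  "low2 v [] = False"
  "low2 v ((x, y) # Q) = low2X (v < y \<and> low3 v y Q) v Q"
  "low1 v [] = False"
  "low1 v ((x, y) # Q) = low1X (y < v) v Q"
  "has2143 [] = False"
  "has2143 ((x, y) # Q) = hasX (low1 y Q) Q"
  "del_rect b d [] = []"
  "del_rect b d ((x, y) # Q) = drX (x < b \<and> y < d) b d (x, y) Q"
  "leaf3 Q t ai bi ar br as bs = leafX (mem_pos ai Q \<or> mem_pos ar Q \<or> mem_pos as Q) Q t ai bi ar br as bs"
  "stepA_i Q t ar ga as be [] = True"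
  "stepA_i Q t ar ga as be ((ai, al) # C) = (leaf3 Q t ai be ar al as ga \<and> stepA_i Q t ar ga as be C)"
  "stepA_s Q t ar ga [] = True"
  "stepA_s Q t ar ga ((as, be) # C) = (stepA_i Q t ar ga as be
     (cands 2 2 0 ar 0 be [Rect X (K ar) (K 0) (K be)] [Rect (K 0) (K ar) Y (K be)] Q) \<and> stepA_s Q t ar ga C)"
  "stepA_r Q t [] = True"
  "stepA_r Q t ((ar, ga) # C) = (guardA (incr_above ar 0 Q) Q t ar ga \<and> stepA_r Q t C)"
  "stepB_i Q t ar al as ga [] = True"
  "stepB_i Q t ar al as ga ((ai, be) # C) = (leaf3 Q t ai al ar ga as be \<and> stepB_i Q t ar al as ga C)"
  "stepB_s Q t ar al [] = True"
  "stepB_s Q t ar al ((as, ga) # C) = (stepB_i Q t ar al as ga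
     (cands 2 3 0 ar al ga []
        [Rect (K 0) (K ar) (K al) Y, Rect X (K ar) (K 0) Y, Rect (K ar) (K as) Y (K 100)] Q) \<and> stepB_s Q t ar al C)"
  "stepB_r Q t [] = True"
  "stepB_r Q t ((ar, al) # C) = (guardB (incr_above ar 0 Q) Q t ar al \<and> stepB_r Q t C)"
  "stepC_r Q [] = True"
  "stepC_r Q ((ar, ga) # C) = (guardC (incr_above ar 0 Q) Q ar ga \<and> stepC_r Q C)"
  "stepC_s Q ar ga [] = True"
  "stepC_s Q ar ga ((as, be) # C) = (elseC1 (has2143 (del_rect ar be (del ar (put as ga Q)))) Q ar ga as be \<and> stepC_s Q ar ga C)"
  "stepC_i1 Q ar ga as be [] = True"
  "stepC_i1 Q ar ga as be ((a1, b1) # C) = (elseC2 (has2143 (put a1 be (put ar b1 (put as ga Q)))) Q ar ga as be a1 b1 \<and> stepC_i1 Q ar ga as be C)"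
  "stepC_i2 Q ar ga as be a1 b1 [] = True"
  "stepC_i2 Q ar ga as be a1 b1 ((a2, b2) # C) = (elseC3 (has2143 (put a2 b2 (put a1 be (put ar b1 (put as ga Q))))) (put a1 b1 (put a2 be (put ar b2 (put as ga Q)))) \<and> stepC_i2 Q ar ga as be a1 b1 C)"
  "stepD1_r Q t [] = True"
  "stepD1_r Q t ((ar, al) # C) = (guardD1 (incr_above ar 0 Q) Q t ar al \<and> stepD1_r Q t C)"
  "stepD2_r Q t [] = True"
  "stepD2_r Q t ((ar, al) # C) = (guardD2 (incr_above ar 0 Q) Q t ar al \<and> stepD2_r Q t C)"
  "stepD1_s Q t ar al [] = True"
  "stepD1_s Q t ar al ((as, ga) # C) = (stepD1_i1 Q t ar al as ga
     (cands 2 4 0 ar al ga [] [Rect (K 0) (K ar) (K al) Y, Rect (K ar) (K as) Y (K 100)] Q) \<and> stepD1_s Q t ar al C)"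
  "stepD1_i1 Q t ar al as ga [] = True"
  "stepD1_i1 Q t ar al as ga ((a1, be) # C) = (stepD1_i2 Q t ar al as ga a1 be
     (cands 3 2 a1 ar 0 al [Rect X (K ar) (K 0) (K be)] [Rect (K a1) (K ar) Y (K be)] Q) \<and> stepD1_i1 Q t ar al as ga C)"
  "stepD1_i2 Q t ar al as ga a1 be [] = True"
  "stepD1_i2 Q t ar al as ga a1 be ((a2, al2) # C) = (leaf4 Q t a1 al a2 al2 ar ga as be \<and> stepD1_i2 Q t ar al as ga a1 be C)"
  "stepD2_s Q t ar al2 [] = True"
  "stepD2_s Q t ar al2 ((as, ga) # C) = (stepD2_i2 Q t ar al2 as ga
     (cands 3 4 0 ar al2 ga [] [Rect X (K ar) (K 0) Y, Rect (K ar) (K as) Y (K 100)] Q) \<and> stepD2_s Q t ar al2 C)"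
  "stepD2_i2 Q t ar al2 as ga [] = True"
  "stepD2_i2 Q t ar al2 as ga ((a2, be) # C) = (stepD2_i1 Q t ar al2 as ga a2 be
     (cands 2 3 0 a2 al2 be [Rect X (K ar) (K al2) (K be)] [Rect (K 0) (K ar) Y (K be)] Q) \<and> stepD2_i2 Q t ar al2 as ga C)"
  "stepD2_i1 Q t ar al2 as ga a2 be [] = True"
  "stepD2_i1 Q t ar al2 as ga a2 be ((a1, al1) # C) = (leaf4 Q t a1 al1 a2 al2 ar ga as be \<and> stepD2_i1 Q t ar al2 as ga a2 be C)"
  apply (simp_all add: dispatch_defs matches_sub_def found_def low3_def leaf3_def
      stepA_i_def stepA_s_def stepA_r_def stepB_i_def stepB_s_def stepB_r_def stepC_i2_def stepC_i1_def stepC_s_def stepC_r_def stepD1_i2_def stepD1_i1_def stepD1_s_def stepD1_r_def stepD2_i1_def stepD2_i2_def stepD2_s_def stepD2_r_def)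
  apply blast+
  done

lemmas check_rules = eval_rules dispatch checkA_def checkB_def checkC_def checkD1_def checkD2_def
  cands_def app.simps gaps.simps bval.simps
  accepts.simps subtries.simps found3_def found1_def leaf4_def simp_thms rel_simps arith_simps

primrec points_of :: "nat \<Rightarrow> nat list \<Rightarrow> points" where
  "points_of k [] = []"
| "points_of k (v # vs) = (k, 6 * v) # points_of (k + 6) vs"

text \<open>Codes of the 35 patterns. Soundness rests on \<open>codes_trie35\<close>: every accepted
  code is the Lehmer code of a listed pattern.\<close>

definition trie35 :: trie where
  "trie35 = Node False [Node False [], Node False [Node False [Node False [], Node False [Node False [Node
    False [], Node False [Node True []]], Node False [], Node False [Node False [Node True []]]],
    Node False [Node False [Node False [], Node False [Node True []]], Node False [Node True []]]],
    Node False [Node False [Node False [], Node False [Node False [], Node False [Node True []]]]],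
    Node False [Node False [Node False [Node False [], Node False [Node True []]], Node False [],
    Node False [Node False [Node True []]]]], Node False [Node False [], Node False [], Node False
    [Node False [], Node False [], Node False [], Node False [Node False [Node False [], Node False
    [Node True []]], Node False [], Node False [Node False [Node False [], Node False [Node True
    []]]]]]], Node False [Node False [], Node False [], Node False [Node False [], Node False [],
    Node False [], Node False [], Node False [Node False [Node False [], Node False [Node False
    [Node True []]]], Node False [], Node False [], Node False [Node False [Node False [], Node
    False [Node True []]]]]], Node False [Node False [], Node False [], Node False [], Node False
    [], Node False [Node False [Node False [], Node False [Node False [Node True []]]], Node False
    [], Node False [], Node False [Node False [Node False [], Node False [Node True []]]]]]]], Node
    False [Node False [Node False [Node False [], Node False [], Node False [Node False [Node True
    []]]], Node False [Node False [Node False [], Node False [Node True []]]], Node False [Node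
    False [Node False [], Node False [Node True []]]]], Node False [Node False [Node False [], Node
    False [Node True []]]]], Node False [Node False [], Node False [Node False [], Node False [],
    Node False [], Node False [Node False [Node False [], Node False [Node True []]], Node False [],
    Node False [Node False [Node False [], Node False [Node True []]]]]]], Node False [Node False
    [Node False [], Node False [], Node False [], Node False [], Node False [Node False [], Node
    False [Node False [Node False [], Node False [Node True []]], Node False [], Node False [Node
    False [Node False [], Node False [Node True []]]]], Node False [], Node False [Node False [],
    Node False [Node False [Node False [], Node False [Node True []]]]]]], Node False [Node False
    [], Node False [], Node False [], Node False [], Node False [Node False [Node False [], Node
    False [Node False [Node True []]]], Node False [], Node False [], Node False [Node False [Node
    False [], Node False [Node True []]]]]], Node False [], Node False [Node False [], Node False
    [], Node False [], Node False [], Node False [Node False [], Node False [Node False [Node False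
    [], Node False [Node True []]], Node False [], Node False [Node False [Node False [], Node False
    [Node True []]]]], Node False [], Node False [Node False [], Node False [Node False [Node False
    [], Node False [Node True []]]]]]]], Node False [Node False [Node False [], Node False [], Node
    False [], Node False [], Node False [], Node False [Node False [], Node False [Node False [Node
    False [], Node False [Node False [Node True []]]], Node False [], Node False [], Node False
    [Node False [Node False [], Node False [Node True []]]]], Node False [], Node False [], Node
    False [Node False [], Node False [Node False [Node False [], Node False [Node True []]]]]]],
    Node False [], Node False [], Node False [Node False [], Node False [], Node False [], Node
    False [], Node False [], Node False [Node False [], Node False [Node False [Node False [], Node
    False [Node False [Node True []]]]], Node False [], Node False [], Node False [Node False [],
    Node False [Node False [Node False [], Node False [Node True []]]]]]], Node False [Node False
    [], Node False [], Node False [], Node False [], Node False [], Node False [Node False [], Node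
    False [Node False [Node False [], Node False [Node False [Node True []]]], Node False [], Node
    False [], Node False [Node False [Node False [], Node False [Node True []]]]], Node False [],
    Node False [], Node False [Node False [], Node False [Node False [Node False [], Node False
    [Node True []]]]]]]]]"

definition trie2143 :: trie where
  "trie2143 = Node False [Node False [], Node False [Node False [Node False [], Node False [Node True []]]]]"

text \<open>The tries remain folded constants inside the evaluated terms; their roots are opened
  only when a match begins.\<close>

lemma trie_rules:
  "accepts trie35 = False" "subtries trie35 = [Node False [], Node False [Node False [Node False [], Node False [Node False [Node False [],
    Node False [Node True []]], Node False [], Node False [Node False [Node True []]]], Node False
    [Node False [Node False [], Node False [Node True []]], Node False [Node True []]]], Node False
    [Node False [Node False [], Node False [Node False [], Node False [Node True []]]]], Node False
    [Node False [Node False [Node False [], Node False [Node True []]], Node False [], Node False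
    [Node False [Node True []]]]], Node False [Node False [], Node False [], Node False [Node False
    [], Node False [], Node False [], Node False [Node False [Node False [], Node False [Node True
    []]], Node False [], Node False [Node False [Node False [], Node False [Node True []]]]]]], Node
    False [Node False [], Node False [], Node False [Node False [], Node False [], Node False [],
    Node False [], Node False [Node False [Node False [], Node False [Node False [Node True []]]],
    Node False [], Node False [], Node False [Node False [Node False [], Node False [Node True
    []]]]]], Node False [Node False [], Node False [], Node False [], Node False [], Node False
    [Node False [Node False [], Node False [Node False [Node True []]]], Node False [], Node False
    [], Node False [Node False [Node False [], Node False [Node True []]]]]]]], Node False [Node
    False [Node False [Node False [], Node False [], Node False [Node False [Node True []]]], Node
    False [Node False [Node False [], Node False [Node True []]]], Node False [Node False [Node
    False [], Node False [Node True []]]]], Node False [Node False [Node False [], Node False [Node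
    True []]]]], Node False [Node False [], Node False [Node False [], Node False [], Node False [],
    Node False [Node False [Node False [], Node False [Node True []]], Node False [], Node False
    [Node False [Node False [], Node False [Node True []]]]]]], Node False [Node False [Node False
    [], Node False [], Node False [], Node False [], Node False [Node False [], Node False [Node
    False [Node False [], Node False [Node True []]], Node False [], Node False [Node False [Node
    False [], Node False [Node True []]]]], Node False [], Node False [Node False [], Node False
    [Node False [Node False [], Node False [Node True []]]]]]], Node False [Node False [], Node
    False [], Node False [], Node False [], Node False [Node False [Node False [], Node False [Node
    False [Node True []]]], Node False [], Node False [], Node False [Node False [Node False [],
    Node False [Node True []]]]]], Node False [], Node False [Node False [], Node False [], Node
    False [], Node False [], Node False [Node False [], Node False [Node False [Node False [], Node
    False [Node True []]], Node False [], Node False [Node False [Node False [], Node False [Node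
    True []]]]], Node False [], Node False [Node False [], Node False [Node False [Node False [],
    Node False [Node True []]]]]]]], Node False [Node False [Node False [], Node False [], Node
    False [], Node False [], Node False [], Node False [Node False [], Node False [Node False [Node
    False [], Node False [Node False [Node True []]]], Node False [], Node False [], Node False
    [Node False [Node False [], Node False [Node True []]]]], Node False [], Node False [], Node
    False [Node False [], Node False [Node False [Node False [], Node False [Node True []]]]]]],
    Node False [], Node False [], Node False [Node False [], Node False [], Node False [], Node
    False [], Node False [], Node False [Node False [], Node False [Node False [Node False [], Node
    False [Node False [Node True []]]]], Node False [], Node False [], Node False [Node False [],
    Node False [Node False [Node False [], Node False [Node True []]]]]]], Node False [Node False
    [], Node False [], Node False [], Node False [], Node False [], Node False [Node False [], Node
    False [Node False [Node False [], Node False [Node False [Node True []]]], Node False [], Node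
    False [], Node False [Node False [Node False [], Node False [Node True []]]]], Node False [],
    Node False [], Node False [Node False [], Node False [Node False [Node False [], Node False
    [Node True []]]]]]]]]"
  "accepts trie2143 = False" "subtries trie2143 = [Node False [], Node False [Node False [Node False [], Node False [Node True []]]]]"
  by (simp_all add: trie35_def trie2143_def)

lemmas pattern_rules = check_rules trie_rules points_of.simps two_vexillary_patterns_def list.pred_inject mult_1_right

section \<open>The finite case analysis, carried out by rewriting\<close>

lemma checkA_35: "list_all (\<lambda>p. checkA (points_of 6 p) trie35) two_vexillary_patterns"
  by (simp only: pattern_rules)

lemma checkB_35: "list_all (\<lambda>p. checkB (points_of 6 p) trie35) two_vexillary_patterns"
  by (simp only: pattern_rules)

lemma checkC_35: "list_all (\<lambda>p. checkC (points_of 6 p)) two_vexillary_patterns"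
  by (simp only: pattern_rules)

lemma checkA_2143: "checkA (points_of 6 [2, 1, 4, 3]) trie2143"
  by (simp only: pattern_rules)

lemma checkB_2143: "checkB (points_of 6 [2, 1, 4, 3]) trie2143"
  by (simp only: pattern_rules)

lemma checkD1_2143: "checkD1 (points_of 6 [2, 1, 4, 3]) trie35"
  by (simp only: pattern_rules)

lemma checkD2_2143: "checkD2 (points_of 6 [2, 1, 4, 3]) trie35"
  by (simp only: pattern_rules)

section \<open>From successful checks to occurrences of patterns\<close>

section \<open>Soundness of the checks\<close>

text \<open>Containment without \<open>fl\<close>, and with position 0 allowed, so that statements
  about shifted positions need no side condition. \<open>contains_pattern_iff_occurs\<close> makes
  the connection.\<close>

definition occurs :: "(nat \<Rightarrow> nat) \<Rightarrow> nat list \<Rightarrow> bool" where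
  "occurs y p \<longleftrightarrow> (\<exists>qs. length qs = length p \<and> sorted_wrt (<) qs \<and>
     (\<forall>i<length p. \<forall>j<length p. y (qs ! i) < y (qs ! j) \<longleftrightarrow> p ! i < p ! j))"

primrec lehmer :: "nat list \<Rightarrow> nat list" where
  "lehmer [] = []"
| "lehmer (x # xs) = length (filter (\<lambda>z. z < x) xs) # lehmer xs"

primrec code_in :: "nat list \<Rightarrow> trie \<Rightarrow> bool" where
  "code_in [] t \<longleftrightarrow> accepts t"
| "code_in (k # c) t \<longleftrightarrow> k < length (subtries t) \<and> code_in c (subtries t ! k)"

lemma drop_smaller_eq: "drop_smaller v T ts = drop (length (filter (\<lambda>z. z < v) (map snd T))) ts"
  by (induction T arbitrary: ts) (auto split: list.split)

lemma matches_iff_code_in: "matches T t \<longleftrightarrow> code_in (lehmer (map snd T)) t"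
proof (induction T arbitrary: t)
  case (Cons p T)
  define k where "k = length (filter ((\<lambda>z. z < snd p) \<circ> snd) T)"
  show ?case
  proof (cases "k < length (subtries t)")
    case True
    then have "drop k (subtries t) = subtries t ! k # drop (Suc k) (subtries t)"
      by (rule Cons_nth_drop_Suc[symmetric])
    then show ?thesis using True Cons.IH by (simp add: drop_smaller_eq filter_map k_def[symmetric])
  next
    case False
    then show ?thesis by (simp add: drop_smaller_eq filter_map k_def[symmetric])
  qed
qed simp

primrec number :: "nat \<Rightarrow> nat list list list \<Rightarrow> nat list list" where
  "number k [] = []"
| "number k (L # Ls) = map ((#) k) L @ number (Suc k) Ls"

primrec codes :: "trie \<Rightarrow> nat list list" where
  "codes (Node b ts) = (if b then [[]] else []) @ number 0 (map codes ts)"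

lemma number_mem: "j < length Ls \<Longrightarrow> c \<in> set (Ls ! j) \<Longrightarrow> (k + j) # c \<in> set (number k Ls)"
proof (induction Ls arbitrary: k j)
  case (Cons L Ls)
  show ?case
  proof (cases j)
    case (Suc i)
    then show ?thesis using Cons.IH[of i "Suc k"] Cons.prems by auto
  qed (use Cons.prems in auto)
qed simp

lemma code_in_codes: "code_in c t \<Longrightarrow> c \<in> set (codes t)"
proof (induction c arbitrary: t)
  case Nil
  then show ?case by (cases t) simp
next
  case (Cons k c)
  then show ?case
    using number_mem[of k "map codes (subtries t)" c 0] by (cases t) auto
qed

lemma codes_trie35: "set (codes trie35) \<subseteq> lehmer ` set two_vexillary_patterns"
proof -
  have "list_all (\<lambda>c. c \<in> set (map lehmer two_vexillary_patterns)) (codes trie35)"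
    by (simp add: trie35_def two_vexillary_patterns_def)
  then show ?thesis by (auto simp: list_all_iff)
qed

lemma codes_trie2143: "set (codes trie2143) \<subseteq> lehmer ` {[2, 1, 4, 3]}"
  by (simp add: trie2143_def)

text \<open>The entries below the first one form a lower set of the tail. By induction the tails are
  ordered alike, so the two lower sets are nested; the first digit gives them equal size, hence they
  coincide.\<close>

lemma lehmer_order_iso:
  assumes "lehmer xs = lehmer ys" "distinct xs" "distinct ys"
  shows "length xs = length ys \<and> (\<forall>i<length xs. \<forall>j<length xs. xs ! i < xs ! j \<longleftrightarrow> ys ! i < ys ! j)"
  using assms
proof (induction xs arbitrary: ys)
  case Nil
  then show ?case by (cases ys) auto
next
  case (Cons x xs ys0)
  then obtain y ys where ys0: "ys0 = y # ys" by (cases ys0) auto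
  have l: "lehmer xs = lehmer ys" "distinct xs" "distinct ys" "x \<notin> set xs" "y \<notin> set ys"
    "length (filter (\<lambda>z. z < x) xs) = length (filter (\<lambda>z. z < y) ys)"
    using Cons.prems by (simp_all add: ys0)
  have IH: "length xs = length ys" "\<And>i j. i < length xs \<Longrightarrow> j < length xs \<Longrightarrow> xs ! i < xs ! j \<longleftrightarrow> ys ! i < ys ! j"
    using Cons.IH[OF l(1-3)] by auto
  let ?A = "{i. i < length xs \<and> xs ! i < x}" and ?B = "{i. i < length xs \<and> ys ! i < y}"
  have card: "card ?A = card ?B"
    using l(6) IH(1) by (simp add: length_filter_conv_card)
  have "?A = ?B"
  proof (rule ccontr)
    assume "?A \<noteq> ?B"
    then consider i where "i \<in> ?A" "i \<notin> ?B" | i where "i \<in> ?B" "i \<notin> ?A" by blast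
    then show False
    proof cases
      case 1
      then have "?B \<subset> ?A" using IH(2) by (auto dest: order.strict_trans) (meson linorder_not_le order.strict_trans order.strict_trans1)+
      then have "card ?B < card ?A" by (intro psubset_card_mono) auto
      then show False using card by simp
    next
      case 2
      then have "?A \<subset> ?B" using IH(2) by (auto dest: order.strict_trans) (meson linorder_not_le order.strict_trans order.strict_trans1)+
      then have "card ?A < card ?B" by (intro psubset_card_mono) auto
      then show False using card by simp
    qed
  qed
  then have lt: "xs ! i < x \<longleftrightarrow> ys ! i < y" if "i < length xs" for i using that by auto
  have gt: "x < xs ! i \<longleftrightarrow> y < ys ! i" if "i < length xs" for i
  proof -
    have "xs ! i \<noteq> x" "ys ! i \<noteq> y"
      using that l(4,5) IH(1) nth_mem[of i xs] nth_mem[of i ys] by auto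
    then show ?thesis using lt[OF that] by presburger
  qed
  show ?case
    using lt gt IH by (auto simp: ys0 nth_Cons split: nat.splits)
qed

lemma lehmer_cong:
  assumes "\<And>x z. x \<in> set xs \<Longrightarrow> z \<in> set xs \<Longrightarrow> f x < f z \<longleftrightarrow> g x < g z"
  shows "lehmer (map f xs) = lehmer (map g xs)"
  using assms
proof (induction xs)
  case (Cons x xs)
  have "filter (\<lambda>z. f z < f x) xs = filter (\<lambda>z. g z < g x) xs"
    using Cons.prems by (intro filter_cong) auto
  then show ?case using Cons by (simp add: filter_map comp_def)
qed simp

lemma code_in_occurs:
  assumes "code_in (lehmer (map y xs)) t" "sorted_wrt (<) xs" "inj y"
    and "set (codes t) \<subseteq> lehmer ` A" "\<And>p. p \<in> A \<Longrightarrow> distinct p"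
  shows "\<exists>p\<in>A. occurs y p"
proof -
  obtain p where p: "p \<in> A" "lehmer (map y xs) = lehmer p"
    using code_in_codes[OF assms(1)] assms(4) by auto
  have "distinct (map y xs)"
    using assms(2,3) strict_sorted_iff[of xs] by (simp add: distinct_map inj_on_def inj_def)
  then have "length xs = length p \<and> (\<forall>i<length xs. \<forall>j<length xs. y (xs ! i) < y (xs ! j) \<longleftrightarrow> p ! i < p ! j)"
    using lehmer_order_iso[OF p(2) _ assms(5)[OF p(1)]] by simp
  then show ?thesis
    using p(1) assms(2) unfolding occurs_def by metis
qed

lemma occurs_2143I:
  assumes "a < b" "b < c" "c < d" "y b < y a" "y a < y d" "y d < y c"
  shows "occurs y [2, 1, 4, 3]"
  unfolding occurs_def
  by (rule exI[of _ "[a, b, c, d]"]) (use assms in \<open>auto simp: less_Suc_eq numeral_eq_Suc\<close>)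

abbreviation sorted_pos :: "points \<Rightarrow> bool" where
  "sorted_pos \<equiv> sorted_wrt (\<lambda>p q. fst p < fst q)"

lemma put_props:
  assumes "sorted_pos Q"
  shows "sorted_pos (put a b Q) \<and> set (put a b Q) = insert (a, b) {p \<in> set Q. fst p \<noteq> a}"
  using assms by (induction Q) auto

lemma del_props:
  assumes "sorted_pos Q"
  shows "sorted_pos (del a Q) \<and> set (del a Q) = {p \<in> set Q. fst p \<noteq> a}"
  using assms by (induction Q) auto

lemma del_rect_props:
  assumes "sorted_pos Q"
  shows "sorted_pos (del_rect b d Q) \<and> set (del_rect b d Q) = {p \<in> set Q. \<not> (fst p < b \<and> snd p < d)}"
  using assms by (induction Q) auto

lemma app_append: "app C D = C @ D"
  by (induction C) auto

lemma search_sound: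
  assumes "search Q P t" "sorted_pos Q"
  shows "\<exists>S. sorted_pos S \<and> set S \<subseteq> set Q \<and> matches (P @ S) t"
  using assms
proof (induction Q arbitrary: P)
  case Nil
  then show ?case by (intro exI[of _ "[]"]) simp
next
  case (Cons p Q)
  show ?case
  proof (cases "search Q (app P [p]) t")
    case True
    then obtain S where "sorted_pos S" "set S \<subseteq> set Q" "matches (P @ p # S) t"
      using Cons.IH[OF True] Cons.prems(2) by (auto simp: app_append)
    then show ?thesis using Cons.prems(2) by (intro exI[of _ "p # S"]) auto
  next
    case False
    then have "search Q P t" using Cons.prems(1) by simp
    then show ?thesis using Cons.IH[of P] Cons.prems(2) by auto
  qed
qed

lemma matches_any_iff: "matches_any Ts t \<longleftrightarrow> (\<exists>T\<in>set Ts. matches T t)"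
  by (induction Ts) auto

lemma found_sound:
  assumes "found Ts T t" "sorted_pos T" "\<And>S. S \<in> set Ts \<Longrightarrow> sorted_pos S \<and> set S \<subseteq> set T"
  shows "\<exists>S. sorted_pos S \<and> set S \<subseteq> set T \<and> matches S t"
proof (cases "search T [] t")
  case True
  then show ?thesis using search_sound[OF True assms(2)] by simp
next
  case False
  then have "matches_any Ts t" using assms(1) by (simp add: found_def)
  then obtain S where "S \<in> set Ts" "matches S t" unfolding matches_any_iff by blast
  then show ?thesis using assms(3)[of S] by blast
qed

lemma found3_sound:
  assumes "found3 a b c T t" "sorted_pos T"
  shows "\<exists>S. sorted_pos S \<and> set S \<subseteq> set T \<and> matches S t"
proof (rule found_sound[OF assms(1)[unfolded found3_def] assms(2)])
  have "sorted_pos (del x (del y T)) \<and> set (del x (del y T)) \<subseteq> set T" for x y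
    using del_props[OF assms(2), of y] del_props[of "del y T" x] by auto
  then show "sorted_pos S \<and> set S \<subseteq> set T"
    if "S \<in> set [del a (del b T), del a (del c T), del b (del c T)]" for S
    using that by auto
qed

lemma found1_sound:
  assumes "found1 T t" "sorted_pos T"
  shows "\<exists>S. sorted_pos S \<and> set S \<subseteq> set T \<and> matches S t"
  by (rule found_sound[OF assms(1)[unfolded found1_def] assms(2)]) (use assms(2) in auto)

lemma low2_sound:
  assumes "low2 v Q" "sorted_pos Q"
  shows "\<exists>p\<in>set Q. \<exists>q\<in>set Q. fst p < fst q \<and> v < snd q \<and> snd q < snd p"
  using assms by (induction Q) (auto simp: low3_def split: if_splits)

lemma low1_sound:
  assumes "low1 v Q" "sorted_pos Q"
  shows "\<exists>o'\<in>set Q. \<exists>p\<in>set Q. \<exists>q\<in>set Q. fst o' < fst p \<and> fst p < fst q \<and> snd o' < v \<and> v < snd q \<and> snd q < snd p"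
  using assms
proof (induction Q)
  case (Cons p Q)
  show ?case
  proof (cases "snd p < v")
    case True
    then obtain q q' where "q \<in> set Q" "q' \<in> set Q" "fst q < fst q'" "v < snd q'" "snd q' < snd q"
      using low2_sound[of v Q] Cons.prems by auto
    then show ?thesis
      using True Cons.prems(2) by - (rule bexI[of _ p], rule bexI[of _ q], rule bexI[of _ q'], auto)
  next
    case False
    then show ?thesis using Cons by (simp, blast)
  qed
qed simp

lemma has2143_sound:
  assumes "has2143 Q" "sorted_pos Q"
  shows "\<exists>a\<in>set Q. \<exists>b\<in>set Q. \<exists>c\<in>set Q. \<exists>d\<in>set Q. fst a < fst b \<and> fst b < fst c \<and> fst c < fst d
    \<and> snd b < snd a \<and> snd a < snd d \<and> snd d < snd c"
  using assms
proof (induction Q)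
  case (Cons p Q)
  show ?case
  proof (cases "low1 (snd p) Q")
    case True
    then obtain a b c where abc: "a \<in> set Q" "b \<in> set Q" "c \<in> set Q" "fst a < fst b" "fst b < fst c"
      "snd a < snd p" "snd p < snd c" "snd c < snd b"
      using low1_sound[of "snd p" Q] Cons.prems by auto
    have "fst p < fst a" using Cons.prems(2) abc(1) by simp
    then have "fst p < fst a \<and> fst a < fst b \<and> fst b < fst c \<and> snd a < snd p \<and> snd p < snd c \<and> snd c < snd b"
      using abc by blast
    moreover have "p \<in> set (p # Q)" "a \<in> set (p # Q)" "b \<in> set (p # Q)" "c \<in> set (p # Q)" using abc by simp_all
    ultimately show ?thesis by blast
  next
    case False
    then have "has2143 Q" "sorted_pos Q" using Cons.prems by simp_all
    from Cons.IH[OF this] show ?thesis by (meson list.set_intros(2))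
  qed
qed simp

lemma empty_rect_iff:
  "empty_rect a b c d Q \<longleftrightarrow> (\<forall>p\<in>set Q. \<not> (a < fst p \<and> fst p < b \<and> c < snd p \<and> snd p < d))"
  by (induction Q) auto

lemma mem_pos_iff: "mem_pos a Q \<longleftrightarrow> a \<in> fst ` set Q"
  by (induction Q) auto

lemma set_gaps: "set (gaps k Q) = (\<lambda>g. k + 6 * g) ` {..length Q}"
proof (induction Q arbitrary: k)
  case (Cons p Q)
  have "{..length (p # Q)} = insert 0 (Suc ` {..length Q})"
    by (simp add: atMost_Suc_eq_insert_0)
  then show ?case using Cons[of "k + 6"] by (simp add: image_image add.assoc)
qed simp

lemma mem_cands:
  assumes "l < A" "A < h" "l' < B" "B < h'" "clear rs A B Q" "clear rs A 0 Q" "clear rs' A B Q"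
    and "(A, B) \<in> set Q \<or> A \<in> set (gaps a Q) \<and> B \<in> set (gaps b Q)"
  shows "(A, B) \<in> set (cands a b l h l' h' rs rs' Q)"
proof -
  have 1: "(A, B) \<in> set E \<Longrightarrow> (A, B) \<in> set (cands_elem l h l' h' rs rs' Q E)" for E
    using assms(1-7) by (induction E) auto
  have 2: "B \<in> set Bs \<or> (A, B) \<in> set C \<Longrightarrow> (A, B) \<in> set (cands_val l' h' rs' Q A Bs C)" for Bs C
    using assms(3,4,7) by (induction Bs) auto
  have 3: "set C \<subseteq> set (cands_val l' h' rs' Q A' Bs C)" for Bs C A'
    by (induction Bs) auto
  have 4: "A \<in> set As \<Longrightarrow> B \<in> set Bs \<Longrightarrow> (A, B) \<in> set (cands_pos l h l' h' rs rs' Q Bs As)" for As Bs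
    using assms(1,2,6) 2 3 by (induction As) (auto, blast+)
  show ?thesis
    using assms(8) 1 4 by (auto simp: cands_def app_append)
qed

lemma incr_above_intro:
  assumes "sorted_pos Q" "\<forall>p\<in>set Q. A < fst p \<longrightarrow> b < snd p"
    and "\<forall>p\<in>set Q. \<forall>q\<in>set Q. A < fst p \<and> fst p < fst q \<longrightarrow> snd p < snd q"
  shows "incr_above A b Q"
  using assms by (induction Q arbitrary: b) auto

text \<open>Elements of \<open>A\<close> lie on the multiples of 6; any other point lies in the gap
  after its predecessors in \<open>A\<close>, at offset \<open>f z\<close>.\<close>

definition crd :: "nat set \<Rightarrow> (nat \<Rightarrow> nat) \<Rightarrow> nat \<Rightarrow> nat" where
  "crd A f z = 6 * card {a \<in> A. a \<le> z} + (if z \<in> A then 0 else f z)"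

lemma crd_mono:
  assumes "finite A" "\<And>z. z \<in> M \<Longrightarrow> 0 < f z \<and> f z < 6" "\<And>z z'. z \<in> M \<Longrightarrow> z' \<in> M \<Longrightarrow> z < z' \<Longrightarrow> f z < f z'"
    and "z \<in> A \<union> M" "z' \<in> A \<union> M" "z < z'"
  shows "crd A f z < crd A f z'"
proof -
  let ?L = "\<lambda>z. {a \<in> A. a \<le> z}"
  have sub: "?L z \<subseteq> ?L z'" using assms(6) by auto
  then have le: "card (?L z) \<le> card (?L z')" using assms(1) by (intro card_mono) auto
  show ?thesis
  proof (cases "card (?L z) = card (?L z')")
    case True
    then have "?L z = ?L z'" using sub assms(1) by (intro card_subset_eq) auto
    have "z' \<notin> A"
    proof
      assume "z' \<in> A"
      then have "z' \<in> ?L z" using \<open>?L z = ?L z'\<close> by simp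
      then show False using assms(6) by simp
    qed
    then show ?thesis using True assms(2-6) by (auto simp: crd_def)
  next
    case False
    have "(if z \<in> A then 0 else f z) < 6" using assms(2,4) by auto
    then show ?thesis using False le unfolding crd_def by linarith
  qed
qed

lemma length_points_of [simp]: "length (points_of k p) = length p"
  by (induction p arbitrary: k) auto

lemma nth_points_of: "i < length p \<Longrightarrow> points_of k p ! i = (k + 6 * i, 6 * p ! i)"
  by (induction p arbitrary: k i) (auto simp: nth_Cons split: nat.splits)

lemma one_line_distinct: "p \<in> one_line (length p) \<Longrightarrow> distinct p"
  by (auto simp: one_line_def intro: card_distinct)

lemma one_line_rank:
  assumes "p \<in> one_line (length p)" "i < length p"
  shows "card {j. j < length p \<and> p ! j \<le> p ! i} = p ! i"
proof -
  have d: "distinct p" by (rule one_line_distinct[OF assms(1)])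
  have s: "set p = {1..length p}" using assms(1) by (simp add: one_line_def)
  have "(!) p ` {j. j < length p \<and> p ! j \<le> p ! i} = {v \<in> set p. v \<le> p ! i}"
    by (auto simp: in_set_conv_nth)
  also have "\<dots> = {1..p ! i}"
    using assms(2) nth_mem[of i p] unfolding s by auto
  finally have "card ((!) p ` {j. j < length p \<and> p ! j \<le> p ! i}) = p ! i" by simp
  moreover have "inj_on ((!) p) {j. j < length p \<and> p ! j \<le> p ! i}"
    by (rule inj_on_nth[OF d]) auto
  ultimately show ?thesis by (simp add: card_image)
qed

text \<open>An occurrence of \<open>p\<close> in \<open>src\<close> together with finitely many marked points, in the coordinates
  used by the checks.\<close>

locale config =
  fixes src :: "nat \<Rightarrow> nat" and qs p :: "nat list" and M :: "nat set" and po vo :: "nat \<Rightarrow> nat"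
  assumes inj_src: "inj src"
    and p: "p \<in> one_line (length p)" "length p \<le> 8"
    and qs: "length qs = length p" "sorted_wrt (<) qs"
      "\<And>i j. i < length p \<Longrightarrow> j < length p \<Longrightarrow> src (qs ! i) < src (qs ! j) \<longleftrightarrow> p ! i < p ! j"
    and po: "\<And>x. x \<in> M \<Longrightarrow> 0 < po x \<and> po x < 6" "\<And>x x'. x \<in> M \<Longrightarrow> x' \<in> M \<Longrightarrow> x < x' \<Longrightarrow> po x < po x'"
    and vo: "\<And>x. x \<in> M \<Longrightarrow> 0 < vo (src x) \<and> vo (src x) < 6"
      "\<And>x x'. x \<in> M \<Longrightarrow> x' \<in> M \<Longrightarrow> src x < src x' \<Longrightarrow> vo (src x) < vo (src x')"
begin

definition "pc = crd (set qs) po"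
definition "vc = crd (src ` set qs) vo"
definition "pts = set qs \<union> M"
definition "Q = points_of 6 p"

lemma pts_intros: "x \<in> set qs \<Longrightarrow> x \<in> pts" "x \<in> M \<Longrightarrow> x \<in> pts"
  by (auto simp: pts_def)

lemma pc_less: "x \<in> pts \<Longrightarrow> x' \<in> pts \<Longrightarrow> pc x < pc x' \<longleftrightarrow> x < x'"
  using crd_mono[of "set qs" M po x x'] crd_mono[of "set qs" M po x' x] po
  by (cases x x' rule: linorder_cases) (auto simp: pc_def pts_def)

lemma pc_eq: "x \<in> pts \<Longrightarrow> x' \<in> pts \<Longrightarrow> pc x = pc x' \<longleftrightarrow> x = x'"
  using pc_less[of x x'] pc_less[of x' x] by (metis nat_neq_iff)

lemma vc_less: 
  assumes "x \<in> pts" "x' \<in> pts" 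
  shows "vc (src x) < vc (src x') \<longleftrightarrow> src x < src x'"
proof -
  have mono: "vc (src x) < vc (src x')" if "x \<in> pts" "x' \<in> pts" "src x < src x'" for x x'
    unfolding vc_def
    by (rule crd_mono[where M="src ` M"]) (use vo that in \<open>auto simp: pts_def\<close>)
  show ?thesis
    using mono[of x x'] mono[of x' x] assms by (cases "src x" "src x'" rule: linorder_cases) auto
qed

text \<open>The coordinates of the occurrence are those of the bare pattern: the rank of a position
  is its index plus one, and the rank of a value is the entry of the one-line notation
  (\<open>one_line_rank\<close>).\<close>

lemma Q_eq: "Q = map (\<lambda>q. (pc q, vc (src q))) qs"
proof (rule nth_equalityI)
  fix i assume "i < length Q"
  then have i: "i < length p" by (simp add: Q_def)
  have dqs: "distinct qs" using qs(2) strict_sorted_iff by blast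
  have "{a \<in> set qs. a \<le> qs ! i} = (!) qs ` {..i}"
  proof -
    have "qs ! j \<le> qs ! i \<longleftrightarrow> j \<le> i" if "j < length qs" for j
      using qs(1,2) i that by (metis linorder_not_le nat_less_le sorted_wrt_iff_nth_less)
    then show ?thesis
      using i qs(1) by (auto simp: image_iff Bex_def) (metis atMost_iff in_set_conv_nth)
  qed
  then have "pc (qs ! i) = 6 + 6 * i"
    using i qs(1) card_image[OF inj_on_nth[OF dqs, of "{..i}"]] by (simp add: pc_def crd_def)
  moreover have "vc (src (qs ! i)) = 6 * p ! i"
  proof -
    have "src (qs ! j) \<le> src (qs ! i) \<longleftrightarrow> p ! j \<le> p ! i" if "j < length p" for j
      using qs(3)[OF i that] by (simp add: linorder_not_less[symmetric])
    moreover have "set qs = (!) qs ` {..<length p}"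
      using qs(1) by (auto simp: in_set_conv_nth image_iff)
    ultimately have "{v \<in> src ` set qs. v \<le> src (qs ! i)} = (\<lambda>j. src (qs ! j)) ` {j. j < length p \<and> p ! j \<le> p ! i}"
      by auto
    moreover have "inj_on (\<lambda>j. src (qs ! j)) {j. j < length p \<and> p ! j \<le> p ! i}"
      using dqs qs(1) by (auto simp: inj_on_def inj_eq[OF inj_src] nth_eq_iff_index_eq)
    ultimately have "card {v \<in> src ` set qs. v \<le> src (qs ! i)} = p ! i"
      by (simp add: card_image one_line_rank[OF p(1) i])
    then show ?thesis using i qs(1) by (simp add: vc_def crd_def)
  qed
  ultimately show "Q ! i = map (\<lambda>q. (pc q, vc (src q))) qs ! i"
    using i qs(1) by (simp add: Q_def nth_points_of)
qed (simp add: Q_def qs(1))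

lemma sorted_Q: "sorted_pos Q"
  unfolding Q_eq sorted_wrt_map
  by (rule sorted_wrt_mono_rel[OF _ qs(2)]) (simp add: pc_less pts_intros)

lemma empty_rect_Q: "empty_rect a b c d Q \<longleftrightarrow>
    (\<forall>q\<in>set qs. \<not> (a < pc q \<and> pc q < b \<and> c < vc (src q) \<and> vc (src q) < d))"
  by (auto simp: empty_rect_iff Q_eq)

lemma bounds:
  assumes "x \<in> pts"
  shows "0 < pc x" "pc x < 100" "0 < vc (src x)" "vc (src x) < 100"
proof -
  have c: "card {a \<in> A. a \<le> z} \<le> 8" if "finite A" "card A \<le> 8" for A :: "nat set" and z
    using card_mono[of A "{a \<in> A. a \<le> z}"] that by auto
  have A: "card (set qs) \<le> 8" "card (src ` set qs) \<le> 8"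
    using card_length[of qs] card_image_le[of "set qs" src] qs(1) p(2) by auto
  have e: "0 < card {a \<in> A. a \<le> z}" if "finite A" "z \<in> A" for A :: "nat set" and z
    using that by (auto simp: card_gt_0_iff)
  have "pc x \<le> 6 * 8 + 6" "vc (src x) \<le> 6 * 8 + 6"
    using assms po(1) vo(1) c[OF _ A(1), of x] c[OF _ A(2), of "src x"]
    by (fastforce simp: pc_def vc_def crd_def pts_def)+
  then show "pc x < 100" "vc (src x) < 100" by auto
  show "0 < pc x"
    using assms po(1)[of x] e[of "set qs" x] by (cases "x \<in> set qs") (auto simp: pc_def crd_def pts_def)
  show "0 < vc (src x)"
    using assms vo(1)[of x] e[of "src ` set qs" "src x"]
    by (cases "src x \<in> src ` set qs") (auto simp: vc_def crd_def pts_def)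
qed

lemma cands_mem:
  assumes "x \<in> M" "po x = a" "vo (src x) = b" "l < pc x" "pc x < h" "l' < vc (src x)" "vc (src x) < h'"
    and "clear rs (pc x) (vc (src x)) Q" "clear rs (pc x) 0 Q" "clear rs' (pc x) (vc (src x)) Q"
  shows "(pc x, vc (src x)) \<in> set (cands a b l h l' h' rs rs' Q)"
proof (rule mem_cands[OF assms(4-10)])
  show "(pc x, vc (src x)) \<in> set Q \<or> pc x \<in> set (gaps a Q) \<and> vc (src x) \<in> set (gaps b Q)"
  proof (cases "x \<in> set qs")
    case True
    then show ?thesis by (simp add: Q_eq)
  next
    case False
    then have "src x \<notin> src ` set qs" using inj_src by (auto dest: injD)
    moreover have "card {q \<in> A. q \<le> z} \<le> length Q" if "finite A" "card A \<le> length qs" for A :: "nat set" and z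
      using card_mono[of A "{a \<in> A. a \<le> z}"] that qs(1) by (auto simp: Q_def)
    ultimately show ?thesis
      using False assms(2,3) card_length[of qs] card_image_le[of "set qs" src]
      by (auto simp: set_gaps pc_def vc_def crd_def intro!: image_eqI)
  qed
qed

text \<open>\<open>T\<close> consists of points of the graph of \<open>tgt\<close>, in the
  coordinates of \<open>src\<close>. \<open>N\<close> collects the marked positions that have been
  overwritten; occurrence points there no longer appear with their old values.\<close>

definition shown :: "(nat \<Rightarrow> nat) \<Rightarrow> nat set \<Rightarrow> points \<Rightarrow> bool" where
  "shown tgt N T \<longleftrightarrow> sorted_pos T \<and> N \<subseteq> M \<and>
     set T \<subseteq> (\<lambda>q. (pc q, vc (src q))) ` (set qs - N) \<union> (\<lambda>x. (pc x, vc (tgt x))) ` N"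

lemma shown_Q: "shown tgt {} Q"
  using sorted_Q unfolding shown_def by (simp add: Q_eq)

lemma shown_put:
  assumes "shown tgt N T" "x \<in> M" "b = vc (tgt x)"
  shows "shown tgt (insert x N) (put (pc x) b T)"
proof -
  have T: "sorted_pos T" "N \<subseteq> M"
    "set T \<subseteq> (\<lambda>q. (pc q, vc (src q))) ` (set qs - N) \<union> (\<lambda>x. (pc x, vc (tgt x))) ` N"
    using assms(1) by (auto simp: shown_def)
  have "s \<in> (\<lambda>q. (pc q, vc (src q))) ` (set qs - insert x N) \<union> (\<lambda>x. (pc x, vc (tgt x))) ` insert x N"
    if s: "s \<in> set T" "fst s \<noteq> pc x" for s
  proof -
    consider q where "q \<in> set qs - N" "s = (pc q, vc (src q))" | z where "z \<in> N" "s = (pc z, vc (tgt z))"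
      using T(3) s(1) by blast
    then show ?thesis
    proof cases
      case 1
      then have "q \<in> set qs - insert x N" using s(2) by auto
      then show ?thesis using 1(2) by blast
    qed blast
  qed
  then show ?thesis
    using put_props[OF T(1), of "pc x" b] T(2) assms(2,3) unfolding shown_def by auto
qed

lemma shown_pull:
  assumes "shown tgt N T" "\<And>q. q \<in> set qs - N \<Longrightarrow> tgt q = src q" "sorted_pos S" "set S \<subseteq> set T"
  shows "\<exists>xs. sorted_wrt (<) xs \<and> set xs \<subseteq> pts \<and> S = map (\<lambda>x. (pc x, vc (tgt x))) xs"
proof -
  have "\<forall>s\<in>set S. \<exists>x. s = (pc x, vc (tgt x)) \<and> x \<in> pts"
  proof
    fix s assume "s \<in> set S"
    then have "s \<in> (\<lambda>q. (pc q, vc (src q))) ` (set qs - N) \<union> (\<lambda>x. (pc x, vc (tgt x))) ` N" and "N \<subseteq> M"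
      using assms(1,4) unfolding shown_def by blast+
    then show "\<exists>x. s = (pc x, vc (tgt x)) \<and> x \<in> pts"
      using assms(2) by (auto simp: pts_def)
  qed
  then obtain f where f: "\<forall>s\<in>set S. s = (pc (f s), vc (tgt (f s))) \<and> f s \<in> pts" by metis
  have S: "S = map (\<lambda>x. (pc x, vc (tgt x))) (map f S)"
    using f by (auto simp: map_idI[symmetric] intro!: map_idI[symmetric])
  have "sorted_wrt (\<lambda>x x'. pc x < pc x') (map f S)"
    using assms(3) by (subst (asm) S) (simp add: sorted_wrt_map)
  then have "sorted_wrt (<) (map f S)"
    by (rule sorted_wrt_mono_rel[rotated]) (use f in \<open>auto simp: pc_less\<close>)
  then show ?thesis using S f by (intro exI[of _ "map f S"]) auto
qed

text \<open>On the points considered, \<open>tgt\<close> takes values of \<open>src\<close> only, so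
  \<open>vc\<close> compares them faithfully and the Lehmer code of the matched list is that of
  \<open>tgt\<close>.\<close>

lemma matches_pull:
  assumes "shown tgt N T" "\<And>q. q \<in> set qs - N \<Longrightarrow> tgt q = src q" "tgt ` pts \<subseteq> src ` pts"
    and "\<exists>S. sorted_pos S \<and> set S \<subseteq> set T \<and> matches S t"
  shows "\<exists>xs. sorted_wrt (<) xs \<and> code_in (lehmer (map tgt xs)) t"
proof -
  obtain S where S: "sorted_pos S" "set S \<subseteq> set T" "matches S t" using assms(4) by blast
  obtain xs where xs: "sorted_wrt (<) xs" "set xs \<subseteq> pts" "S = map (\<lambda>x. (pc x, vc (tgt x))) xs"
    using shown_pull[OF assms(1,2) S(1,2)] by blast
  have less: "vc (tgt x) < vc (tgt z) \<longleftrightarrow> tgt x < tgt z" if "x \<in> pts" "z \<in> pts" for x z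
  proof -
    have "tgt x \<in> src ` pts" "tgt z \<in> src ` pts"
      using that by (auto intro: subsetD[OF assms(3)])
    then show ?thesis by (auto simp: vc_less)
  qed
  have "lehmer (map snd S) = lehmer (map (\<lambda>x. vc (tgt x)) xs)"
    by (simp add: xs(3) comp_def)
  also have "\<dots> = lehmer (map tgt xs)"
  proof (rule lehmer_cong)
    fix x z assume "x \<in> set xs" "z \<in> set xs"
    then show "vc (tgt x) < vc (tgt z) \<longleftrightarrow> tgt x < tgt z"
      using xs(2) by (intro less) auto
  qed
  finally have "code_in (lehmer (map tgt xs)) t"
    using S(3) by (simp add: matches_iff_code_in)
  then show ?thesis using xs(1) by blast
qed

lemma has2143_pull:
  assumes "has2143 T" "shown tgt N T'" "\<And>q. q \<in> set qs - N \<Longrightarrow> tgt q = src q" "tgt ` pts \<subseteq> src ` pts"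
    and "sorted_pos T" "set T \<subseteq> set T'"
  shows "occurs tgt [2, 1, 4, 3]"
proof -
  obtain a b c d where abcd: "a \<in> set T" "b \<in> set T" "c \<in> set T" "d \<in> set T" "fst a < fst b" "fst b < fst c" "fst c < fst d"
    "snd b < snd a" "snd a < snd d" "snd d < snd c"
    using has2143_sound[OF assms(1,5)] by blast
  have "\<exists>x\<in>pts. \<exists>z\<in>pts. s = (pc x, vc (src z)) \<and> tgt x = src z" if "s \<in> set T" for s
  proof -
    have "s \<in> (\<lambda>q. (pc q, vc (src q))) ` (set qs - N) \<union> (\<lambda>x. (pc x, vc (tgt x))) ` N" and "N \<subseteq> M"
      using assms(2,6) that unfolding shown_def by blast+
    then consider q where "q \<in> set qs - N" "s = (pc q, vc (src q))"
      | z where "z \<in> N" "s = (pc z, vc (tgt z))" "z \<in> M" by blast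
    then have "\<exists>x\<in>pts. s = (pc x, vc (tgt x))"
      by cases (auto simp: pts_def intro!: bexI assms(3)[symmetric] arg_cong[where f=vc])
    then obtain x where x: "s = (pc x, vc (tgt x))" "x \<in> pts" by blast
    then have "tgt x \<in> src ` pts" by (auto intro: subsetD[OF assms(4)])
    then obtain z where "z \<in> pts" "tgt x = src z" by blast
    then show ?thesis using x by (intro bexI[of _ x] bexI[of _ z]) auto
  qed
  then obtain X Z where XZ: "\<And>s. s \<in> set T \<Longrightarrow>
      X s \<in> pts \<and> Z s \<in> pts \<and> s = (pc (X s), vc (src (Z s))) \<and> tgt (X s) = src (Z s)"
    by metis
  have less: "X s < X s' \<longleftrightarrow> fst s < fst s'" "tgt (X s) < tgt (X s') \<longleftrightarrow> snd s < snd s'"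
    if "s \<in> set T" "s' \<in> set T" for s s'
    using XZ[OF that(1)] XZ[OF that(2)] by (metis fst_conv pc_less, metis snd_conv vc_less)
  show ?thesis
    by (rule occurs_2143I[of "X a" "X b" "X c" "X d"]) (use abcd less in simp_all)
qed

lemma incr_Q:
  assumes "r \<in> M" "\<And>k l. r < k \<Longrightarrow> k < l \<Longrightarrow> src k < src l"
  shows "incr_above (pc r) 0 Q"
proof (rule incr_above_intro[OF sorted_Q])
  show "\<forall>p\<in>set Q. pc r < fst p \<longrightarrow> 0 < snd p"
    by (auto simp: Q_eq bounds pts_intros)
  show "\<forall>p\<in>set Q. \<forall>q\<in>set Q. pc r < fst p \<and> fst p < fst q \<longrightarrow> snd p < snd q"
    using assms by (auto simp: Q_eq pc_less vc_less pts_intros)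
qed

lemma mem_pos_Q: "x \<in> M \<Longrightarrow> mem_pos (pc x) Q \<longleftrightarrow> x \<in> set qs"
  by (auto simp: mem_pos_iff Q_eq image_image pc_eq pts_intros intro!: image_eqI)

lemmas guard_simps = empty_rect_Q pc_less vc_less pc_eq pts_intros

end

text \<open>The exchange of the three marked points is a cycle between the parent and its only child.\<close>

definition cycle3 :: "(nat \<Rightarrow> nat) \<Rightarrow> nat \<Rightarrow> nat \<Rightarrow> nat \<Rightarrow> nat \<Rightarrow> nat" where
  "cycle3 y i r s = y(i := y s, r := y i, s := y r)"

text \<open>The actual points at r, s and i are among the enumerated candidates. The rectangles say
  that \<open>src\<close> increases after \<open>r\<close>, that \<open>s\<close> is the last later
  position with a value below \<open>src r\<close>, and that \<open>i\<close> dominates all points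
  left of \<open>r\<close> with value below \<open>src s\<close>.\<close>

lemma checkA_sound:
  assumes "config src qs p {i, r, s} po vo" "checkA (points_of 6 p) t"
    and "po i = 2" "po r = 3" "po s = 4" "vo (src i) = 2" "vo (src s) = 3" "vo (src r) = 4"
    and "i < r" "r < s" "src i < src s" "src s < src r"
    and "\<And>k l. r < k \<Longrightarrow> k < l \<Longrightarrow> src k < src l"
    and "\<And>k. r < k \<Longrightarrow> src k < src r \<Longrightarrow> k \<le> s"
    and "\<And>k. k < r \<Longrightarrow> src k < src s \<Longrightarrow> k \<le> i \<and> src k \<le> src i"
    and "{i, r, s} \<inter> set qs \<noteq> {}"
  shows "\<exists>xs. sorted_wrt (<) xs \<and> code_in (lehmer (map (cycle3 src i r s) xs)) t"
proof -
  interpret config src qs p "{i, r, s}" po vo by (rule assms(1))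
  note b = bounds[of i] bounds[of r] bounds[of s]
  have K: "i \<in> pts" "r \<in> pts" "s \<in> pts" by (auto simp: pts_def)
  have f1: "src q < src s" if "r < q" "q < s" for q using assms(13) that by blast
  have f2: "src r < src q" if "s < q" for q
    using assms(14)[of q] assms(10) that inj_eq[OF inj_src, of q r]
    by (metis linorder_not_less nat_neq_iff order.strict_trans)
  have f3: "q \<le> i" and f4: "src q \<le> src i" if "q < r" "src q < src s" for q
    using assms(15)[OF that] by auto
  have 1: "(pc r, vc (src r)) \<in> set (cands 3 4 0 100 0 100 [] [] Q)"
    by (rule cands_mem) (use b K assms(3-8) in auto)
  have 2: "(pc s, vc (src s)) \<in> set (cands 4 3 (pc r) 100 0 (vc (src r))
      [Rect (bound.K (pc r)) X (bound.K (vc (src r))) (bound.K 100), Rect X (bound.K 100) (bound.K 0) (bound.K (vc (src r)))]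
      [Rect (bound.K (pc r)) X Y (bound.K 100)] Q)"
    by (rule cands_mem) (use b K assms(3-12) in \<open>auto simp: guard_simps dest: f1 f2\<close>)
  have 3: "(pc i, vc (src i)) \<in> set (cands 2 2 0 (pc r) 0 (vc (src s))
      [Rect X (bound.K (pc r)) (bound.K 0) (bound.K (vc (src s)))]
      [Rect (bound.K 0) (bound.K (pc r)) Y (bound.K (vc (src s)))] Q)"
    by (rule cands_mem) (use b K assms(3-12) in \<open>auto simp: guard_simps dest: f3 f4\<close>)
  have inc: "incr_above (pc r) 0 Q" by (rule incr_Q) (use assms(13) in auto)
  have "leaf3 Q t (pc i) (vc (src s)) (pc r) (vc (src i)) (pc s) (vc (src r))"
    using assms(2) 1 2 3 inc unfolding checkA_def stepA_r_def stepA_s_def stepA_i_def Q_def by blast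
  then have f: "found3 (pc i) (pc r) (pc s)
      (put (pc i) (vc (src s)) (put (pc r) (vc (src i)) (put (pc s) (vc (src r)) Q))) t"
    using assms(16) by (auto simp: leaf3_def mem_pos_Q)
  let ?tgt = "cycle3 src i r s"
  have sh: "shown ?tgt {i, r, s} (put (pc i) (vc (src s)) (put (pc r) (vc (src i)) (put (pc s) (vc (src r)) Q)))"
    by (intro shown_put shown_Q) (use assms(9,10) in \<open>auto simp: cycle3_def\<close>)
  show ?thesis
  proof (rule matches_pull[OF sh _ _ found3_sound[OF f]])
    show "?tgt ` pts \<subseteq> src ` pts" using K by (auto simp: cycle3_def)
  qed (use sh in \<open>auto simp: cycle3_def shown_def\<close>)
qed

text \<open>Here \<open>src\<close> is the child and the inverse cycle leads to the parent. The
  rectangles express the same conditions on the parent, read in the child.\<close>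

lemma checkB_sound:
  assumes "config src qs p {i, r, s} po vo" "checkB (points_of 6 p) t"
    and "po i = 2" "po r = 3" "po s = 4" "vo (src r) = 2" "vo (src i) = 3" "vo (src s) = 4"
    and "i < r" "r < s" "src r < src i" "src i < src s"
    and "\<And>k l. r < k \<Longrightarrow> k < l \<Longrightarrow> src k < src l"
    and "\<And>k. r < k \<Longrightarrow> k < s \<Longrightarrow> src k < src i"
    and "\<And>k. k < r \<Longrightarrow> src k < src i \<Longrightarrow> k \<le> i \<and> src k \<le> src r"
    and "{i, r, s} \<inter> set qs \<noteq> {}"
  shows "\<exists>xs. sorted_wrt (<) xs \<and> code_in (lehmer (map (src(i := src r, r := src s, s := src i)) xs)) t"
proof -
  interpret config src qs p "{i, r, s}" po vo by (rule assms(1))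
  note b = bounds[of i] bounds[of r] bounds[of s]
  have K: "i \<in> pts" "r \<in> pts" "s \<in> pts" by (auto simp: pts_def)
  have f1: "src q < src s" if "r < q" "q < s" for q using assms(13) that by blast
  have f2: "src s < src q" if "s < q" for q using assms(10,13) that by blast
  have f3: "q \<le> i" and f4: "src q \<le> src r" if "q < r" "src q < src i" for q
    using assms(15)[OF that] by auto
  have f5: "src q < src i" if "r < q" "q < s" for q using assms(14) that by blast
  have 1: "(pc r, vc (src r)) \<in> set (cands 3 2 0 100 0 100 [] [] Q)"
    by (rule cands_mem) (use b K assms(3-8) in auto)
  have 2: "(pc s, vc (src s)) \<in> set (cands 4 4 (pc r) 100 (vc (src r)) 100 []
      [Rect (bound.K (pc r)) X Y (bound.K 100), Rect X (bound.K 100) (bound.K 0) Y] Q)"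
    by (rule cands_mem) (use b K assms(3-12) in \<open>auto simp: guard_simps dest: f1 f2\<close>)
  have 3: "(pc i, vc (src i)) \<in> set (cands 2 3 0 (pc r) (vc (src r)) (vc (src s)) []
      [Rect (bound.K 0) (bound.K (pc r)) (bound.K (vc (src r))) Y, Rect X (bound.K (pc r)) (bound.K 0) Y,
       Rect (bound.K (pc r)) (bound.K (pc s)) Y (bound.K 100)] Q)"
    by (rule cands_mem) (use b K assms(3-12) in \<open>auto simp: guard_simps dest: f3 f4 f5\<close>)
  have inc: "incr_above (pc r) 0 Q" by (rule incr_Q) (use assms(13) in auto)
  have "leaf3 Q t (pc i) (vc (src r)) (pc r) (vc (src s)) (pc s) (vc (src i))"
    using assms(2) 1 2 3 inc unfolding checkB_def stepB_r_def stepB_s_def stepB_i_def Q_def by blast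
  then have f: "found3 (pc i) (pc r) (pc s)
      (put (pc i) (vc (src r)) (put (pc r) (vc (src s)) (put (pc s) (vc (src i)) Q))) t"
    using assms(16) by (auto simp: leaf3_def mem_pos_Q)
  let ?tgt = "src(i := src r, r := src s, s := src i)"
  have sh: "shown ?tgt {i, r, s} (put (pc i) (vc (src r)) (put (pc r) (vc (src s)) (put (pc s) (vc (src i)) Q)))"
    by (intro shown_put shown_Q) (use assms(9,10) in auto)
  show ?thesis
  proof (rule matches_pull[OF sh _ _ found3_sound[OF f]])
    show "?tgt ` pts \<subseteq> src ` pts" using K by auto
  qed (use sh in \<open>auto simp: shown_def\<close>)
qed

lemma checkC_sound:
  assumes "config src qs p {i, i', r, s} po vo" "checkC (points_of 6 p)"
    and "po i = 2" "po i' = 3" "po r = 4" "po s = 5"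
    and "vo (src i') = 2" "vo (src i) = 3" "vo (src s) = 4" "vo (src r) = 5"
    and "i < i'" "i' < r" "r < s" "src i' < src i" "src i < src s" "src s < src r"
    and "\<And>k l. r < k \<Longrightarrow> k < l \<Longrightarrow> src k < src l"
    and "\<And>k. r < k \<Longrightarrow> src k < src r \<Longrightarrow> k \<le> s"
    and "\<And>k. k < r \<Longrightarrow> src k < src s \<Longrightarrow> k \<le> i \<and> src k \<le> src i \<or> k \<le> i' \<and> src k \<le> src i'"
  shows "occurs (cycle3 src i r s) [2, 1, 4, 3] \<or> occurs (cycle3 src i' r s) [2, 1, 4, 3]"
proof -
  interpret config src qs p "{i, i', r, s}" po vo by (rule assms(1))
  note b = bounds[of i] bounds[of i'] bounds[of r] bounds[of s]
  have K: "i \<in> pts" "i' \<in> pts" "r \<in> pts" "s \<in> pts" by (auto simp: pts_def)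
  have f1: "src q < src s" if "r < q" "q < s" for q using assms(17) that by blast
  have f2: "src r < src q" if "s < q" for q
    using assms(18)[of q] assms(13) that inj_eq[OF inj_src, of q r]
    by (metis linorder_not_less nat_neq_iff order.strict_trans)
  have f3: "q \<le> i'" and f4: "src q \<le> src i" if "q < r" "src q < src s" for q
    using assms(19)[OF that] assms(11,14) by auto
  have f5: "src q \<le> src i'" if "q < r" "src q < src s" "i < q" for q
    using assms(19)[OF that(1,2)] that(3) by auto
  have 1: "(pc r, vc (src r)) \<in> set (cands 4 5 0 100 0 100 [] [] Q)"
    by (rule cands_mem) (use b K assms(3-10) in auto)
  have 2: "(pc s, vc (src s)) \<in> set (cands 5 4 (pc r) 100 0 (vc (src r))
      [Rect (bound.K (pc r)) X (bound.K (vc (src r))) (bound.K 100), Rect X (bound.K 100) (bound.K 0) (bound.K (vc (src r)))]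
      [Rect (bound.K (pc r)) X Y (bound.K 100)] Q)"
    by (rule cands_mem) (use b K assms(3-16) in \<open>auto simp: guard_simps dest: f1 f2\<close>)
  have 3: "(pc i, vc (src i)) \<in> set (cands 2 3 0 (pc r) 0 (vc (src s)) []
      [Rect (bound.K 0) (bound.K (pc r)) Y (bound.K (vc (src s)))] Q)"
    by (rule cands_mem) (use b K assms(3-16) in \<open>auto simp: guard_simps dest: f4\<close>)
  have 4: "(pc i', vc (src i')) \<in> set (cands 3 2 (pc i) (pc r) 0 (vc (src i))
      [Rect X (bound.K (pc r)) (bound.K 0) (bound.K (vc (src s)))]
      [Rect (bound.K (pc i)) (bound.K (pc r)) Y (bound.K (vc (src s)))] Q)"
    by (rule cands_mem) (use b K assms(3-16) in \<open>auto simp: guard_simps dest: f3 f5\<close>)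
  have inc: "incr_above (pc r) 0 Q" by (rule incr_Q) (use assms(17) in auto)
  let ?tgt = "cycle3 src i r s" and ?tgt' = "cycle3 src i' r s"
  let ?T0 = "put (pc s) (vc (src r)) Q"
  let ?T1 = "put (pc i) (vc (src s)) (put (pc r) (vc (src i)) ?T0)"
  let ?T2 = "put (pc i') (vc (src i')) ?T1"
  let ?T3 = "put (pc i) (vc (src i)) (put (pc i') (vc (src s)) (put (pc r) (vc (src i')) ?T0))"
  have "has2143 (del_rect (pc r) (vc (src s)) (del (pc r) ?T0)) \<or> has2143 ?T1 \<or> has2143 ?T2 \<or> has2143 ?T3"
    using assms(2) 1 2 3 4 inc
    unfolding checkC_def stepC_r_def stepC_s_def stepC_i1_def stepC_i2_def Q_def by blast
  moreover have sh0: "shown ?tgt {s} ?T0"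
    by (intro shown_put shown_Q) (use assms(11-13) in \<open>auto simp: cycle3_def\<close>)
  have sh1: "shown ?tgt {i, r, s} ?T1"
    by (intro shown_put shown_Q) (use assms(11-13) in \<open>auto simp: cycle3_def\<close>)
  have sh2: "shown ?tgt {i', i, r, s} ?T2"
    by (intro shown_put shown_Q) (use assms(11-13) in \<open>auto simp: cycle3_def\<close>)
  have sh3: "shown ?tgt' {i, i', r, s} ?T3"
    by (intro shown_put shown_Q) (use assms(11-13) in \<open>auto simp: cycle3_def\<close>)
  have im: "?tgt ` pts \<subseteq> src ` pts" "?tgt' ` pts \<subseteq> src ` pts"
    using K by (auto simp: cycle3_def)
  moreover have "occurs ?tgt [2, 1, 4, 3]" if "has2143 (del_rect (pc r) (vc (src s)) (del (pc r) ?T0))"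
  proof (rule has2143_pull[OF that sh1 _ im(1)])
    have so: "sorted_pos ?T0" using sh0 by (simp add: shown_def)
    note d = del_props[OF so, of "pc r"]
    show "sorted_pos (del_rect (pc r) (vc (src s)) (del (pc r) ?T0))"
      using del_rect_props d by blast
    have so1: "sorted_pos (put (pc r) (vc (src i)) ?T0)" using put_props[OF so] by blast
    show "set (del_rect (pc r) (vc (src s)) (del (pc r) ?T0)) \<subseteq> set ?T1"
    proof
      fix u assume u: "u \<in> set (del_rect (pc r) (vc (src s)) (del (pc r) ?T0))"
      then have u': "u \<in> set ?T0" "fst u \<noteq> pc r" "\<not> (fst u < pc r \<and> snd u < vc (src s))"
        using del_rect_props[of "del (pc r) ?T0" "pc r" "vc (src s)"] d by auto
      \<comment> \<open>A point at \<open>i\<close> would still carry its old value and would lie in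
        the rectangle that was removed.\<close>
      have "fst u \<noteq> pc i"
      proof
        assume "fst u = pc i"
        moreover have "u \<in> (\<lambda>q. (pc q, vc (src q))) ` (set qs - {s}) \<union> (\<lambda>x. (pc x, vc (?tgt x))) ` {s}"
          using sh0 u'(1) unfolding shown_def by blast
        ultimately have "u = (pc i, vc (src i))"
          using K assms(11-13) by (auto simp: pc_eq pts_intros)
        then show False using u'(3) K assms(11-16) by (auto simp: pc_less vc_less)
      qed
      then show "u \<in> set ?T1"
        using u'(1,2) put_props[OF so] put_props[OF so1] by auto
    qed
  qed (auto simp: cycle3_def)
  moreover have "occurs ?tgt [2, 1, 4, 3]" if "has2143 ?T1"
    by (rule has2143_pull[OF that sh1 _ im(1)]) (use sh1 in \<open>auto simp: cycle3_def shown_def\<close>)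
  moreover have "occurs ?tgt [2, 1, 4, 3]" if "has2143 ?T2"
    by (rule has2143_pull[OF that sh2 _ im(1)]) (use sh2 in \<open>auto simp: cycle3_def shown_def\<close>)
  moreover have "occurs ?tgt' [2, 1, 4, 3]" if "has2143 ?T3"
    by (rule has2143_pull[OF that sh3 _ im(2)]) (use sh3 in \<open>auto simp: cycle3_def shown_def\<close>)
  ultimately show ?thesis by blast
qed

lemma checkD1_sound:
  assumes "config src qs p {i, i', r, s} po vo" "checkD1 (points_of 6 p) t"
    and "po i = 2" "po i' = 3" "po r = 4" "po s = 5"
    and "vo (src i') = 2" "vo (src r) = 3" "vo (src i) = 4" "vo (src s) = 5"
    and "i < i'" "i' < r" "r < s" "src i' < src r" "src r < src i" "src i < src s"
    and "\<And>k l. r < k \<Longrightarrow> k < l \<Longrightarrow> src k < src l"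
    and "\<And>k. r < k \<Longrightarrow> k < s \<Longrightarrow> src k < src i"
    and "\<And>k. k < r \<Longrightarrow> src k < src i \<Longrightarrow> k \<le> i \<and> src k \<le> src r \<or> k \<le> i' \<and> src k \<le> src i'"
  shows "\<exists>xs. sorted_wrt (<) xs \<and> code_in (lehmer (map (src(i := src r, r := src s, s := src i)) xs)) t"
proof -
  interpret config src qs p "{i, i', r, s}" po vo by (rule assms(1))
  note b = bounds[of i] bounds[of i'] bounds[of r] bounds[of s]
  have K: "i \<in> pts" "i' \<in> pts" "r \<in> pts" "s \<in> pts" by (auto simp: pts_def)
  have f1: "src q < src s" if "r < q" "q < s" for q using assms(17) that by blast
  have f2: "src s < src q" if "s < q" for q using assms(13,17) that by blast
  have f3: "q \<le> i'" and f4: "src q \<le> src r" if "q < r" "src q < src i" for q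
    using assms(19)[OF that] assms(11,14) by auto
  have f5: "src q \<le> src i'" if "q < r" "src q < src i" "i < q" for q
    using assms(19)[OF that(1,2)] that(3) by auto
  have f6: "src q < src i" if "r < q" "q < s" for q using assms(18) that by blast
  have 1: "(pc r, vc (src r)) \<in> set (cands 4 3 0 100 0 100 [] [] Q)"
    by (rule cands_mem) (use b K assms(3-10) in auto)
  have 2: "(pc s, vc (src s)) \<in> set (cands 5 5 (pc r) 100 (vc (src r)) 100 []
      [Rect (bound.K (pc r)) X Y (bound.K 100), Rect X (bound.K 100) (bound.K 0) Y] Q)"
    by (rule cands_mem) (use b K assms(3-16) in \<open>auto simp: guard_simps dest: f1 f2\<close>)
  have 3: "(pc i, vc (src i)) \<in> set (cands 2 4 0 (pc r) (vc (src r)) (vc (src s)) []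
      [Rect (bound.K 0) (bound.K (pc r)) (bound.K (vc (src r))) Y, Rect (bound.K (pc r)) (bound.K (pc s)) Y (bound.K 100)] Q)"
    by (rule cands_mem) (use b K assms(3-16) in \<open>auto simp: guard_simps dest: f4 f6\<close>)
  have 4: "(pc i', vc (src i')) \<in> set (cands 3 2 (pc i) (pc r) 0 (vc (src r))
      [Rect X (bound.K (pc r)) (bound.K 0) (bound.K (vc (src i)))]
      [Rect (bound.K (pc i)) (bound.K (pc r)) Y (bound.K (vc (src i)))] Q)"
    by (rule cands_mem) (use b K assms(3-16) in \<open>auto simp: guard_simps dest: f3 f5\<close>)
  have inc: "incr_above (pc r) 0 Q" by (rule incr_Q) (use assms(17) in auto)
  let ?tgt = "src(i := src r, r := src s, s := src i)"
  let ?T = "put (pc i) (vc (src r)) (put (pc i') (vc (src i')) (put (pc r) (vc (src s)) (put (pc s) (vc (src i)) Q)))"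
  have "leaf4 Q t (pc i) (vc (src r)) (pc i') (vc (src i')) (pc r) (vc (src s)) (pc s) (vc (src i))"
    using assms(2) 1 2 3 4 inc
    unfolding checkD1_def stepD1_r_def stepD1_s_def stepD1_i1_def stepD1_i2_def Q_def by blast
  then have f: "found1 ?T t" by (simp add: leaf4_def)
  have sh: "shown ?tgt {i, i', r, s} ?T"
    by (intro shown_put shown_Q) (use assms(11-13) in auto)
  show ?thesis
  proof (rule matches_pull[OF sh _ _ found1_sound[OF f]])
    show "?tgt ` pts \<subseteq> src ` pts" using K by auto
  qed (use sh in \<open>auto simp: shown_def\<close>)
qed

lemma checkD2_sound:
  assumes "config src qs p {i, i', r, s} po vo" "checkD2 (points_of 6 p) t"
    and "po i = 2" "po i' = 3" "po r = 4" "po s = 5"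
    and "vo (src r) = 2" "vo (src i) = 3" "vo (src i') = 4" "vo (src s) = 5"
    and "i < i'" "i' < r" "r < s" "src r < src i" "src i < src i'" "src i' < src s"
    and "\<And>k l. r < k \<Longrightarrow> k < l \<Longrightarrow> src k < src l"
    and "\<And>k. r < k \<Longrightarrow> k < s \<Longrightarrow> src k < src i'"
    and "\<And>k. k < r \<Longrightarrow> src k < src i' \<Longrightarrow> k \<le> i \<and> src k \<le> src i \<or> k \<le> i' \<and> src k \<le> src r"
  shows "\<exists>xs. sorted_wrt (<) xs \<and> code_in (lehmer (map (src(i' := src r, r := src s, s := src i')) xs)) t"
proof -
  interpret config src qs p "{i, i', r, s}" po vo by (rule assms(1))
  note b = bounds[of i] bounds[of i'] bounds[of r] bounds[of s]
  have K: "i \<in> pts" "i' \<in> pts" "r \<in> pts" "s \<in> pts" by (auto simp: pts_def)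
  have f1: "src q < src s" if "r < q" "q < s" for q using assms(17) that by blast
  have f2: "src s < src q" if "s < q" for q using assms(13,17) that by blast
  have f3: "q \<le> i'" and f4: "src q \<le> src i" if "q < r" "src q < src i'" for q
    using assms(19)[OF that] assms(11,14) by auto
  have f5: "src q \<le> src r" if "q < r" "src q < src i'" "i < q" for q
    using assms(19)[OF that(1,2)] that(3) by auto
  have f6: "src q < src i'" if "r < q" "q < s" for q using assms(18) that by blast
  have 1: "(pc r, vc (src r)) \<in> set (cands 4 2 0 100 0 100 [] [] Q)"
    by (rule cands_mem) (use b K assms(3-10) in auto)
  have 2: "(pc s, vc (src s)) \<in> set (cands 5 5 (pc r) 100 (vc (src r)) 100 []
      [Rect (bound.K (pc r)) X Y (bound.K 100), Rect X (bound.K 100) (bound.K 0) Y] Q)"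
    by (rule cands_mem) (use b K assms(3-16) in \<open>auto simp: guard_simps dest: f1 f2\<close>)
  have 3: "(pc i', vc (src i')) \<in> set (cands 3 4 0 (pc r) (vc (src r)) (vc (src s)) []
      [Rect X (bound.K (pc r)) (bound.K 0) Y, Rect (bound.K (pc r)) (bound.K (pc s)) Y (bound.K 100)] Q)"
    by (rule cands_mem) (use b K assms(3-16) in \<open>auto simp: guard_simps dest: f3 f6\<close>)
  have 4: "(pc i, vc (src i)) \<in> set (cands 2 3 0 (pc i') (vc (src r)) (vc (src i'))
      [Rect X (bound.K (pc r)) (bound.K (vc (src r))) (bound.K (vc (src i')))]
      [Rect (bound.K 0) (bound.K (pc r)) Y (bound.K (vc (src i')))] Q)"
    by (rule cands_mem) (use b K assms(3-16) in \<open>auto simp: guard_simps dest: f4 f5\<close>)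
  have inc: "incr_above (pc r) 0 Q" by (rule incr_Q) (use assms(17) in auto)
  let ?tgt = "src(i' := src r, r := src s, s := src i')"
  let ?T = "put (pc i) (vc (src i)) (put (pc i') (vc (src r)) (put (pc r) (vc (src s)) (put (pc s) (vc (src i')) Q)))"
  have "leaf4 Q t (pc i) (vc (src i)) (pc i') (vc (src r)) (pc r) (vc (src s)) (pc s) (vc (src i'))"
    using assms(2) 1 2 3 4 inc
    unfolding checkD2_def stepD2_r_def stepD2_s_def stepD2_i1_def stepD2_i2_def Q_def by blast
  then have f: "found1 ?T t" by (simp add: leaf4_def)
  have sh: "shown ?tgt {i, i', r, s} ?T"
    by (intro shown_put shown_Q) (use assms(11-13) in auto)
  show ?thesis
  proof (rule matches_pull[OF sh _ _ found1_sound[OF f]])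
    show "?tgt ` pts \<subseteq> src ` pts" using K by auto
  qed (use sh in \<open>auto simp: shown_def\<close>)
qed

section \<open>Children of a permutation and the patterns they inherit\<close>

section \<open>Children\<close>

text \<open>The last two conditions keep the least value in \<open>occurs_cycle\<close> out of every
  occurrence, both at its place after the last descent and at the front. The bound 8 on the length
  keeps all coordinates below 100.\<close>

definition admissible :: "nat list \<Rightarrow> bool" where
  "admissible p \<longleftrightarrow> p \<in> one_line (length p) \<and> length p \<le> 8 \<and>
     (\<exists>v\<in>set p. v < hd p) \<and> \<not> sorted (tl (dropWhile (\<lambda>v. v \<noteq> 1) p))"

lemma admissible_patterns: "p \<in> set two_vexillary_patterns \<Longrightarrow> admissible p"
proof -
  have "list_all (\<lambda>p. length p \<le> 8 \<and> list_ex (\<lambda>v. v < hd p) p \<and>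
      \<not> sorted (tl (dropWhile (\<lambda>v. v \<noteq> 1) p))) two_vexillary_patterns"
    by (simp add: two_vexillary_patterns_def)
  then show "p \<in> set two_vexillary_patterns \<Longrightarrow> admissible p"
    using two_vexillary_patterns_check(3) by (auto simp: admissible_def list_all_iff list_ex_iff)
qed

lemma admissible_2143: "admissible [2, 1, 4, 3]"
  by (auto simp: admissible_def one_line_def)

lemma occurs_cong:
  assumes "length qs = length p" "sorted_wrt (<) qs" "\<And>q. q \<in> set qs \<Longrightarrow> z (g q) = y q"
    and "\<And>q q'. q \<in> set qs \<Longrightarrow> q' \<in> set qs \<Longrightarrow> q < q' \<Longrightarrow> g q < g q'"
    and "\<forall>i<length p. \<forall>j<length p. y (qs ! i) < y (qs ! j) \<longleftrightarrow> p ! i < p ! j"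
  shows "occurs z p"
  unfolding occurs_def
proof (intro exI conjI)
  show "sorted_wrt (<) (map g qs)"
    unfolding sorted_wrt_map by (rule sorted_wrt_mono_rel[OF _ assms(2)]) (use assms(4) in auto)
  show "\<forall>i<length p. \<forall>j<length p. z (map g qs ! i) < z (map g qs ! j) \<longleftrightarrow> p ! i < p ! j"
    using assms(1,3,5) by simp
qed (use assms(1) in simp)

lemma admissible_first:
  fixes y :: "nat \<Rightarrow> nat"
  assumes "admissible p" "length qs = length p" "sorted_wrt (<) qs"
    and "\<forall>i<length p. \<forall>j<length p. y (qs ! i) < y (qs ! j) \<longleftrightarrow> p ! i < p ! j"
    and "q \<in> set qs"
  shows "\<exists>q'. qs ! 0 \<le> q \<and> qs ! 0 < q' \<and> y q' < y (qs ! 0)"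
proof -
  obtain j where j: "j < length p" "p ! j < hd p"
    using assms(1) by (auto simp: admissible_def in_set_conv_nth)
  then have "p \<noteq> []" by auto
  then have "j \<noteq> 0" using j(2) by (metis hd_conv_nth order.irrefl)
  then have "y (qs ! j) < y (qs ! 0)" "qs ! 0 < qs ! j"
    using j assms(2-4) \<open>p \<noteq> []\<close> by (auto simp: hd_conv_nth sorted_wrt_iff_nth_less)
  moreover have "qs ! 0 \<le> q"
    using assms(2,3,5) \<open>p \<noteq> []\<close> by (cases qs) auto
  ultimately show ?thesis by blast
qed

lemma admissible_after_min:
  assumes "admissible p" "k < length p" "\<And>j. j < length p \<Longrightarrow> p ! k \<le> p ! j"
  shows "\<exists>a b. k < a \<and> a < b \<and> b < length p \<and> p ! b < p ! a"
proof -
  have ol: "set p = {1..length p}" and ns: "\<not> sorted (tl (dropWhile (\<lambda>v. v \<noteq> 1) p))"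
    using assms(1) by (auto simp: admissible_def one_line_def)
  have "1 \<in> set p" using assms(2) ol by auto
  then obtain j where j: "j < length p" "p ! j = 1" by (auto simp: in_set_conv_nth)
  then have "p ! k = 1" using assms(3)[of j] nth_mem[OF assms(2)] ol by auto
  have dist: "distinct p" using assms(1) one_line_distinct by (simp add: admissible_def)
  have "p ! i \<noteq> 1" if "i < k" for i
    using nth_eq_iff_index_eq[OF dist, of i k] that assms(2) \<open>p ! k = 1\<close> by simp
  then have tw: "takeWhile (\<lambda>v. v \<noteq> 1) p = take k p"
    by (rule takeWhile_eq_take_P_nth)
      (use assms(2) \<open>p ! k = 1\<close> in auto)
  have "dropWhile (\<lambda>v. v \<noteq> 1) p = drop k p"
    unfolding dropWhile_eq_drop tw using assms(2) by simp
  then have "\<not> sorted (drop (Suc k) p)" using ns by (simp add: tl_drop drop_Suc)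
  then obtain a b where "a < b" "b < length p - Suc k" "p ! (Suc k + b) < p ! (Suc k + a)"
    by (auto simp: sorted_iff_nth_mono_less not_le)
  then show ?thesis by (intro exI[of _ "Suc k + a"] exI[of _ "Suc k + b"]) auto
qed

lemma not_occurs_id: "admissible p \<Longrightarrow> \<not> occurs id p"
proof
  assume p: "admissible p" and "occurs id p"
  then obtain qs :: "nat list" where qs: "length qs = length p" "sorted_wrt (<) qs"
    "\<forall>i<length p. \<forall>j<length p. id (qs ! i) < id (qs ! j) \<longleftrightarrow> p ! i < p ! j"
    unfolding occurs_def by blast
  have "qs \<noteq> []" using p qs(1) by (auto simp: admissible_def)
  then show False using admissible_first[OF p qs, of "hd qs"] by auto
qed

lemma word_perm_cycle:
  "m \<le> k \<Longrightarrow> k \<le> r \<Longrightarrow> word_perm (rev [m..<Suc r]) (Suc k) = k"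
proof (induction r)
  case 0
  then show ?case by (simp add: word_perm_Cons)
next
  case (Suc r)
  have e: "rev [m..<Suc (Suc r)] = Suc r # rev [m..<Suc r]" using Suc.prems by simp
  show ?case
  proof (cases "k = Suc r")
    case True
    have "word_perm (rev [m..<Suc r]) (Suc k) = Suc k"
      by (rule word_perm_notin) (use True in auto)
    then show ?thesis using True by (simp add: e word_perm_Cons del: upt_Suc)
  next
    case False
    then show ?thesis using Suc by (simp add: e word_perm_Cons del: upt_Suc)
  qed
qed

text \<open>The cycle moves the least value \<open>m\<close> from position r+1 to the front and
  keeps the order of all other entries. At the front it could only be the first and least entry of
  an occurrence, but an admissible pattern does not start with 1. At r+1 it could only play the role
  of 1, but the entries after it increase while those after 1 in the pattern do not.\<close>

lemma occurs_cycle: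
  assumes "y permutes {m..n}" "y (Suc r) = m" "m \<le> r" "\<And>k. r < k \<Longrightarrow> y k < y (Suc k)" "admissible p"
  shows "occurs (y \<circ> word_perm (rev [m..<Suc r])) p \<longleftrightarrow> occurs y p"
proof -
  define z where "z = y \<circ> word_perm (rev [m..<Suc r])"
  have zm: "z m = m" using descending_cycle[OF assms(1-3)] by (simp add: z_def)
  have z1: "z (Suc k) = y k" if "m \<le> k" "k \<le> r" for k
    unfolding z_def comp_apply word_perm_cycle[OF that] ..
  have z2: "z k = y k" if "Suc r < k \<or> k < m" for k
    unfolding z_def comp_apply by (rule arg_cong[OF word_perm_notin]) (use that in auto)
  have yout: "y k = k" if "k < m" for k using permutes_not_in[OF assms(1), of k] that by simp
  have yge: "m \<le> y k" if "m \<le> k" for k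
    using permutes_in_image[OF assms(1), of k] permutes_not_in[OF assms(1), of k] that
    by (cases "k \<le> n") auto
  have ymono: "y a < y b" if "r < a" "a < b" for a b
    using that(2,1) by (induction rule: less_Suc_induct) (use assms(4) in \<open>auto intro: order.strict_trans\<close>)
  have zlow: "z k = k" if "k \<le> m" for k
    using that zm z2[of k] yout[of k] by (cases "k = m") auto
  have zge: "z k \<le> z l" if "k \<le> m" "k < l" for k l
  proof (cases "l \<le> m")
    case True
    then show ?thesis using zlow that by simp
  next
    case False
    have "m \<le> z l"
    proof (cases "l \<le> Suc r")
      case True
      then show ?thesis using z1[of "l - 1"] yge[of "l - 1"] False by simp
    next
      case outer: False
      then show ?thesis using z2[of l] yge[of l] False by simp
    qed
    then show ?thesis using zlow[OF that(1)] that by simp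
  qed
  show ?thesis
    unfolding z_def[symmetric]
  proof
    assume "occurs z p"
    then obtain qs where qs: "length qs = length p" "sorted_wrt (<) qs"
      "\<forall>i<length p. \<forall>j<length p. z (qs ! i) < z (qs ! j) \<longleftrightarrow> p ! i < p ! j"
      unfolding occurs_def by blast
    have gt: "m < q" if q: "q \<in> set qs" for q
    proof (rule ccontr)
      assume "\<not> m < q"
      moreover obtain q' where "qs ! 0 \<le> q" "qs ! 0 < q'" "z q' < z (qs ! 0)"
        using admissible_first[OF assms(5) qs q] by blast
      ultimately show False using zge[of "qs ! 0" q'] by simp
    qed
    have g: "y (if q \<le> Suc r then q - 1 else q) = z q" if "q \<in> set qs" for q
      using gt[OF that] z1[of "q - 1"] z2[of q] by auto
    show "occurs y p"
    proof (rule occurs_cong[where g="\<lambda>q. if q \<le> Suc r then q - 1 else q" and z=y and y=z,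
          OF qs(1,2) g _ qs(3)])
      fix q q' assume "q \<in> set qs" "q' \<in> set qs" "q < q'"
      then show "(if q \<le> Suc r then q - 1 else q) < (if q' \<le> Suc r then q' - 1 else q')"
        using gt[of q] gt[of q'] by auto
    qed
  next
    assume "occurs y p"
    then obtain qs where qs: "length qs = length p" "sorted_wrt (<) qs"
      "\<forall>i<length p. \<forall>j<length p. y (qs ! i) < y (qs ! j) \<longleftrightarrow> p ! i < p ! j"
      unfolding occurs_def by blast
    have yle: "y k \<le> y l" if "k < m" "k < l" for k l
      using that yout[of k] yout[of l] yge[of l] by (cases "l < m") auto
    have ge: "m \<le> q" if q: "q \<in> set qs" for q
    proof (rule ccontr)
      assume "\<not> m \<le> q"
      moreover obtain q' where "qs ! 0 \<le> q" "qs ! 0 < q'" "y q' < y (qs ! 0)"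
        using admissible_first[OF assms(5) qs q] by blast
      ultimately show False using yle[of "qs ! 0" q'] by simp
    qed
    have "Suc r \<notin> set qs"
    proof
      assume "Suc r \<in> set qs"
      then obtain k where k: "k < length p" "qs ! k = Suc r" using qs(1) by (auto simp: in_set_conv_nth)
      have "p ! k \<le> p ! j" if "j < length p" for j
      proof -
        have "qs ! j \<in> set qs" using qs(1) that by simp
        then have "\<not> y (qs ! j) < y (qs ! k)" using yge[OF ge] assms(2) k(2) by (simp add: not_less)
        then show ?thesis using qs(3) that k(1) by (simp add: not_less)
      qed
      then obtain a b where ab: "k < a" "a < b" "b < length p" "p ! b < p ! a"
        using admissible_after_min[OF assms(5) k(1)] by blast
      then have "y (qs ! b) < y (qs ! a)" using qs(3) by simp
      moreover have "Suc r < qs ! a" "qs ! a < qs ! b"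
        using sorted_wrt_nth_less[OF qs(2), of k a] sorted_wrt_nth_less[OF qs(2), of a b] qs(1) ab k(2) by simp_all
      ultimately show False using ymono[of "qs ! a" "qs ! b"] by simp
    qed
    then have ne: "q \<noteq> Suc r" if "q \<in> set qs" for q using that by auto
    have g: "z (if q \<le> r then Suc q else q) = y q" if "q \<in> set qs" for q
      using z1[of q] z2[of q] ge[OF that] ne[OF that] by auto
    show "occurs z p"
    proof (rule occurs_cong[where g="\<lambda>q. if q \<le> r then Suc q else q" and z=z and y=y,
          OF qs(1,2) g _ qs(3)])
      fix q q' assume "q \<in> set qs" "q' \<in> set qs" "q < q'"
      then show "(if q \<le> r then Suc q else q) < (if q' \<le> r then Suc q' else q')"
        using ne[of q] ne[of q'] by auto
    qed
  qed
qed

lemma cycle3_eq: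
  assumes "i \<noteq> r" "r \<noteq> s" "i \<noteq> s"
  shows "cycle3 y i r s = y \<circ> Transposition.transpose r s \<circ> Transposition.transpose i r"
  using assms by (auto simp: cycle3_def fun_eq_iff Transposition.transpose_def)

lemma inj_cycle3: "inj y \<Longrightarrow> i \<noteq> r \<Longrightarrow> r \<noteq> s \<Longrightarrow> i \<noteq> s \<Longrightarrow> inj (cycle3 y i r s)"
  by (simp add: cycle3_eq inj_compose)

text \<open>The position \<open>r\<close> is the last descent, and \<open>s\<close> is the last position with a smaller value.\<close>

locale last_descent =
  fixes y :: "nat \<Rightarrow> nat" and r s :: nat
  assumes inj: "inj y" and rs: "r < s" "y s < y r"
    and incr: "\<And>k l. r < k \<Longrightarrow> k < l \<Longrightarrow> y k < y l"
    and last: "\<And>k. r < k \<Longrightarrow> y k < y r \<Longrightarrow> k \<le> s"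
begin

lemma beyond: "s < k \<Longrightarrow> y r < y k"
  using last[of k] rs(1) inj by (metis inj_eq linorder_not_le nat_neq_iff order.strict_trans)

lemma between: "r < k \<Longrightarrow> k < s \<Longrightarrow> y k < y s"
  using incr by blast

lemma child_incr: "i < r \<Longrightarrow> r < k \<Longrightarrow> k < l \<Longrightarrow> cycle3 y i r s k < cycle3 y i r s l"
  using incr[of k l] beyond[of l] between[of k] rs by (auto simp: cycle3_def)

lemma child_between: "i < r \<Longrightarrow> r < k \<Longrightarrow> k < s \<Longrightarrow> cycle3 y i r s k < y s"
  using between[of k] by (simp add: cycle3_def)

text \<open>Either the occurrence avoids all three changed positions and survives, or check A
  supplies a pattern in the child.\<close>

lemma forward1:
  assumes "i < r" "y i < y s" "\<And>k. k < r \<Longrightarrow> y k < y s \<Longrightarrow> k \<le> i \<and> y k \<le> y i"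
    and "occurs y p" "p \<in> A" "\<And>p. p \<in> A \<Longrightarrow> admissible p \<and> checkA (points_of 6 p) t"
    and "set (codes t) \<subseteq> lehmer ` A"
  shows "\<exists>p\<in>A. occurs (cycle3 y i r s) p"
proof -
  obtain qs where qs: "length qs = length p" "sorted_wrt (<) qs"
    "\<forall>i<length p. \<forall>j<length p. y (qs ! i) < y (qs ! j) \<longleftrightarrow> p ! i < p ! j"
    using assms(4) unfolding occurs_def by blast
  show ?thesis
  proof (cases "{i, r, s} \<inter> set qs = {}")
    case True
    have "occurs (cycle3 y i r s) p"
      by (rule occurs_cong[OF qs(1,2) _ _ qs(3), where g=id]) (use True in \<open>auto simp: cycle3_def\<close>)
    then show ?thesis using assms(5) by blast
  next
    case False
    \<comment> \<open>The offsets list the marked positions and values in increasing order; they are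
      those under which check A enumerates candidates.\<close>
    let ?po = "\<lambda>x. if x = i then 2 else if x = r then 3 else 4"
    let ?vo = "\<lambda>v. if v = y i then 2 else if v = y s then 3 else 4"
    have p: "admissible p" "checkA (points_of 6 p) t" using assms(5,6) by auto
    have ne: "y i \<noteq> y s" "y i \<noteq> y r" "y s \<noteq> y r" using assms(2) rs by auto
    have cfg: "config y qs p {i, r, s} ?po ?vo"
      by unfold_locales (use inj qs p(1) assms(1,2) rs ne in \<open>auto simp: admissible_def\<close>)
    have "\<exists>xs. sorted_wrt (<) xs \<and> code_in (lehmer (map (cycle3 y i r s) xs)) t"
      by (rule checkA_sound[OF cfg p(2), OF _ _ _ _ _ _ _ _ _ _ incr last assms(3)])
        (use assms(1,2) rs ne False in auto)
    then obtain xs where "sorted_wrt (<) xs" "code_in (lehmer (map (cycle3 y i r s) xs)) t" by blast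
    moreover have "inj (cycle3 y i r s)" by (rule inj_cycle3[OF inj]) (use assms(1) rs in auto)
    ultimately show ?thesis
      using code_in_occurs[OF _ _ _ assms(7)] assms(6) one_line_distinct unfolding admissible_def by blast
  qed
qed

text \<open>The parent \<open>y\<close> arises from the child by the inverse cycle. The properties
  of the last descent and of the only branch are restated for the child to meet the hypotheses of
  check B.\<close>

lemma backward1:
  assumes "i < r" "y i < y s" "\<And>k. k < r \<Longrightarrow> y k < y s \<Longrightarrow> k \<le> i \<and> y k \<le> y i"
    and "occurs (cycle3 y i r s) p" "p \<in> A" "\<And>p. p \<in> A \<Longrightarrow> admissible p \<and> checkB (points_of 6 p) t"
    and "set (codes t) \<subseteq> lehmer ` A"
  shows "\<exists>p\<in>A. occurs y p"
proof -
  define x where "x = cycle3 y i r s"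
  have x: "x i = y s" "x r = y i" "x s = y r" "\<And>k. k \<noteq> i \<Longrightarrow> k \<noteq> r \<Longrightarrow> k \<noteq> s \<Longrightarrow> x k = y k"
    using assms(1) rs by (auto simp: x_def cycle3_def)
  have y: "x(i := x r, r := x s, s := x i) = y"
    using x assms(1) rs by (auto simp: fun_eq_iff)
  have injx: "inj x" unfolding x_def by (rule inj_cycle3[OF inj]) (use assms(1) rs in auto)
  obtain qs where qs: "length qs = length p" "sorted_wrt (<) qs"
    "\<forall>i<length p. \<forall>j<length p. x (qs ! i) < x (qs ! j) \<longleftrightarrow> p ! i < p ! j"
    using assms(4) unfolding occurs_def x_def by blast
  show ?thesis
  proof (cases "{i, r, s} \<inter> set qs = {}")
    case True
    have "y q = x q" if "q \<in> set qs" for q using x(4)[of q] True that by (metis disjoint_iff insertCI)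
    then have "occurs y p"
      by (intro occurs_cong[OF qs(1,2) _ _ qs(3), where g=id]) auto
    then show ?thesis using assms(5) by blast
  next
    case False
    let ?po = "\<lambda>x. if x = i then 2 else if x = r then 3 else 4"
    let ?vo = "\<lambda>v. if v = y i then 2 else if v = y s then 3 else 4"
    have p: "admissible p" "checkB (points_of 6 p) t" using assms(5,6) by auto
    have ne: "y i \<noteq> y s" "y i \<noteq> y r" "y s \<noteq> y r" using assms(2) rs by auto
    have cfg: "config x qs p {i, r, s} ?po ?vo"
      by unfold_locales (use injx qs p(1) assms(1,2) rs ne x in \<open>auto simp: admissible_def\<close>)
    have dom: "k \<le> i \<and> x k \<le> x r" if "k < r" "x k < x i" for k
    proof -
      have "k \<noteq> i" "k \<noteq> r" "k \<noteq> s" using that rs by auto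
      then have "x k = y k" by (rule x(4))
      then show ?thesis using assms(3)[of k] that x(1,2) by simp
    qed
    have btw: "x k < x i" if "r < k" "k < s" for k
      using child_between[OF assms(1) that] x(1) by (simp add: x_def)
    have inc: "x k < x l" if "r < k" "k < l" for k l
      using child_incr[OF assms(1) that] by (simp add: x_def)
    have "\<exists>xs. sorted_wrt (<) xs \<and> code_in (lehmer (map (x(i := x r, r := x s, s := x i)) xs)) t"
      by (rule checkB_sound[OF cfg p(2), OF _ _ _ _ _ _ _ _ _ _ inc btw dom])
        (use assms(1,2) rs ne x(1-3) False in auto)
    then show ?thesis
      unfolding y using code_in_occurs[OF _ _ inj assms(7)] assms(6) one_line_distinct
      unfolding admissible_def by blast
  qed
qed

lemma forward2:
  assumes "i < i'" "i' < r" "y i' < y i" "y i < y s"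
    and "\<And>k. k < r \<Longrightarrow> y k < y s \<Longrightarrow> k \<le> i \<and> y k \<le> y i \<or> k \<le> i' \<and> y k \<le> y i'"
    and "occurs y p" "admissible p" "checkC (points_of 6 p)"
  shows "occurs (cycle3 y i r s) [2, 1, 4, 3] \<or> occurs (cycle3 y i' r s) [2, 1, 4, 3]"
proof -
  obtain qs where qs: "length qs = length p" "sorted_wrt (<) qs"
    "\<forall>i<length p. \<forall>j<length p. y (qs ! i) < y (qs ! j) \<longleftrightarrow> p ! i < p ! j"
    using assms(6) unfolding occurs_def by blast
  let ?po = "\<lambda>x. if x = i then 2 else if x = i' then 3 else if x = r then 4 else 5"
  let ?vo = "\<lambda>v. if v = y i' then 2 else if v = y i then 3 else if v = y s then 4 else 5"
  have cfg: "config y qs p {i, i', r, s} ?po ?vo"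
    by unfold_locales (use inj qs assms(1-4,7) rs in \<open>auto simp: admissible_def\<close>)
  show ?thesis
    by (rule checkC_sound[OF cfg assms(8), OF _ _ _ _ _ _ _ _ _ _ _ _ _ _ incr last assms(5)])
      (use assms(1-4) rs in auto)
qed

text \<open>Checks D1 and D2 treat the two children separately, starting from the single pattern
  2143.\<close>

lemma backward2:
  assumes "i < i'" "i' < r" "y i' < y i" "y i < y s"
    and "\<And>k. k < r \<Longrightarrow> y k < y s \<Longrightarrow> k \<le> i \<and> y k \<le> y i \<or> k \<le> i' \<and> y k \<le> y i'"
    and "occurs (cycle3 y i r s) [2, 1, 4, 3] \<or> occurs (cycle3 y i' r s) [2, 1, 4, 3]"
  shows "\<exists>p\<in>set two_vexillary_patterns. occurs y p"
proof -
  let ?po = "\<lambda>x. if x = i then 2 else if x = i' then 3 else if x = r then 4 else 5"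
  let ?vo = "\<lambda>v. if v = y i' then 2 else if v = y i then 3 else if v = y s then 4 else 5"
  define p :: "nat list" where "p = [2, 1, 4, 3]"
  have p: "p \<in> one_line (length p)" "length p \<le> 8"
    using admissible_2143 by (auto simp: p_def admissible_def)
  have ne: "i \<noteq> i'" "i \<noteq> r" "i \<noteq> s" "i' \<noteq> r" "i' \<noteq> s" "r \<noteq> s"
    "y i \<noteq> y i'" "y i \<noteq> y r" "y i \<noteq> y s" "y i' \<noteq> y r" "y i' \<noteq> y s" "y r \<noteq> y s"
    using assms(1-4) rs by auto
  have fin: ?thesis if "\<exists>xs. sorted_wrt (<) xs \<and> code_in (lehmer (map y xs)) trie35"
    using that code_in_occurs[OF _ _ inj codes_trie35] admissible_patterns one_line_distinct
    unfolding admissible_def by blast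
  show ?thesis
    using assms(6)
  proof
    assume "occurs (cycle3 y i r s) [2, 1, 4, 3]"
    define x where "x = cycle3 y i r s"
    have x: "x i = y s" "x r = y i" "x s = y r" "\<And>k. k \<noteq> i \<Longrightarrow> k \<noteq> r \<Longrightarrow> k \<noteq> s \<Longrightarrow> x k = y k"
      using ne by (auto simp: x_def cycle3_def)
    have x4: "x i' = y i'" using x(4)[of i'] ne by simp
    have y: "x(i := x r, r := x s, s := x i) = y" using x ne by (auto simp: fun_eq_iff)
    have injx: "inj x" unfolding x_def by (rule inj_cycle3[OF inj]) (use ne in auto)
    obtain qs where qs: "length qs = length p" "sorted_wrt (<) qs"
      "\<forall>i<length p. \<forall>j<length p. x (qs ! i) < x (qs ! j) \<longleftrightarrow> p ! i < p ! j"
      using \<open>occurs (cycle3 y i r s) [2, 1, 4, 3]\<close> unfolding occurs_def x_def p_def by blast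
    have cfg: "config x qs p {i, i', r, s} ?po ?vo"
      by unfold_locales (use injx qs p assms(1-4) rs ne x(1-3) x4 in auto)
    have dom: "k \<le> i \<and> x k \<le> x r \<or> k \<le> i' \<and> x k \<le> x i'" if "k < r" "x k < x i" for k
    proof -
      have "k \<noteq> i" "k \<noteq> r" "k \<noteq> s" using that rs by auto
      then have "x k = y k" by (rule x(4))
      then show ?thesis using assms(5)[of k] that x(1,2) x4 by simp
    qed
    have btw: "x k < x i" if "r < k" "k < s" for k
      using child_between[OF _ that, of i] assms(1,2) x(1) by (simp add: x_def)
    have inc: "x k < x l" if "r < k" "k < l" for k l
      using child_incr[OF _ that, of i] assms(1,2) by (simp add: x_def)
    have "\<exists>xs. sorted_wrt (<) xs \<and> code_in (lehmer (map (x(i := x r, r := x s, s := x i)) xs)) trie35"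
      by (rule checkD1_sound[OF cfg checkD1_2143[folded p_def], OF _ _ _ _ _ _ _ _ _ _ _ _ _ _ inc btw dom])
        (simp_all add: ne ne[symmetric] x(1-3) x4 assms(1-4) rs)
    then show ?thesis unfolding y by (rule fin)
  next
    assume "occurs (cycle3 y i' r s) [2, 1, 4, 3]"
    define x where "x = cycle3 y i' r s"
    have x: "x i' = y s" "x r = y i'" "x s = y r" "\<And>k. k \<noteq> i' \<Longrightarrow> k \<noteq> r \<Longrightarrow> k \<noteq> s \<Longrightarrow> x k = y k"
      using ne by (auto simp: x_def cycle3_def)
    have x4: "x i = y i" using x(4)[of i] ne by simp
    have y: "x(i' := x r, r := x s, s := x i') = y" using x ne by (auto simp: fun_eq_iff)
    have injx: "inj x" unfolding x_def by (rule inj_cycle3[OF inj]) (use ne in auto)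
    obtain qs where qs: "length qs = length p" "sorted_wrt (<) qs"
      "\<forall>i<length p. \<forall>j<length p. x (qs ! i) < x (qs ! j) \<longleftrightarrow> p ! i < p ! j"
      using \<open>occurs (cycle3 y i' r s) [2, 1, 4, 3]\<close> unfolding occurs_def x_def p_def by blast
    have cfg: "config x qs p {i, i', r, s} ?po ?vo"
      by unfold_locales (use injx qs p assms(1-4) rs ne x(1-3) x4 in auto)
    have dom: "k \<le> i \<and> x k \<le> x i \<or> k \<le> i' \<and> x k \<le> x r" if "k < r" "x k < x i'" for k
    proof -
      have "k \<noteq> i'" "k \<noteq> r" "k \<noteq> s" using that rs by auto
      then have "x k = y k" by (rule x(4))
      then show ?thesis using assms(5)[of k] that x(1,2) x4 by simp
    qed
    have btw: "x k < x i'" if "r < k" "k < s" for k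
      using child_between[OF _ that, of i'] assms(1,2) x(1) by (simp add: x_def)
    have inc: "x k < x l" if "r < k" "k < l" for k l
      using child_incr[OF _ that, of i'] assms(1,2) by (simp add: x_def)
    have "\<exists>xs. sorted_wrt (<) xs \<and> code_in (lehmer (map (x(i' := x r, r := x s, s := x i')) xs)) trie35"
      by (rule checkD2_sound[OF cfg checkD2_2143[folded p_def], OF _ _ _ _ _ _ _ _ _ _ _ _ _ _ inc btw dom])
        (simp_all add: ne ne[symmetric] x(1-3) x4 assms(1-4) rs)
    then show ?thesis unfolding y by (rule fin)
  qed
qed

end

section \<open>Induction along the transition tree\<close>

section \<open>Induction over transitions\<close>

text \<open>The criteria have to be proved together: with two branches, the count is at least 3 iff
  a child has count at least 2, which is the criterion by 2143.\<close>

definition classified :: "(nat \<Rightarrow> nat) \<Rightarrow> bool" where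
  "classified y \<longleftrightarrow> 1 \<le> card (tableaux y) \<and>
     (occurs y [2, 1, 4, 3] \<longleftrightarrow> 2 \<le> card (tableaux y)) \<and>
     ((\<exists>p\<in>set two_vexillary_patterns. occurs y p) \<longleftrightarrow> 3 \<le> card (tableaux y))"

context last_descent
begin

text \<open>The positions \<open>i\<close> for which \<open>(i, r)\<close> is a cover of y
  t_rs.\<close>

definition branches :: "nat set" where
  "branches = {i. i < r \<and> y i < y s \<and> (\<forall>k. i < k \<and> k < r \<longrightarrow> \<not> (y i < y k \<and> y k < y s))}"

lemma finite_branches: "finite branches"
  by (rule finite_subset[of _ "{..<r}"]) (auto simp: branches_def)

lemma branches_decreasing:
  assumes "i \<in> branches" "i' \<in> branches" "i < i'"
  shows "y i' < y i"
proof -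
  have "y i \<noteq> y i'" using inj assms(3) by (auto dest: injD)
  then show ?thesis using assms by (force simp: branches_def)
qed

text \<open>Among the positions from \<open>k\<close> on and left of \<open>r\<close> whose values
  are at least \<open>y k\<close> and below \<open>y s\<close>, the last one is a branch.\<close>

lemma branches_dominate:
  assumes "k < r" "y k < y s"
  shows "\<exists>i\<in>branches. k \<le> i \<and> y k \<le> y i"
proof -
  define C where "C = {i. k \<le> i \<and> i < r \<and> y k \<le> y i \<and> y i < y s}"
  have C: "finite C" "C \<noteq> {}"
    using assms by (auto simp: C_def intro: finite_subset[of _ "{..<r}"])
  have M: "Max C \<in> C" by (rule Max_in[OF C])
  have "l \<le> Max C" if "l \<in> C" for l by (rule Max_ge[OF C(1) that])
  then have "Max C \<in> branches"
    using M unfolding branches_def C_def mem_Collect_eq by (meson leD less_imp_le order.trans)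
  then show ?thesis using M by (auto simp: C_def)
qed

text \<open>The transition equation at u = y t_rs. By the choice of \<open>s\<close>, the only cover
  of u starting at \<open>r\<close> is \<open>(r, s)\<close>, so one side consists of
  \<open>y\<close> alone.\<close>

lemma card_tableaux_branches:
  assumes "y permutes {m..n}" "1 \<le> m" "branches \<noteq> {}"
  shows "card (tableaux y) = (\<Sum>i\<in>branches. card (tableaux (cycle3 y i r s)))"
proof -
  define u where "u = y \<circ> Transposition.transpose r s"
  have u: "u r = y s" "u s = y r" "\<And>k. k \<noteq> r \<Longrightarrow> k \<noteq> s \<Longrightarrow> u k = y k"
    by (auto simp: u_def Transposition.transpose_def)
  have "r < n \<and> s \<le> n \<and> 1 \<le> r"
  proof (intro conjI)
    show s: "s \<le> n"
    proof (rule ccontr)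
      assume "\<not> s \<le> n"
      then have "y s = s" "y r \<le> n \<or> y r = r"
        using permutes_not_in[OF assms(1)] permutes_in_image[OF assms(1), of r] by auto
      then show False using rs \<open>\<not> s \<le> n\<close> by auto
    qed
    then show "r < n" using rs by simp
    show "1 \<le> r" using assms(3) by (auto simp: branches_def)
  qed
  then have r: "r < n" "s \<le> n" "1 \<le> r" by auto
  have y1: "y permutes {1..n}" by (rule permutes_subset[OF assms(1)]) (use assms(2) in auto)
  have "u permutes {1..n}"
    unfolding u_def by (rule permutes_compose[OF permutes_swap_id y1]) (use r rs in auto)
  then have "(\<Sum>j | (r, j) \<in> covers (Suc n) u. card (tableaux (u \<circ> Transposition.transpose r j))) =
      (\<Sum>i | (i, r) \<in> covers (Suc n) u. card (tableaux (u \<circ> Transposition.transpose i r)))"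
    by (rule tableaux_transition) (use r in auto)
  moreover have "{j. (r, j) \<in> covers (Suc n) u} = {s}"
  proof -
    have "j = s" if "r < j" "u r < u j" "\<forall>k. r < k \<and> k < j \<longrightarrow> \<not> (u r < u k \<and> u k < u j)" for j
    proof (cases j s rule: linorder_cases)
      case less
      then show ?thesis using that between[of j] u(1) u(3)[of j] by simp
    next
      case greater
      then show ?thesis using that(3) beyond[of j] rs u(1,2) u(3)[of j] by auto
    qed simp
    moreover have "\<not> (u r < u k \<and> u k < u s)" if "r < k" "k < s" for k
      using between[OF that] u(1) u(3)[of k] that by simp
    ultimately show ?thesis using rs r(2) u(1,2) by (auto simp: covers_def)
  qed
  moreover have "{i. (i, r) \<in> covers (Suc n) u} = branches"
    using r rs u by (auto simp: covers_def branches_def)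
  moreover have "u \<circ> Transposition.transpose r s = y" by (simp add: u_def comp_assoc)
  moreover have "u \<circ> Transposition.transpose i r = cycle3 y i r s" if "i \<in> branches" for i
    using that rs by (subst cycle3_eq) (auto simp: u_def branches_def)
  ultimately show ?thesis by simp
qed

text \<open>The counts add up over the branches. A single branch transfers count and patterns
  unchanged. With two branches, a count of at least 3 requires a child with count at least 2. Values
  decrease along the branches, so three of them form 32154 together with \<open>r\<close> and
  \<open>s\<close>.\<close>

lemma classified_branches:
  assumes "y permutes {m..n}" "1 \<le> m" "branches \<noteq> {}"
    and "\<And>i. i \<in> branches \<Longrightarrow> classified (cycle3 y i r s)"
  shows "classified y"
proof -
  let ?e = "\<lambda>z. card (tableaux z)" and ?bad = "\<lambda>z. \<exists>p\<in>set two_vexillary_patterns. occurs z p"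
  have sum: "?e y = (\<Sum>i\<in>branches. ?e (cycle3 y i r s))"
    by (rule card_tableaux_branches[OF assms(1-3)])
  have pos: "1 \<le> ?e (cycle3 y i r s)" if "i \<in> branches" for i
    using assms(4)[OF that] by (simp add: classified_def)
  have lt: "i < r" "y i < y s" if "i \<in> branches" for i
    using that by (auto simp: branches_def)
  have "card branches \<noteq> 0" using finite_branches assms(3) by simp
  then consider "card branches = 1" | "card branches = 2" | "3 \<le> card branches" by linarith
  then show ?thesis
  proof cases
    case 1
    then obtain i where i: "branches = {i}" by (auto simp: card_1_singleton_iff)
    have dom: "k \<le> i \<and> y k \<le> y i" if "k < r" "y k < y s" for k
      using branches_dominate[OF that] i by simp
    have ir: "i < r" "y i < y s" using lt i by auto
    note h = ir dom
    have "?bad y \<longleftrightarrow> ?bad (cycle3 y i r s)"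
      using forward1[OF h, of _ "set two_vexillary_patterns" trie35]
        backward1[OF h, of _ "set two_vexillary_patterns" trie35]
        admissible_patterns checkA_35 checkB_35 codes_trie35
      unfolding list_all_iff by blast
    moreover have "occurs y [2, 1, 4, 3] \<longleftrightarrow> occurs (cycle3 y i r s) [2, 1, 4, 3]"
      using forward1[OF h, of "[2, 1, 4, 3]" "{[2, 1, 4, 3]}" trie2143]
        backward1[OF h, of "[2, 1, 4, 3]" "{[2, 1, 4, 3]}" trie2143]
        admissible_2143 checkA_2143 checkB_2143 codes_trie2143 by blast
    ultimately show ?thesis
      using assms(4)[of i] sum unfolding i by (simp add: classified_def)
  next
    case 2
    then obtain a b where "branches = {a, b}" "a \<noteq> b" by (auto simp: card_2_iff)
    then obtain i i' where ii: "branches = {i, i'}" "i < i'"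
      by (metis insert_commute linorder_neqE_nat)
    have dec: "y i' < y i" using branches_decreasing ii by auto
    have h: "i < i'" "i' < r" "y i' < y i" "y i < y s" using lt ii dec by auto
    have dom: "k \<le> i \<and> y k \<le> y i \<or> k \<le> i' \<and> y k \<le> y i'" if "k < r" "y k < y s" for k
      using branches_dominate[OF that] ii by simp
    have e: "?e y = ?e (cycle3 y i r s) + ?e (cycle3 y i' r s)" using sum ii by simp
    have ge: "1 \<le> ?e (cycle3 y i r s)" "1 \<le> ?e (cycle3 y i' r s)" using pos ii by auto
    have o: "occurs y [2, 1, 4, 3]" by (rule occurs_2143I[of i i' r s]) (use h rs in auto)
    have "?bad y \<longleftrightarrow> occurs (cycle3 y i r s) [2, 1, 4, 3] \<or> occurs (cycle3 y i' r s) [2, 1, 4, 3]"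
      using forward2[OF h dom] backward2[OF h dom] admissible_patterns checkC_35
      unfolding list_all_iff by blast
    then have "?bad y \<longleftrightarrow> 2 \<le> ?e (cycle3 y i r s) \<or> 2 \<le> ?e (cycle3 y i' r s)"
      using assms(4)[of i] assms(4)[of i'] ii unfolding classified_def by blast
    then show ?thesis using e ge o unfolding classified_def by linarith
  next
    case 3
    have e: "3 \<le> ?e y"
    proof -
      have "card branches \<le> ?e y"
        unfolding sum using sum_mono[of branches "\<lambda>_. 1" "\<lambda>i. ?e (cycle3 y i r s)"] pos by simp
      then show ?thesis using 3 by simp
    qed
    obtain B where "B \<subseteq> branches" "card B = 3" using 3 by (meson obtain_subset_with_card_n)
    moreover have "finite B" using \<open>card B = 3\<close> by (intro card_ge_0_finite) simp
    ultimately have B: "length (sorted_list_of_set B) = 3" "set (sorted_list_of_set B) \<subseteq> branches"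
      "sorted_wrt (<) (sorted_list_of_set B)" by auto
    have "\<exists>a b c. xs = [a, b, c]" if "length xs = 3" for xs :: "nat list"
      using that by (auto simp: numeral_3_eq_3 length_Suc_conv)
    then obtain a b c where abc: "sorted_list_of_set B = [a, b, c]" using B(1) by blast
    then have lt3: "a < b" "b < c" "a \<in> branches" "b \<in> branches" "c \<in> branches" using B by auto
    then have v: "y b < y a" "y c < y b" "c < r" "y a < y s" using branches_decreasing lt by auto
    have "occurs y [2, 1, 4, 3]" by (rule occurs_2143I[of a b r s]) (use lt3 v rs in auto)
    moreover have "occurs y [3, 2, 1, 5, 4]"
      unfolding occurs_def
      by (rule exI[of _ "[a, b, c, r, s]"]) (use lt3 v rs in \<open>auto simp: less_Suc_eq numeral_eq_Suc\<close>)
    moreover have "[3, 2, 1, 5, 4] \<in> set two_vexillary_patterns"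
      by (simp add: two_vexillary_patterns_def)
    ultimately show ?thesis using e unfolding classified_def by auto
  qed
qed

lemma cycle3_permutes:
  assumes "y permutes {m..n}" "branches \<subseteq> {m..}" "i \<in> branches" "s \<le> n"
  shows "cycle3 y i r s permutes {m..n}"
proof -
  have "m \<le> i" "i < r" using assms(2,3) by (auto simp: branches_def)
  then show ?thesis
    using rs assms(1,4) by (subst cycle3_eq) (auto intro!: permutes_compose permutes_swap_id)
qed

end

lemma classified_id: "classified id"
proof -
  have "\<not> occurs id p" if "p \<in> set two_vexillary_patterns" for p
    using not_occurs_id admissible_patterns that by blast
  then show ?thesis
    using not_occurs_id[OF admissible_2143] by (auto simp: classified_def tableaux_id)
qed

lemma last_descent_exists:
  assumes "y permutes {m..n}" "\<And>k l. r < k \<Longrightarrow> k < l \<Longrightarrow> y k < y l" "y (Suc r) < y r"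
  shows "\<exists>s\<le>n. m \<le> r \<and> last_descent y r s"
proof -
  let ?S = "{k. r < k \<and> y k < y r}"
  have "r \<le> n"
    using assms(3) permutes_not_in[OF assms(1), of r] permutes_not_in[OF assms(1), of "Suc r"]
    by (cases "r \<le> n") auto
  have bnd: "k \<le> n" if "r < k" "y k < y r" for k
  proof (rule ccontr)
    assume "\<not> k \<le> n"
    then have "y k = k" using permutes_not_in[OF assms(1), of k] by simp
    moreover have "y r \<le> n"
      using permutes_in_image[OF assms(1), of r] permutes_not_in[OF assms(1), of r] \<open>r \<le> n\<close>
      by (cases "r \<in> {m..n}") auto
    ultimately show False using that \<open>\<not> k \<le> n\<close> by simp
  qed
  then have S: "finite ?S" "?S \<noteq> {}" using assms(3) by (auto intro: finite_subset[of _ "{..n}"])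
  have "last_descent y r (Max ?S)"
  proof
    show "inj y" by (rule permutes_inj[OF assms(1)])
  qed (use Max_in[OF S] Max_ge[OF S(1)] assms(2) in auto)
  moreover have "m \<le> r"
  proof (rule ccontr)
    assume "\<not> m \<le> r"
    then have "y r = r" using permutes_not_in[OF assms(1), of r] by simp
    moreover have "r < y (Suc r)"
      using permutes_in_image[OF assms(1), of "Suc r"] permutes_not_in[OF assms(1), of "Suc r"] \<open>\<not> m \<le> r\<close>
      by (cases "Suc r \<in> {m..n}") auto
    ultimately show False using assms(3) by simp
  qed
  ultimately show ?thesis using bnd Max_in[OF S] by blast
qed

text \<open>Lexicographic induction on \<open>Suc n - m\<close>, on a bound \<open>r\<close> for the
  last descent, and on \<open>y r\<close>. If there is no descent at \<open>r\<close>, the bound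
  drops; passing to a child lowers the value at \<open>r\<close>; removing the forced first column
  raises \<open>m\<close>.\<close>

lemma classified_permutation:
  assumes "y permutes {m..n}" "1 \<le> m" "\<And>k l. r < k \<Longrightarrow> k < l \<Longrightarrow> y k < y l"
  shows "classified y"
proof -
  define R where "R = less_than <*lex*> less_than <*lex*> less_than"
  have wf: "wf R" by (auto simp: R_def)
  have "classified y" if "x = (Suc n - m, r, y r)" "y permutes {m..n}" "1 \<le> m"
    "\<And>k l. r < k \<Longrightarrow> k < l \<Longrightarrow> y k < y l" for x m r y
    using that
  proof (induction x arbitrary: m r y rule: wf_induct_rule[OF wf])
    case (1 x m r y)
    note y = 1(3) and m = 1(4) and incr = 1(5)
    have IH: "classified y'" if "((Suc n - m', r', y' r'), (Suc n - m, r, y r)) \<in> R"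
      "y' permutes {m'..n}" "1 \<le> m'" "\<And>k l. r' < k \<Longrightarrow> k < l \<Longrightarrow> y' k < y' l" for m' r' y'
      by (rule 1(1)[of _ m' r' y'])  (use that 1(2) in simp_all)
    have inj: "inj y" by (rule permutes_inj[OF y])
    show ?case
    proof (cases "y (Suc r) < y r")
      case False
      then have asc: "y r < y (Suc r)" using inj by (metis inj_eq n_not_Suc_n nat_neq_iff)
      have incr': "y k < y l" if "r \<le> k" "k < l" for k l
      proof (cases "k = r")
        case True
        have "y r < y l"
        proof (cases "l = Suc r")
          case False
          then have "y (Suc r) < y l" using incr[of "Suc r" l] that True by simp
          then show ?thesis using asc by simp
        qed (simp add: asc)
        then show ?thesis using True by simp
      next
        case False
        then show ?thesis using incr[of k l] that by simp
      qed
      show ?thesis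
      proof (cases r)
        case 0
        have "y = id"
        proof (rule permutes_no_descent)
          show "y permutes {..n}" by (rule permutes_subset[OF y]) auto
        qed (use incr' 0 in auto)
        show ?thesis unfolding \<open>y = id\<close> by (rule classified_id)
      next
        case (Suc r')
        show ?thesis
          by (rule IH[of m r']) (use y m incr' Suc in \<open>auto simp: R_def\<close>)
      qed
    next
      case True
      then obtain s where s: "s \<le> n" "m \<le> r" "last_descent y r s"
        using last_descent_exists[OF y incr] by blast
      interpret last_descent y r s by (rule s(3))
      show ?thesis
      proof (cases "\<exists>k. m \<le> k \<and> k < r \<and> y k < y s")
        case True
        then obtain k where k: "m \<le> k" "k < r" "y k < y s" by blast
        then have ne: "branches \<noteq> {}" using branches_dominate by blast
        have sub: "branches \<subseteq> {m..}"
        proof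
          fix i assume i: "i \<in> branches"
          have "m \<le> y k" using permutes_in_image[OF y, of k] k(1,2) s rs by auto
          moreover have "\<not> (i < k \<and> y i < y k)" using i k by (auto simp: branches_def)
          ultimately show "i \<in> {m..}" using permutes_not_in[OF y, of i] k(1) by (cases "i < m") auto
        qed
        have "classified (cycle3 y i r s)" if i: "i \<in> branches" for i
        proof (rule IH[of m r])
          have "i < r" "y i < y s" using i by (auto simp: branches_def)
          then show "((Suc n - m, r, cycle3 y i r s r), (Suc n - m, r, y r)) \<in> R"
            using rs by (auto simp: R_def cycle3_def)
          show "cycle3 y i r s permutes {m..n}" by (rule cycle3_permutes[OF y sub i s(1)])
          show "cycle3 y i r s k < cycle3 y i r s l" if "r < k" "k < l" for k l
            by (rule child_incr[OF \<open>i < r\<close> that])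
        qed (rule m)
        then show ?thesis by (rule classified_branches[OF y m ne])
      next
        case no: False
        have "m \<in> y ` {m..n}" using permutes_image[OF y] s rs by auto
        then obtain k where k: "m \<le> k" "k \<le> n" "y k = m" by auto
        have r1: "Suc r \<in> {m..n}" using s rs by auto
        then have ge: "m \<le> y (Suc r)" using permutes_in_image[OF y, of "Suc r"] by auto
        have les: "y (Suc r) \<le> y s" using incr[of "Suc r" s] rs by (cases "s = Suc r") auto
        \<comment> \<open>The value \<open>m\<close> is not left of \<open>r\<close>, since no value
          there is below \<open>y s\<close>, and not at \<open>r\<close>, since
          \<open>y s < y r\<close>. To the right of \<open>r\<close> the values increase, so it
          comes immediately after \<open>r\<close>.\<close>
        have "k = Suc r"
        proof (rule ccontr)
          assume ne: "k \<noteq> Suc r"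
          then have "y k \<noteq> y (Suc r)" using inj by (auto dest: injD)
          then have lt: "y k < y (Suc r)" using ge k(3) by simp
          then have "k \<noteq> r" "\<not> k < r" using rs les no k(1) by auto
          then show False using incr[of "Suc r" k] ne lt by auto
        qed
        then have ym: "y (Suc r) = m" using k by simp
        have inc: "y k < y (Suc k)" if "r < k" for k using incr that by simp
        let ?z = "y \<circ> word_perm (rev [m..<Suc r])"
        have zp: "?z permutes {Suc m..n}" and ez: "card (tableaux y) = card (tableaux ?z)"
          using card_tableaux_cycle[OF y ym s(2) inc] by auto
        have "classified ?z"
        \<comment> \<open>As the leading component decreases, the bound for the last descent may be
          reset to \<open>n\<close>.\<close>
        proof (rule IH[of "Suc m" n])
          show "((Suc n - Suc m, n, ?z n), (Suc n - m, r, y r)) \<in> R"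
            using s rs by (auto simp: R_def)
          show "?z k < ?z l" if "n < k" "k < l" for k l
            using that permutes_not_in[OF zp, of k] permutes_not_in[OF zp, of l] by simp
        qed (use zp m in auto)
        moreover have "occurs ?z p \<longleftrightarrow> occurs y p" if "admissible p" for p
          by (rule occurs_cycle[OF y ym s(2) inc that])
        ultimately show ?thesis
          using ez admissible_2143 admissible_patterns unfolding classified_def by simp
      qed
    qed
  qed
  then show ?thesis using assms by blast
qed

definition inverse_pattern :: "nat list \<Rightarrow> nat list" where
  "inverse_pattern p = map (\<lambda>v. Suc (length (takeWhile (\<lambda>x. x \<noteq> v) p))) [1..<Suc (length p)]"

text \<open>The criterion is obtained for \<open>inv w\<close>; this closure property carries it
  over to \<open>w\<close>.\<close>

lemma inverse_pattern_closed:
  "p \<in> set two_vexillary_patterns \<Longrightarrow> inverse_pattern p \<in> set two_vexillary_patterns"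
proof -
  have "list_all (\<lambda>p. inverse_pattern p \<in> set two_vexillary_patterns) two_vexillary_patterns"
    by (simp add: two_vexillary_patterns_def inverse_pattern_def upt_rec)
  then show "p \<in> set two_vexillary_patterns \<Longrightarrow> inverse_pattern p \<in> set two_vexillary_patterns"
    by (simp add: list_all_iff)
qed

text \<open>Positions and values change roles: the values of the occurrence, in increasing order,
  are the positions of the inverse one.\<close>

lemma occurs_inverse:
  assumes "occurs w p" "p \<in> one_line (length p)" "inj w"
  shows "occurs (inv w) (inverse_pattern p)"
proof -
  obtain qs where qs: "length qs = length p" "sorted_wrt (<) qs"
    "\<And>i j. i < length p \<Longrightarrow> j < length p \<Longrightarrow> w (qs ! i) < w (qs ! j) \<longleftrightarrow> p ! i < p ! j"
    using assms(1) unfolding occurs_def by blast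
  define f where "f i = length (takeWhile (\<lambda>x. x \<noteq> Suc i) p)" for i
  have f: "f i < length p \<and> p ! f i = Suc i" if "i < length p" for i
  proof -
    have "Suc i \<in> set p" using assms(2) that by (simp add: one_line_def)
    then have "dropWhile (\<lambda>x. x \<noteq> Suc i) p \<noteq> []" by (simp add: dropWhile_eq_Nil_conv)
    moreover have "length (takeWhile (\<lambda>x. x \<noteq> Suc i) p) + length (dropWhile (\<lambda>x. x \<noteq> Suc i) p) = length p"
      by (metis length_append takeWhile_dropWhile_id)
    ultimately have "f i < length p" unfolding f_def by (metis length_greater_0_conv less_add_same_cancel1)
    then show ?thesis using nth_length_takeWhile[of "\<lambda>x. x \<noteq> Suc i" p] by (simp add: f_def)
  qed
  have ip: "length (inverse_pattern p) = length p"
    "\<And>i. i < length p \<Longrightarrow> inverse_pattern p ! i = Suc (f i)"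
    by (simp_all add: inverse_pattern_def f_def del: upt_Suc)
  have mono: "qs ! a < qs ! b \<longleftrightarrow> a < b" if "a < length p" "b < length p" for a b
    using qs(1,2) that by (metis linorder_neqE_nat order.asym sorted_wrt_nth_less)
  let ?vs = "map (\<lambda>i. w (qs ! f i)) [0..<length p]"
  show ?thesis
    unfolding occurs_def
  proof (intro exI[of _ ?vs] conjI allI impI)
    show "length ?vs = length (inverse_pattern p)" by (simp add: ip)
    show "sorted_wrt (<) ?vs"
      unfolding sorted_wrt_iff_nth_less using qs(3) f by simp
    fix i j assume "i < length (inverse_pattern p)" "j < length (inverse_pattern p)"
    then show "inv w (?vs ! i) < inv w (?vs ! j) \<longleftrightarrow> inverse_pattern p ! i < inverse_pattern p ! j"
      using f mono ip assms(3) by (simp add: inv_f_f)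
  qed
qed

text \<open>The list of ranks satisfies the description in \<open>fl\<close>, and any list that does
  consists of the ranks (\<open>one_line_rank\<close>).\<close>

lemma fl_eq_iff:
  fixes x :: "'a::linorder list"
  assumes "distinct x"
  shows "fl x = v \<longleftrightarrow> v \<in> one_line (length x) \<and>
     (\<forall>i<length x. \<forall>j<length x. v ! i < v ! j \<longleftrightarrow> x ! i < x ! j)" (is "_ \<longleftrightarrow> ?P v")
proof -
  have rank: "v ! i = card {j. j < length x \<and> x ! j \<le> x ! i}" if "?P v" "i < length x" for v i
  proof -
    have l: "length v = length x" using that(1) by (simp add: one_line_def)
    have "{j. j < length v \<and> v ! j \<le> v ! i} = {j. j < length x \<and> x ! j \<le> x ! i}"
      using that by (simp add: l linorder_not_less[symmetric] cong: conj_cong)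
    then show ?thesis using one_line_rank[of v i] that l by simp
  qed
  have unique: "v = v'" if "?P v" "?P v'" for v v'
  proof (rule nth_equalityI)
    have l: "length v = length x" "length v' = length x" using that by (simp_all add: one_line_def)
    then show "length v = length v'" by simp
    fix i assume "i < length v"
    then have i: "i < length x" using l by simp
    show "v ! i = v' ! i" unfolding rank[OF that(1) i] rank[OF that(2) i] ..
  qed
  define u where "u = map (\<lambda>i. card {j. j < length x \<and> x ! j \<le> x ! i}) [0..<length x]"
  have less: "u ! i < u ! j" if "i < length x" "j < length x" "x ! i < x ! j" for i j
  proof -
    have "{k. k < length x \<and> x ! k \<le> x ! i} \<subset> {k. k < length x \<and> x ! k \<le> x ! j}"
    proof (rule psubsetI)
      have "x ! k \<le> x ! j" if "x ! k \<le> x ! i" for k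
        using that \<open>x ! i < x ! j\<close> by order
      then show "{k. k < length x \<and> x ! k \<le> x ! i} \<subseteq> {k. k < length x \<and> x ! k \<le> x ! j}" by blast
      have "j \<in> {k. k < length x \<and> x ! k \<le> x ! j}" "j \<notin> {k. k < length x \<and> x ! k \<le> x ! i}"
        using that by auto
      then show "{k. k < length x \<and> x ! k \<le> x ! i} \<noteq> {k. k < length x \<and> x ! k \<le> x ! j}" by metis
    qed
    then show ?thesis using that by (simp add: u_def psubset_card_mono)
  qed
  have order: "u ! i < u ! j \<longleftrightarrow> x ! i < x ! j" if "i < length x" "j < length x" for i j
  proof (cases "x ! i" "x ! j" rule: linorder_cases)
    case equal
    then have "i = j" using assms that by (simp add: nth_eq_iff_index_eq)
    then show ?thesis by simp
  qed (use less[OF that] less[OF that(2,1)] in auto)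
  have "distinct u"
    unfolding distinct_conv_nth
  proof (intro allI impI)
    fix i j assume "i < length u" "j < length u" "i \<noteq> j"
    then have ij: "i < length x" "j < length x" "i \<noteq> j" by (simp_all add: u_def)
    then have "x ! i \<noteq> x ! j" using assms by (simp add: nth_eq_iff_index_eq)
    then show "u ! i \<noteq> u ! j" using order[of i j] order[of j i] ij by (metis linorder_neq_iff)
  qed
  have "set u \<subseteq> {1..length x}"
  proof -
    have "card {j. j < length x \<and> x ! j \<le> x ! i} \<in> {1..length x}" if "i < length x" for i
    proof -
      have "card {j. j < length x \<and> x ! j \<le> x ! i} \<le> card {..<length x}"
        by (rule card_mono) auto
      moreover have "card {j. j < length x \<and> x ! j \<le> x ! i} > 0"
        using that by (auto simp: card_gt_0_iff)
      ultimately show ?thesis by simp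
    qed
    then show ?thesis by (auto simp: u_def)
  qed
  moreover have "card (set u) = length x" using distinct_card[OF \<open>distinct u\<close>] by (simp add: u_def)
  ultimately have "set u = {1..length x}" by (intro card_subset_eq) auto
  then have u: "?P u" using order by (simp add: one_line_def u_def)
  have "fl x = u" unfolding fl_def
  proof (rule the_equality)
    show "v = u" if "?P v" for v by (rule unique[OF that u])
  qed (rule u)
  then show ?thesis using u unique[OF _ u, of v] by metis
qed

text \<open>\<open>occurs\<close> admits position 0, but \<open>w\<close> fixes 0, and the first
  point of an occurrence of an admissible pattern is followed by a smaller value.\<close>

lemma contains_pattern_iff_occurs:
  assumes "w permutes {1..n}" "admissible p"
  shows "contains_pattern w p \<longleftrightarrow> occurs w p"
proof -
  have inj: "inj w" by (rule permutes_inj[OF assms(1)])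
  have fl: "fl (map w qs) = p \<longleftrightarrow>
      (\<forall>i<length p. \<forall>j<length p. w (qs ! i) < w (qs ! j) \<longleftrightarrow> p ! i < p ! j)"
    if "length qs = length p" "sorted_wrt (<) qs" for qs
  proof -
    have "distinct (map w qs)"
      using that(2) inj strict_sorted_iff[of qs] by (simp add: distinct_map inj_on_def inj_def)
    then have "fl (map w qs) = p \<longleftrightarrow> p \<in> one_line (length qs) \<and>
        (\<forall>i<length qs. \<forall>j<length qs. p ! i < p ! j \<longleftrightarrow> w (qs ! i) < w (qs ! j))"
      using fl_eq_iff[of "map w qs" p] by simp
    then show ?thesis using assms(2) that(1) unfolding admissible_def by auto
  qed
  have pos: "set qs \<subseteq> {1..}" if qs: "length qs = length p" "sorted_wrt (<) qs"
    "\<forall>i<length p. \<forall>j<length p. w (qs ! i) < w (qs ! j) \<longleftrightarrow> p ! i < p ! j" for qs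
  proof
    fix q assume q: "q \<in> set qs"
    have "w 0 = 0" using permutes_not_in[OF assms(1), of 0] by simp
    then show "q \<in> {1..}"
      using admissible_first[OF assms(2) qs q] by (cases "q = 0") auto
  qed
  show ?thesis
  proof
    assume "contains_pattern w p"
    then obtain qs where qs: "length qs = length p" "sorted_wrt (<) qs" "fl (map w qs) = p"
      unfolding contains_pattern_def by blast
    then show "occurs w p"
      unfolding occurs_def using fl[OF qs(1,2)] by blast
  next
    assume "occurs w p"
    then obtain qs where qs: "length qs = length p" "sorted_wrt (<) qs"
      "\<forall>i<length p. \<forall>j<length p. w (qs ! i) < w (qs ! j) \<longleftrightarrow> p ! i < p ! j"
      unfolding occurs_def by blast
    then show "contains_pattern w p"
      unfolding contains_pattern_def using fl[OF qs(1,2)] pos[OF qs] by blast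
  qed
qed

theorem theorem5p12:
  fixes w :: "nat \<Rightarrow> nat"
  assumes "w \<in> S_infty"
  shows "two_vexillary w \<longleftrightarrow> (\<forall>v\<in>set two_vexillary_patterns. avoids_pattern w v)"
proof -
  obtain n where w: "w permutes {1..n}" using assms by (auto simp: S_infty_def)
  have iw: "inv w permutes {1..n}" by (rule permutes_inv[OF w])
  have inj: "inj w" "inj (inv w)" "inv (inv w) = w"
    using permutes_inj[OF w] permutes_inj[OF iw] permutes_inv_inv[OF w] by auto
  have "classified (inv w)"
  proof (rule classified_permutation[OF iw, of n])
    show "inv w k < inv w l" if "n < k" "k < l" for k l
      using that permutes_not_in[OF iw, of k] permutes_not_in[OF iw, of l] by simp
  qed simp
  then have e: "two_vexillary w \<longleftrightarrow> \<not> (\<exists>p\<in>set two_vexillary_patterns. occurs (inv w) p)"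
    unfolding two_vexillary_def EG_def card_EG_tableaux[OF w] classified_def by linarith
  have "\<exists>p\<in>set two_vexillary_patterns. occurs (inv v) p"
    if v: "\<exists>p\<in>set two_vexillary_patterns. occurs v p" "inj v" for v
  proof -
    obtain p where p: "p \<in> set two_vexillary_patterns" "occurs v p" using v(1) by blast
    have "occurs (inv v) (inverse_pattern p)"
      by (rule occurs_inverse[OF p(2) _ v(2)]) (use p(1) two_vexillary_patterns_check(3) in blast)
    then show ?thesis using inverse_pattern_closed[OF p(1)] by blast
  qed
  from this[of w] this[of "inv w"]
  have "(\<exists>p\<in>set two_vexillary_patterns. occurs (inv w) p) \<longleftrightarrow>
      (\<exists>p\<in>set two_vexillary_patterns. occurs w p)"
    unfolding inj(3) using inj(1,2) by blast
  then have "two_vexillary w \<longleftrightarrow> (\<forall>p\<in>set two_vexillary_patterns. \<not> occurs w p)"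
    using e by blast
  also have "\<dots> \<longleftrightarrow> (\<forall>p\<in>set two_vexillary_patterns. avoids_pattern w p)"
    by (rule ball_cong) (simp_all add: avoids_pattern_def contains_pattern_iff_occurs[OF w] admissible_patterns)
  finally show ?thesis .
qed

end
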